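(* Let $u$ be the entropy solution of $u_t+f(u)_x=0$, $u|_{t=0}=\varphi\in L^\infty(\mathbb{R})$, and (when $\bar\Phi>-\infty$) let $\tilde u$ be the entropy solution of $\tilde u_t+f(\tilde u)_x=0$, $\tilde u|_{t=0}=\bar\Phi'$. Assume that $\overline u_r=\underline u_r$, $\overline u_l=\underline u_l$, and that $$\frac1x\int_y^{y+x}\varphi\,d\xi\to\underline u_r\ \text{ as }x\to\infty,\text{ uniformly in }y\ge0;\qquad\frac1x\int_y^{y+x}\varphi\,d\xi\to\overline u_l\ \text{ as }x\to-\infty,\text{ uniformly in }y\le0.$$ (i) Suppose $\overline u_l<\underline u_r$, or $\overline u_l=\underline u_r$ with $\mathcal{K}_0\ne\varnothing$. Then the asymptotic profile of $u$ in the $L^\infty$-norm is the rarefaction-constant solution $\tilde u$, in the following sense, with $\mathbb{R}\times\mathbb{R}^+=\mathcal{K}\cup(\bigcup_n\mathcal{H}_{(e_n,h_n)})$: (a) On $\mathcal{K}$, $u(x,t)=\tilde u(x,t)=(f')^{-1}\big(\frac{x-x_0}{t}\big)$ with $x_0\in\mathcal{K}_0$ (for $(x,t)$ on a divide emitting from $x_0$). (b) If there exists $\mathcal{H}_{(e_n,h_n)}$ with finite $e_n,h_n$, then $\tilde u=c_n$ there and, as $t\to\infty$, $u(x\pm,t)=c_n+o(1)$ uniformly in $x$ for $(x,t)\in\mathcal{H}_{(e_n,h_n)}$. (c) If there exists $\mathcal{H}_{(e_n,h_n)}$ with finite $e_n$ and $h_n=\infty$, then $\tilde u=\underline u_r$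 there and, as $t\to\infty$, $u(x\pm,t)=\underline u_r+o(1)$ uniformly in $x$ for $(x,t)\in\mathcal{H}_\infty$. (d) If there exists $\mathcal{H}_{(e_n,h_n)}$ with finite $h_n$ and $e_n=-\infty$, then $\tilde u=\overline u_l$ there and, as $t\to\infty$, $u(x\pm,t)=\overline u_l+o(1)$ uniformly in $x$ for $(x,t)\in\mathcal{H}_{-\infty}$. (ii) Suppose $\overline u_l>\underline u_r$, or $\overline u_l=\underline u_r$ with $\mathcal{K}_0=\varnothing$. Then $u$ turns into a single shock asymptotically in $\mathbb{R}\times\mathbb{R}^+$ (any two shocks coincide after a finite time), and: (a) If $\overline u_l=\underline u_r$, then, as $t\to\infty$, $u(x\pm,t)=\underline u_r+o(1)$ uniformly in $x\in\mathbb{R}$. (b) If $\overline u_l>\underline u_r$, then, as $t\to\infty$, $u(x\pm,t)=\overline u_l+o(1)$ uniformly in $x<x(t)$ and $u(x\pm,t)=\underline u_r+o(1)$ uniformly in $x>x(t)$, where $x=x(t)$, $t\in[0,\infty)$, is a forward generalized characteristic emitting from any point on the $x$-axis.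
   Context: Setting: $f\in C^2(\mathbb{R})$, $f''\ge0$, $\mathcal{L}\{f''=0\}=0$, so $f'$ is strictly increasing; $\mathbb R^+=(0,\infty)$. For $t>0$: $E(u;x,t)=t\int_0^u f''(s)(\varphi(x-tf'(s))-s)\,ds$; $\mathcal{U}(x,t)$ is the (nonempty compact) set of maximizers of $E(\cdot\,;x,t)$; the entropy solution with data $\varphi$ is $u(x,t)=\inf\mathcal{U}(x,t)$, with $u(x-,t)=\sup\mathcal{U}(x,t)$, $u(x+,t)=\inf\mathcal{U}(x,t)$ (the same formula with data $\bar\Phi'$ gives $\tilde u$). $\Phi(x)=\int_0^x\varphi\,d\xi$; $\overline u_l,\underline u_l$ are the limsup and liminf of $\Phi(x)/x$ as $x\to-\infty$; $\overline u_r,\underline u_r$ those as $x\to\infty$. $\bar\Phi(x)=\lim_{N\to\infty}\bar\Phi_N(x)\in[-\infty,\infty)$, where $\bar\Phi_N$ is the convex hull (largest convex minorant) of $\Phi|_{[-N,N]}$ on $[-N,N]$ and equals $\Phi$ for $|x|\ge N$. $\mathcal{K}_0=\{x_0:\Phi(x_0)=\bar\Phi(x_0)\}$ (closed). $L_c(x_0)=\{(x,t):x=x_0+tf'(c),\ t>0\}$ is a divide emitting from $x_0$ if $\mathcal{U}(x,t)=\{c\}$ on all of it; $\mathcal{K}$ is the union of all divides (they emit exactly from points of $\mathcal K_0$). If $\mathcal{K}_0\ne\varnothing$: $\mathbb{R}\setminus\mathcal{K}_0=\bigcup_n(e_n,h_n)$ (components); for bounded $(e_n,h_n)$, $c_n=\frac{\Phi(h_n)-\Phi(e_n)}{h_n-e_n}$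 and $\mathcal{H}_{(e_n,h_n)}=\{t>0,\ e_n+tf'(c_n)<x<h_n+tf'(c_n)\}$; if $h_n=\infty$ (i.e. $x_0^+=\sup\mathcal{K}_0<\infty$), $\mathcal{H}_{(e_n,h_n)}=\mathcal{H}_\infty=\{t>0,\ x>x_0^++tf'(\underline u_r)\}$; if $e_n=-\infty$ (i.e. $x_0^-=\inf\mathcal{K}_0>-\infty$), $\mathcal{H}_{(e_n,h_n)}=\mathcal{H}_{-\infty}=\{t>0,\ x<x_0^-+tf'(\overline u_l)\}$. Forward generalized characteristics: for $t>0$, $\Delta_I(x,t)=\{(\xi,\tau):\xi=x+(\tau-t)f'(v),\ 0<\tau<t,\ v\in[u(x+,t),u(x-,t)]\}$; the forward generalized characteristic of $(x_0,t_0)$, $t_0>0$, is the unique curve $x(t)$, $t\ge t_0$, $x(t_0)=x_0$, with $\Delta_I(x_0,t_0)\subset\Delta_I(x(t_1),t_1)\subset\Delta_I(x(t_2),t_2)$ for $t_2>t_1>t_0$. One emitting from a point $x_0$ of the $x$-axis is a continuous curve $x(t)$, $t\ge0$, $x(0)=x_0$, whose restriction to $[t_0,\infty)$ is the forward generalized characteristic of $(x(t_0),t_0)$ for every $t_0>0$. A shock is such a curve along which $u(x(t)+,t)<u(x(t)-,t)$. *)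

theory Defs
  imports "HOL-Analysis.Analysis"
begin

definition C2 :: "(real \<Rightarrow> real) \<Rightarrow> bool" where
  "C2 f \<longleftrightarrow> (\<forall>x. f differentiable at x) \<and> (\<forall>x. deriv f differentiable at x)
     \<and> continuous_on UNIV (deriv (deriv f))"

(* A representative of a class in L^infinity(R). The integrals below depend only on the class; for
   the one in E this holds because the image under "deriv f" of the measure with density f'' is
   Lebesgue measure. *)
definition Linfty :: "(real \<Rightarrow> real) \<Rightarrow> bool" where
  "Linfty \<phi> \<longleftrightarrow> \<phi> \<in> borel_measurable lebesgue \<and> (\<exists>C. AE x in lebesgue. \<bar>\<phi> x\<bar> \<le> C)"

text \<open>Solution formula. The interval integrals are oriented (the sign changes when the
  bounds are swapped).\<close>

definition E :: "(real \<Rightarrow> real) \<Rightarrow> (real \<Rightarrow> real) \<Rightarrow> real \<Rightarrow> real \<Rightarrow> real \<Rightarrow> real" where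
  "E f \<phi> u x t = t * (LINT s=0..u|lebesgue. (deriv (deriv f) s * (\<phi> (x - t * deriv f s) - s)))"

definition maximizers :: "(real \<Rightarrow> real) \<Rightarrow> (real \<Rightarrow> real) \<Rightarrow> real \<Rightarrow> real \<Rightarrow> real set" where
  "maximizers f \<phi> x t = {u. \<forall>v. E f \<phi> v x t \<le> E f \<phi> u x t}"

definition entropy_sol :: "(real \<Rightarrow> real) \<Rightarrow> (real \<Rightarrow> real) \<Rightarrow> real \<Rightarrow> real \<Rightarrow> real" where
  "entropy_sol f \<phi> x t = Inf (maximizers f \<phi> x t)"

text \<open>The one-sided values u(x-,t) and u(x+,t).\<close>

definition u_left :: "(real \<Rightarrow> real) \<Rightarrow> (real \<Rightarrow> real) \<Rightarrow> real \<Rightarrow> real \<Rightarrow> real" where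
  "u_left f \<phi> x t = Sup (maximizers f \<phi> x t)"

definition u_right :: "(real \<Rightarrow> real) \<Rightarrow> (real \<Rightarrow> real) \<Rightarrow> real \<Rightarrow> real \<Rightarrow> real" where
  "u_right f \<phi> x t = Inf (maximizers f \<phi> x t)"

text \<open>The primitive of the data, its asymptotic slopes (as real numbers: they are finite for
  essentially bounded data), and its convex hull.\<close>

definition Phi :: "(real \<Rightarrow> real) \<Rightarrow> real \<Rightarrow> real" where
  "Phi \<phi> x = (LINT \<xi>=0..x|lebesgue. \<phi> \<xi>)"

definition ul_sup :: "(real \<Rightarrow> real) \<Rightarrow> real" where
  "ul_sup \<phi> = real_of_ereal (Limsup at_bot (\<lambda>x. ereal (Phi \<phi> x / x)))"

definition ul_inf :: "(real \<Rightarrow> real) \<Rightarrow> real" where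
  "ul_inf \<phi> = real_of_ereal (Liminf at_bot (\<lambda>x. ereal (Phi \<phi> x / x)))"

definition ur_sup :: "(real \<Rightarrow> real) \<Rightarrow> real" where
  "ur_sup \<phi> = real_of_ereal (Limsup at_top (\<lambda>x. ereal (Phi \<phi> x / x)))"

definition ur_inf :: "(real \<Rightarrow> real) \<Rightarrow> real" where
  "ur_inf \<phi> = real_of_ereal (Liminf at_top (\<lambda>x. ereal (Phi \<phi> x / x)))"

(* The largest convex minorant on [-N,N] is the pointwise supremum of the convex minorants; as
   Phi is continuous, this supremum has the value Phi at the end points, too. *)
definition Phi_hull_N :: "(real \<Rightarrow> real) \<Rightarrow> real \<Rightarrow> real \<Rightarrow> real" where
  "Phi_hull_N \<phi> N x =
     (if \<bar>x\<bar> \<ge> N then Phi \<phi> x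
      else Sup {g x |g. convex_on {-N..N} g \<and> (\<forall>y\<in>{-N..N}. g y \<le> Phi \<phi> y)})"

definition Phi_hull :: "(real \<Rightarrow> real) \<Rightarrow> real \<Rightarrow> ereal" where
  "Phi_hull \<phi> x = Lim at_top (\<lambda>N. ereal (Phi_hull_N \<phi> N x))"

(* The derivative of the hull exists up to countably many points (if the hull is finite);
   "deriv" has unspecified values at the other points. *)
definition hull_data :: "(real \<Rightarrow> real) \<Rightarrow> real \<Rightarrow> real" where
  "hull_data \<phi> = deriv (\<lambda>x. real_of_ereal (Phi_hull \<phi> x))"

definition K0 :: "(real \<Rightarrow> real) \<Rightarrow> real set" where
  "K0 \<phi> = {x. ereal (Phi \<phi> x) = Phi_hull \<phi> x}"

definition ray :: "(real \<Rightarrow> real) \<Rightarrow> real \<Rightarrow> real \<Rightarrow> (real \<times> real) set" where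
  "ray f c x0 = {(x, t). x = x0 + t * deriv f c \<and> t > 0}"

definition is_divide :: "(real \<Rightarrow> real) \<Rightarrow> (real \<Rightarrow> real) \<Rightarrow> real \<Rightarrow> real \<Rightarrow> bool" where
  "is_divide f \<phi> c x0 \<longleftrightarrow> (\<forall>(x, t) \<in> ray f c x0. maximizers f \<phi> x t = {c})"

definition K_set :: "(real \<Rightarrow> real) \<Rightarrow> (real \<Rightarrow> real) \<Rightarrow> (real \<times> real) set" where
  "K_set f \<phi> = \<Union>{ray f c x0 |c x0. is_divide f \<phi> c x0}"

text \<open>The components \<open>(e,h)\<close> of the complement of \<open>K0\<close>, by their extended real end points.\<close>

definition gaps :: "(real \<Rightarrow> real) \<Rightarrow> (ereal \<times> ereal) set" where
  "gaps \<phi> = {(e, h). einterval e h \<in> components (- K0 \<phi>)}"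

definition gap_slope :: "(real \<Rightarrow> real) \<Rightarrow> real \<Rightarrow> real \<Rightarrow> real" where
  "gap_slope \<phi> e h = (Phi \<phi> h - Phi \<phi> e) / (h - e)"

(* For nonempty K0 no gap has e = -infinity and h = infinity. A finite end point e of a gap with
   h = infinity is Sup K0, a finite end point h of a gap with e = -infinity is Inf K0. *)
definition H_region :: "(real \<Rightarrow> real) \<Rightarrow> (real \<Rightarrow> real) \<Rightarrow> ereal \<Rightarrow> ereal \<Rightarrow> (real \<times> real) set" where
  "H_region f \<phi> e h =
     (if h = \<infinity> then {(x, t). t > 0 \<and> x > real_of_ereal e + t * deriv f (ur_inf \<phi>)}
      else if e = -\<infinity> then {(x, t). t > 0 \<and> x < real_of_ereal h + t * deriv f (ul_sup \<phi>)}
      else let e' = real_of_ereal e; h' = real_of_ereal h; c = gap_slope \<phi> e' h'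
           in {(x, t). t > 0 \<and> e' + t * deriv f c < x \<and> x < h' + t * deriv f c})"

text \<open>Generalized characteristics and shocks.\<close>

definition Delta_I ::
    "(real \<Rightarrow> real) \<Rightarrow> (real \<Rightarrow> real) \<Rightarrow> real \<Rightarrow> real \<Rightarrow> (real \<times> real) set" where
  "Delta_I f \<phi> x t = {(\<xi>, \<tau>). 0 < \<tau> \<and> \<tau> < t \<and>
     (\<exists>v\<in>{u_right f \<phi> x t..u_left f \<phi> x t}. \<xi> = x + (\<tau> - t) * deriv f v)}"

definition fwd_char ::
    "(real \<Rightarrow> real) \<Rightarrow> (real \<Rightarrow> real) \<Rightarrow> real \<Rightarrow> real \<Rightarrow> (real \<Rightarrow> real) \<Rightarrow> bool" where
  "fwd_char f \<phi> x0 t0 \<gamma> \<longleftrightarrow> t0 > 0 \<and> continuous_on {t0..} \<gamma> \<and> \<gamma> t0 = x0 \<and>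
     (\<forall>t1 t2. t0 < t1 \<and> t1 < t2 \<longrightarrow>
        Delta_I f \<phi> x0 t0 \<subseteq> Delta_I f \<phi> (\<gamma> t1) t1 \<and>
        Delta_I f \<phi> (\<gamma> t1) t1 \<subseteq> Delta_I f \<phi> (\<gamma> t2) t2)"

definition fwd_char_axis ::
    "(real \<Rightarrow> real) \<Rightarrow> (real \<Rightarrow> real) \<Rightarrow> real \<Rightarrow> (real \<Rightarrow> real) \<Rightarrow> bool" where
  "fwd_char_axis f \<phi> x0 \<gamma> \<longleftrightarrow> continuous_on {0..} \<gamma> \<and> \<gamma> 0 = x0 \<and>
     (\<forall>t0>0. fwd_char f \<phi> (\<gamma> t0) t0 \<gamma>)"

(* A shock starting at time t0, either in the upper half plane (t0 > 0) or on the axis (t0 = 0).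
   The solution need not jump at the starting point itself. *)
definition is_shock ::
    "(real \<Rightarrow> real) \<Rightarrow> (real \<Rightarrow> real) \<Rightarrow> real \<Rightarrow> (real \<Rightarrow> real) \<Rightarrow> bool" where
  "is_shock f \<phi> t0 \<gamma> \<longleftrightarrow>
     (fwd_char f \<phi> (\<gamma> t0) t0 \<gamma> \<or> (t0 = 0 \<and> fwd_char_axis f \<phi> (\<gamma> 0) \<gamma>)) \<and>
     (\<forall>t>t0. u_right f \<phi> (\<gamma> t) t < u_left f \<phi> (\<gamma> t) t)"

text \<open>As t tends to infinity, \<open>u(x-,t) = c + o(1)\<close> and \<open>u(x+,t) = c + o(1)\<close>, uniformly in \<open>x\<close>
  such that \<open>(x,t) \<in> S\<close>.\<close>

definition tends_uniformly ::
    "(real \<Rightarrow> real) \<Rightarrow> (real \<Rightarrow> real) \<Rightarrow> (real \<times> real) set \<Rightarrow> real \<Rightarrow> bool" where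
  "tends_uniformly f \<phi> S c \<longleftrightarrow> (\<forall>\<epsilon>>0. \<forall>\<^sub>F t in at_top. \<forall>x. (x, t) \<in> S \<longrightarrow>
     \<bar>u_left f \<phi> x t - c\<bar> < \<epsilon> \<and> \<bar>u_right f \<phi> x t - c\<bar> < \<epsilon>)"

end

theory Submission imports Defs
begin

text \<open>Substituting \<open>y = x - t f'(s)\<close> turns \<open>E\<close>, up to sign and a constant, into the
  Hopf--Lax functional \<open>\<Phi>(x - t f'(u)) + t (u f'(u) - f(u))\<close>, so only the Lipschitz
  function \<open>\<Phi>\<close> matters. A divide emits from \<open>y\<close> with speed \<open>f'(c)\<close> iff \<open>\<Phi>\<close> has a global
  support line of slope \<open>c\<close> at \<open>y\<close>; support lines at the end points of a gap confine the base
  points of the minimizers. If two forward characteristics never met, their base points would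
  accumulate at a point with a support line, so without support lines all of them merge.
  The uniform limits come from comparing a minimizer \<open>u\<close> with \<open>u \<plusminus> \<epsilon>\<close>: this bounds
  \<open>u\<close> by a mean of the data over an interval whose length grows linearly in \<open>t\<close>.\<close>

section \<open>Minimizers and backward characteristics\<close>

text \<open>Three obstacles shape the proof. The hull is a limit of hulls on bounded intervals and
  may be minus infinity, so contact with it is translated into existence of a support line, a
  statement about the primitive alone. The data of the comparison solution is a \<open>deriv\<close>
  with unspecified values at kinks. Its maximizers are therefore found without evaluating it: the
  hull has a support line at each of its points, so each point of a gap region lies on a divide for
  the hull data, where the solution can be read off. For this the minimization problem is set up for
  an arbitrary Lipschitz function and used for both primitives. Finally, \<open>a\<close> is
  strictly increasing, but it need not be onto and its derivative may vanish, so states rather than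
  speeds serve as variables. The two cases of the theorem come from the slopes at infinity. A
  support slope lies between the left and the right one, which excludes support lines if the left
  one is larger. If it is smaller, subtracting a line of intermediate slope makes the primitive grow
  at both ends, so that a minimum, hence a support line, exists.\<close>

definition supports :: "(real \<Rightarrow> real) \<Rightarrow> real \<Rightarrow> real \<Rightarrow> bool" where
  "supports \<Phi> c y \<longleftrightarrow> (\<forall>z. \<Phi> y + c * (z - y) \<le> \<Phi> z)"

locale hopf_lax =
  fixes F a \<Phi> :: "real \<Rightarrow> real" and M :: real
  assumes F_deriv: "\<And>u. (F has_real_derivative a u) (at u)"
    and a_mono: "strict_mono a"
    and a_cont: "continuous_on UNIV a"
    and lip: "\<And>x y. \<bar>\<Phi> x - \<Phi> y\<bar> \<le> M * \<bar>x - y\<bar>"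
begin

text \<open>The Legendre transform of \<open>F\<close> at the speed \<open>a u\<close>, kept as a
  function of the state \<open>u\<close>.\<close>

definition L :: "real \<Rightarrow> real" where
  "L u = u * a u - F u"

definition G :: "real \<Rightarrow> real \<Rightarrow> real \<Rightarrow> real" where
  "G u x t = \<Phi> (x - t * a u) + t * L u"

definition minimizers :: "real \<Rightarrow> real \<Rightarrow> real set" where
  "minimizers x t = {u. \<forall>v. G u x t \<le> G v x t}"

abbreviation supp :: "real \<Rightarrow> real \<Rightarrow> bool" where
  "supp \<equiv> supports \<Phi>"

lemma minimizers_eqI:
  assumes "\<And>v. v \<noteq> u \<Longrightarrow> G u x t < G v x t" shows "minimizers x t = {u}"
proof (intro equalityI subsetI)
  fix w assume "w \<in> minimizers x t"
  then have "G w x t \<le> G u x t" by (simp add: minimizers_def)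
  then show "w \<in> {u}" using assms[of w] by fastforce
next
  fix w assume w: "w \<in> {u}"
  have "G u x t \<le> G v x t" for v using assms[of v] by (cases "v = u") auto
  then show "w \<in> minimizers x t" using w by (simp add: minimizers_def)
qed

lemma a_less [simp]: "a u < a v \<longleftrightarrow> u < v"
  using a_mono by (simp add: strict_mono_less)

lemma a_le [simp]: "a u \<le> a v \<longleftrightarrow> u \<le> v"
  using a_mono by (simp add: strict_mono_less_eq)

lemma a_eq [simp]: "a u = a v \<longleftrightarrow> u = v"
  using a_mono by (simp add: strict_mono_eq)

lemma isCont_a: "isCont a u"
  using a_cont by (simp add: continuous_on_eq_continuous_at)

lemma a_ivt:
  assumes "a p \<le> y" "y \<le> a q"
  obtains w where "p \<le> w" "w \<le> q" "a w = y"
proof -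
  have "p \<le> q" using assms a_le by (meson order_trans)
  then show thesis using IVT'[of a p y q] assms a_cont that
    by (meson continuous_on_subset subset_UNIV)
qed

lemma M_nonneg: "0 \<le> M"
  using lip[of 1 0] by simp

text \<open>As a function of the speed, \<open>L\<close> is strictly convex with subgradient
  \<open>w\<close> at \<open>a w\<close>. The two sides differ by
  \<open>(v - w) * a v - (F v - F w)\<close>, which the mean value theorem makes positive.\<close>

lemma L_gt:
  assumes "v \<noteq> w"
  shows "L w + w * (a v - a w) < L v"
proof (cases "w < v")
  case True
  obtain z where z: "w < z" "z < v" "F v - F w = (v - w) * a z"
    using MVT2[OF True, of F a] F_deriv by blast
  have "(v - w) * a z < (v - w) * a v" using z True by simp
  then show ?thesis using z(3) by (simp add: L_def algebra_simps)
next
  case False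
  then have vw: "v < w" using assms by simp
  obtain z where z: "v < z" "z < w" "F w - F v = (w - v) * a z"
    using MVT2[OF vw, of F a] F_deriv by blast
  have "(w - v) * a v < (w - v) * a z" using z vw by simp
  then show ?thesis using z(3) by (simp add: L_def algebra_simps)
qed

lemma L_ge: "L w + w * (a v - a w) \<le> L v"
  using L_gt[of v w] by (cases "v = w") auto

lemma cont_\<Phi>: "continuous_on UNIV \<Phi>"
proof -
  have "M-lipschitz_on UNIV \<Phi>"
    by (rule lipschitz_onI) (use lip M_nonneg in \<open>auto simp: dist_real_def\<close>)
  then show ?thesis by (rule lipschitz_on_continuous_on)
qed

lemma isCont_\<Phi>: "isCont \<Phi> y"
  using cont_\<Phi> by (simp add: continuous_on_eq_continuous_at)

lemma isCont_L: "isCont L u"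
  unfolding L_def using isCont_a DERIV_isCont[OF F_deriv]
  by (auto intro!: continuous_intros)

lemma tendsto_G:
  assumes "(X \<longlongrightarrow> x) net" "(U \<longlongrightarrow> u) net"
  shows "((\<lambda>n. G (U n) (X n) t) \<longlongrightarrow> G u x t) net"
  unfolding G_def
  by (intro tendsto_intros isCont_tendsto_compose[OF isCont_\<Phi>] isCont_tendsto_compose[OF isCont_a]
      isCont_tendsto_compose[OF isCont_L] assms)

text \<open>When the speed moves outward beyond \<open>a M\<close> or \<open>a (-M)\<close>, the
  convex term gains more than \<open>M\<close> per unit by which the base point is shifted, while
  \<open>\<Phi>\<close> can lose at most \<open>M\<close>.\<close>

lemma G_outside:
  assumes "t > 0" shows "M < u \<Longrightarrow> G M x t < G u x t" "u < -M \<Longrightarrow> G (-M) x t < G u x t"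
proof -
  assume u: "M < u"
  have "\<bar>\<Phi> (x - t * a u) - \<Phi> (x - t * a M)\<bar> \<le> M * (t * (a u - a M))"
    using lip[of "x - t * a u" "x - t * a M"] u assms by (simp add: abs_if algebra_simps split: if_splits)
  moreover have "t * (L M + M * (a u - a M)) < t * L u"
    using L_gt[of u M] u assms by simp
  ultimately show "G M x t < G u x t" unfolding G_def by (simp add: algebra_simps)
next
  assume u: "u < -M"
  have "\<bar>\<Phi> (x - t * a u) - \<Phi> (x - t * a (-M))\<bar> \<le> M * (t * (a (-M) - a u))"
    using lip[of "x - t * a u" "x - t * a (-M)"] u assms by (simp add: abs_if algebra_simps split: if_splits)
  moreover have "t * (L (-M) + (-M) * (a u - a (-M))) < t * L u"
    using L_gt[of u "-M"] u assms by simp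
  ultimately show "G (-M) x t < G u x t" unfolding G_def by (simp add: algebra_simps)
qed

section \<open>Existence and compactness of the minimizers\<close>

lemma minimizers_bounded:
  assumes "t > 0" "u \<in> minimizers x t" shows "-M \<le> u" "u \<le> M"
proof -
  have "G u x t \<le> G M x t" "G u x t \<le> G (-M) x t" using assms(2) by (auto simp: minimizers_def)
  then show "-M \<le> u" "u \<le> M" using G_outside[OF assms(1)] by (force simp: not_le[symmetric])+
qed

lemma minimizers_nonempty:
  assumes "t > 0" shows "minimizers x t \<noteq> {}"
proof -
  have "continuous_on {-M..M} (\<lambda>u. G u x t)"
    using tendsto_G[of "\<lambda>_. x" x _ "\<lambda>u. u"] by (auto intro!: continuous_at_imp_continuous_on simp: continuous_at)
  then obtain u where u: "u \<in> {-M..M}" "\<And>v. v \<in> {-M..M} \<Longrightarrow> G u x t \<le> G v x t"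
    using continuous_attains_inf[of "{-M..M}" "\<lambda>u. G u x t"] M_nonneg by auto
  have "G u x t \<le> G v x t" for v
  proof -
    consider "v \<in> {-M..M}" | "v > M" | "v < -M" by fastforce
    then show ?thesis
      using u(2)[of v] u(2)[of M] u(2)[of "-M"] G_outside[OF assms, where u=v and x=x] M_nonneg by cases auto
  qed
  then show ?thesis by (auto simp: minimizers_def)
qed

lemma minimizers_limit:
  assumes "X \<longlonglongrightarrow> x" "U \<longlonglongrightarrow> u" "\<And>n. U n \<in> minimizers (X n) t"
  shows "u \<in> minimizers x t"
proof -
  have "G u x t \<le> G v x t" for v
    by (rule LIMSEQ_le[OF tendsto_G[OF assms(1,2)] tendsto_G[OF assms(1) tendsto_const]])
      (use assms(3) in \<open>auto simp: minimizers_def\<close>)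
  then show ?thesis by (simp add: minimizers_def)
qed

lemma minimizers_compact:
  assumes "t > 0" shows "compact (minimizers x t)"
proof -
  have "closed (minimizers x t)"
    unfolding closed_sequential_limits using minimizers_limit[of "\<lambda>_. x" x] by auto
  moreover have "bounded (minimizers x t)"
    by (rule bounded_subset[of "{-M..M}"]) (use minimizers_bounded[OF assms] in auto)
  ultimately show ?thesis by (simp add: compact_eq_bounded_closed)
qed

definition uL :: "real \<Rightarrow> real \<Rightarrow> real" where "uL x t = Sup (minimizers x t)"
definition uR :: "real \<Rightarrow> real \<Rightarrow> real" where "uR x t = Inf (minimizers x t)"

lemma minimizers_bdd: "t > 0 \<Longrightarrow> bdd_above (minimizers x t)" "t > 0 \<Longrightarrow> bdd_below (minimizers x t)"
  by (simp_all add: minimizers_compact compact_imp_bounded bounded_imp_bdd_above bounded_imp_bdd_below)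

lemma uL_minimizers: "t > 0 \<Longrightarrow> uL x t \<in> minimizers x t"
  unfolding uL_def by (intro closed_contains_Sup minimizers_nonempty minimizers_bdd compact_imp_closed minimizers_compact)

lemma uR_minimizers: "t > 0 \<Longrightarrow> uR x t \<in> minimizers x t"
  unfolding uR_def by (intro closed_contains_Inf minimizers_nonempty minimizers_bdd compact_imp_closed minimizers_compact)

lemma uL_ge: "t > 0 \<Longrightarrow> u \<in> minimizers x t \<Longrightarrow> u \<le> uL x t"
  unfolding uL_def by (intro cSup_upper minimizers_bdd)

lemma uR_le: "t > 0 \<Longrightarrow> u \<in> minimizers x t \<Longrightarrow> uR x t \<le> u"
  unfolding uR_def by (intro cInf_lower minimizers_bdd)

lemma uR_le_uL: "t > 0 \<Longrightarrow> uR x t \<le> uL x t"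
  using uR_le uL_minimizers by blast

section \<open>Support lines and minimizing rays\<close>

lemma supp_minimizers:
  assumes "supp c y" "t > 0" shows "minimizers (y + t * a c) t = {c}"
proof -
  have "G c (y + t * a c) t < G v (y + t * a c) t" if "v \<noteq> c" for v
  proof -
    have "L v + v * (a c - a v) < L c" using L_gt that by metis
    moreover have "L c + c * (a v - a c) < L v" using L_gt that by metis
    then have "t * (L c + c * (a v - a c)) < t * L v" using assms by simp
    \<comment> \<open>The support line of \<open>\<Phi>\<close> falls at the same rate
      \<open>c\<close> at which the tangent of \<open>L\<close> rises, so the sum of the two lower
      bounds does not depend on \<open>v\<close>.\<close>
    moreover have "\<Phi> y + c * (t * a c - t * a v) \<le> \<Phi> (y + t * a c - t * a v)"
      using assms(1)[unfolded supports_def, rule_format, of "y + t * a c - t * a v"] by simp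
    ultimately show ?thesis by (simp add: G_def algebra_simps)
  qed
  then show ?thesis by (rule minimizers_eqI)
qed

text \<open>The competitor \<open>u\<close> has base point \<open>z\<close> at exactly one time
  \<open>t\<close>, and the comparison there gives the inequality with slope \<open>u\<close>
  instead of \<open>c\<close>. As \<open>u\<close> tends to \<open>c\<close>, this time tends to
  infinity, so minimality on the whole ray enters.\<close>

lemma minimizers_ray_imp_supp:
  assumes "\<And>t. t > 0 \<Longrightarrow> c \<in> minimizers (y + t * a c) t"
  shows "supp c y"
  unfolding supports_def
proof
  fix z
  have key: "u * (z - y) \<le> \<Phi> z - \<Phi> y" if u: "u < c \<and> z > y \<or> c < u \<and> z < y" for u
  proof -
    define t where "t = (z - y) / (a c - a u)"
    have t: "t > 0" using u by (auto simp: t_def divide_simps)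
    have zy: "z - y = t * (a c - a u)" using u by (auto simp: t_def)
    have "G c (y + t * a c) t \<le> G u (y + t * a c) t" using assms[OF t] by (auto simp: minimizers_def)
    moreover have "y + t * a c - t * a u = z" using zy by (simp add: algebra_simps)
    ultimately have "\<Phi> y + t * L c \<le> \<Phi> z + t * L u" by (simp add: G_def)
    moreover have "t * (L u + u * (a c - a u)) \<le> t * L c" using L_ge t by simp
    ultimately show ?thesis unfolding zy by (simp add: algebra_simps)
  qed
  consider "z > y" | "z < y" | "z = y" by fastforce
  then have "c * (z - y) \<le> \<Phi> z - \<Phi> y"
  proof cases
    case 1
    have "c \<le> (\<Phi> z - \<Phi> y) / (z - y)"
      by (rule dense_le) (use key 1 in \<open>simp add: pos_le_divide_eq\<close>)
    then show ?thesis using 1 by (simp add: pos_le_divide_eq)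
  next
    case 2
    have "(\<Phi> z - \<Phi> y) / (z - y) \<le> c"
      by (rule dense_ge) (use key 2 in \<open>simp add: neg_divide_le_eq\<close>)
    then show ?thesis using 2 by (simp add: neg_divide_le_eq)
  qed simp
  then show "\<Phi> y + c * (z - y) \<le> \<Phi> z" by simp
qed

section \<open>Order of backward characteristics\<close>

lemma minimizers_back:
  assumes u: "u \<in> minimizers x t" and s: "0 < s" "s < t"
  shows "minimizers (x - (t - s) * a u) s = {u}"
proof -
  define \<xi> where "\<xi> = x - (t - s) * a u"
  have "G u \<xi> s < G v \<xi> s" if v: "v \<noteq> u" for v
  proof -
    define k where "k = s / t"
    have k: "0 < k" "k < 1" "s = k * t" using s by (auto simp: k_def)
    \<comment> \<open>\<open>?m\<close> is the mean speed of the broken path that has speed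
      \<open>a v\<close> up to time \<open>s\<close> and \<open>a u\<close> afterwards. The straight
      path with state \<open>w\<close> joins the same end points and costs less by convexity of
      \<open>L\<close>, strictly less because its speed differs from \<open>a v\<close>. So a
      \<open>v\<close> as good as \<open>u\<close> at time \<open>s\<close> would produce a
      \<open>w\<close> better than \<open>u\<close> at time \<open>t\<close>.\<close>
    let ?m = "k * a v + (1 - k) * a u"
    have "min (a u) (a v) \<le> ?m" "?m \<le> max (a u) (a v)"
      using k convex_bound_le[of "a v" "max (a u) (a v)" "a u" k "1-k"]
        convex_bound_le[of "- a v" "- min (a u) (a v)" "- a u" k "1-k"] by (simp_all add: algebra_simps)
    then have "a (min u v) \<le> ?m" "?m \<le> a (max u v)" by (auto simp: min_def max_def split: if_splits)
    then obtain w where w: "a w = ?m" by (rule a_ivt)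
    have "a w \<noteq> a v"
    proof
      assume "a w = a v"
      then have "(1 - k) * (a u - a v) = 0" using w by (simp add: algebra_simps)
      then show False using k v by simp
    qed
    then have "w \<noteq> v" by auto
    then have "s * (L w + w * (a v - a w)) < s * L v" using L_gt s by simp
    moreover have "(t - s) * (L w + w * (a u - a w)) \<le> (t - s) * L u" using L_ge s by simp
    moreover have tw: "t * a w = s * a v + (t - s) * a u" unfolding w k(3) by (simp add: algebra_simps)
    have "s * (w * (a v - a w)) + (t - s) * (w * (a u - a w)) = w * (s * a v + (t - s) * a u - t * a w)"
      by (simp add: algebra_simps)
    then have "s * (w * (a v - a w)) + (t - s) * (w * (a u - a w)) = 0" using tw by simp
    moreover have "G u x t \<le> G w x t" using u by (simp add: minimizers_def)
    then have "\<Phi> (\<xi> - s * a u) + t * L u \<le> \<Phi> (\<xi> - s * a v) + t * L w"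
      unfolding G_def tw \<xi>_def by (simp add: algebra_simps)
    ultimately show ?thesis unfolding G_def by (simp add: algebra_simps)
  qed
  then show ?thesis unfolding \<xi>_def by (rule minimizers_eqI)
qed

text \<open>If the base points were in reverse order, the characteristics would cross at the time
  \<open>s\<close> strictly between 0 and \<open>t\<close>. The crossing point has only one
  minimizer, so both would have the same speed and could not cross.\<close>

lemma minimizers_base_mono:
  assumes u: "u \<in> minimizers x t" and u': "u' \<in> minimizers x' t" and "x < x'" "0 < t"
  shows "x - t * a u \<le> x' - t * a u'"
proof (rule ccontr)
  assume "\<not> ?thesis"
  then have d: "x' - x < t * (a u' - a u)" by (simp add: algebra_simps)
  define s where "s = t - (x' - x) / (a u' - a u)"
  have pos: "a u' - a u > 0" using d assms by (metis diff_gt_0_iff_gt less_trans zero_less_mult_pos)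
  have s: "0 < s" "s < t" using d pos assms(3) by (auto simp: s_def divide_simps algebra_simps)
  have "(t - s) * (a u' - a u) = x' - x" using pos by (simp add: s_def)
  then have "x - (t - s) * a u = x' - (t - s) * a u'" by (simp add: algebra_simps)
  then have "u = u'" using minimizers_back[OF u s] minimizers_back[OF u' s] by simp
  then show False using pos by simp
qed

text \<open>The point at time \<open>s\<close> is a convex combination of the base point, which is
  ordered weakly, and the end point, which is ordered strictly. The latter has the positive weight
  \<open>k = s / t\<close>.\<close>

lemma minimizers_strict_mono:
  assumes u: "u \<in> minimizers x t" and u': "u' \<in> minimizers x' t" and "x < x'" "0 < s" "s \<le> t"
  shows "x - (t - s) * a u < x' - (t - s) * a u'"
proof -
  define k where "k = s / t"
  have k: "0 < k" "k \<le> 1" "s = k * t" using assms by (auto simp: k_def)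
  have "(1 - k) * (x - t * a u) \<le> (1 - k) * (x' - t * a u')"
    using minimizers_base_mono[OF u u'] assms k by (intro mult_left_mono) auto
  moreover have "k * x < k * x'" using k assms by simp
  ultimately show ?thesis unfolding k(3) by (simp add: algebra_simps)
qed

text \<open>The point \<open>(x1, t1)\<close> lies in the closed backward characteristic triangle with apex
  \<open>(x2, t2)\<close>. Time \<open>t1 = 0\<close> is allowed, which covers characteristics emitting from the axis.\<close>

definition below :: "real \<Rightarrow> real \<Rightarrow> real \<Rightarrow> real \<Rightarrow> bool" where
  "below x1 t1 x2 t2 \<longleftrightarrow> 0 \<le> t1 \<and> t1 < t2 \<and>
     x2 - (t2 - t1) * a (uL x2 t2) \<le> x1 \<and> x1 \<le> x2 - (t2 - t1) * a (uR x2 t2)"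

section \<open>Nesting of backward triangles\<close>

lemma belowD:
  assumes "below x1 t1 x2 t2"
  shows "0 \<le> t1" "t1 < t2" "0 < t2"
    "x2 - (t2 - t1) * a (uL x2 t2) \<le> x1" "x1 \<le> x2 - (t2 - t1) * a (uR x2 t2)"
  using assms by (auto simp: below_def)

text \<open>The state \<open>v\<close> lies between the extreme minimizers but need not be a
  minimizer: at a jump the triangle is filled.\<close>

lemma below_ivt:
  assumes "below x1 t1 x2 t2"
  obtains v where "uR x2 t2 \<le> v" "v \<le> uL x2 t2" "x1 = x2 - (t2 - t1) * a v"
proof -
  note b = belowD[OF assms]
  have "a (uR x2 t2) \<le> (x2 - x1) / (t2 - t1)" "(x2 - x1) / (t2 - t1) \<le> a (uL x2 t2)"
    using b by (simp_all add: divide_simps algebra_simps)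
  then obtain v where v: "uR x2 t2 \<le> v" "v \<le> uL x2 t2" "a v = (x2 - x1) / (t2 - t1)"
    by (rule a_ivt)
  show thesis by (rule that[OF v(1,2)]) (use b v(3) in simp)
qed

lemma belowI:
  assumes "0 \<le> t1" "t1 < t2" "uR x2 t2 \<le> v" "v \<le> uL x2 t2"
  shows "below (x2 - (t2 - t1) * a v) t1 x2 t2"
  using assms by (auto simp: below_def intro!: mult_left_mono)

text \<open>A side of the triangle at \<open>(x2, t2)\<close> passes the point \<open>\<xi>\<close>
  at time \<open>t1\<close> and its state is the only minimizer there. As \<open>\<xi>\<close> is
  not strictly between the two sides seen from \<open>x1\<close>, the order of characteristics keeps
  this side outside the triangle at \<open>(x1, t1)\<close> down to time \<open>t0\<close>.\<close>

lemma below_trans: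
  assumes b0: "below x0 t0 x1 t1" and b1: "below x1 t1 x2 t2"
  shows "below x0 t0 x2 t2"
proof -
  note b0 = belowD[OF b0] and b1 = belowD[OF b1]
  have left: "x2 - (t2 - t0) * a (uL x2 t2) \<le> x0"
  proof -
    define \<xi> where "\<xi> = x2 - (t2 - t1) * a (uL x2 t2)"
    have m: "minimizers \<xi> t1 = {uL x2 t2}" unfolding \<xi>_def using minimizers_back uL_minimizers b0 b1 by simp
    have eq: "x2 - (t2 - t0) * a (uL x2 t2) = \<xi> - (t1 - t0) * a (uL x2 t2)"
      by (simp add: \<xi>_def algebra_simps)
    have "\<xi> - (t1 - t0) * a (uL x2 t2) \<le> x1 - (t1 - t0) * a (uL x1 t1)"
    proof (cases "\<xi> = x1")
      case True
      then show ?thesis using m by (simp add: uL_def)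
    next
      case False
      then have "\<xi> < x1" using b1 by (simp add: \<xi>_def)
      \<comment> \<open>On the axis only the weak order of base points is available, which suffices
        here.\<close>
      then show ?thesis
        using minimizers_base_mono[OF _ uL_minimizers \<open>\<xi> < x1\<close>, of "uL x2 t2" t1] m b0
          minimizers_strict_mono[OF _ uL_minimizers \<open>\<xi> < x1\<close>, of "uL x2 t2" t1 t0]
        by (cases "t0 = 0") (auto simp: less_imp_le)
    qed
    then show ?thesis using b0 eq by simp
  qed
  have right: "x0 \<le> x2 - (t2 - t0) * a (uR x2 t2)"
  proof -
    define \<xi> where "\<xi> = x2 - (t2 - t1) * a (uR x2 t2)"
    have m: "minimizers \<xi> t1 = {uR x2 t2}" unfolding \<xi>_def using minimizers_back uR_minimizers b0 b1 by simp
    have eq: "x2 - (t2 - t0) * a (uR x2 t2) = \<xi> - (t1 - t0) * a (uR x2 t2)"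
      by (simp add: \<xi>_def algebra_simps)
    have "x1 - (t1 - t0) * a (uR x1 t1) \<le> \<xi> - (t1 - t0) * a (uR x2 t2)"
    proof (cases "\<xi> = x1")
      case True
      then show ?thesis using m by (simp add: uR_def)
    next
      case False
      then have "x1 < \<xi>" using b1 by (simp add: \<xi>_def)
      then show ?thesis
        using minimizers_base_mono[OF uR_minimizers _ \<open>x1 < \<xi>\<close>, of t1 "uR x2 t2"] m b0
          minimizers_strict_mono[OF uR_minimizers _ \<open>x1 < \<xi>\<close>, of t1 "uR x2 t2" t0]
        by (cases "t0 = 0") (auto simp: less_imp_le)
    qed
    then show ?thesis using b0 eq by simp
  qed
  show ?thesis using left right b0 b1 by (simp add: below_def)
qed

text \<open>Triangles with different apexes at the same time are disjoint at positive times. They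
  may touch on the axis, as in a centered rarefaction wave, hence \<open>0 < s\<close>.\<close>

lemma below_mono:
  assumes b1: "below x1 s y1 t" and b2: "below x2 s y2 t" and "0 < s" "y1 < y2"
  shows "x1 < x2"
proof -
  note b1 = belowD[OF b1] and b2 = belowD[OF b2]
  have "y1 - (t - s) * a (uR y1 t) < y2 - (t - s) * a (uL y2 t)"
    by (rule minimizers_strict_mono) (use assms b1 in \<open>auto intro: uR_minimizers uL_minimizers\<close>)
  then show ?thesis using b1 b2 by linarith
qed

lemma below_unique:
  assumes "below x s y1 t" "below x s y2 t" "0 < s"
  shows "y1 = y2"
  using below_mono[of x s y1 t x y2] below_mono[of x s y2 t x y1] assms by fastforce

section \<open>Existence of forward characteristics\<close>

lemma a_bounded: obtains A where "A > 0" "\<And>u. -M \<le> u \<Longrightarrow> u \<le> M \<Longrightarrow> \<bar>a u\<bar> \<le> A"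
proof
  show "\<bar>a M\<bar> + \<bar>a (-M)\<bar> + 1 > 0" by simp
  show "\<bar>a u\<bar> \<le> \<bar>a M\<bar> + \<bar>a (-M)\<bar> + 1" if "-M \<le> u" "u \<le> M" for u
    using a_le[of "-M" u] a_le[of u M] that by linarith
qed

lemma minimizers_subseq:
  assumes "\<And>n. U n \<in> minimizers (X n) t" "X \<longlonglongrightarrow> x" "t > 0"
  obtains u r where "strict_mono (r :: nat \<Rightarrow> nat)" "(U \<circ> r) \<longlonglongrightarrow> u" "u \<in> minimizers x t"
proof -
  have "seq_compact {-M..M}" by (simp add: compact_imp_seq_compact)
  moreover have "\<forall>n. U n \<in> {-M..M}" using minimizers_bounded[OF assms(3) assms(1)] by simp
  ultimately obtain u r where ur: "strict_mono (r :: nat \<Rightarrow> nat)" "(U \<circ> r) \<longlonglongrightarrow> u"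
    unfolding seq_compact_def by blast
  have "(X \<circ> r) \<longlonglongrightarrow> x" using LIMSEQ_subseq_LIMSEQ assms(2) ur(1) by blast
  then have "u \<in> minimizers x t" using minimizers_limit[OF _ ur(2)] assms(1) by simp
  then show thesis using that ur by blast
qed

text \<open>\<open>S\<close> collects the apexes with some characteristic passing \<open>x\<close>
  or a point left of it at time \<open>s\<close>. Its supremum belongs to \<open>S\<close> by
  compactness of the states; approaching it from the right, outside \<open>S\<close>, gives the
  opposite inequality. For \<open>s = 0\<close> the apex need not be unique, and
  \<open>chain_exists\<close> selects the greatest one.\<close>

lemma below_greatest:
  assumes s: "0 \<le> s" "s < t"
  obtains y where "below x s y t" "\<And>y'. below x s y' t \<Longrightarrow> y' \<le> y"
proof -
  obtain A where A: "A > 0" "\<And>u. -M \<le> u \<Longrightarrow> u \<le> M \<Longrightarrow> \<bar>a u\<bar> \<le> A" using a_bounded by blast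
  have t: "t > 0" using s by simp
  define S where "S = {y. \<exists>u\<in>minimizers y t. y - (t - s) * a u \<le> x}"
  have b: "\<bar>(t - s) * a u\<bar> \<le> (t - s) * A" if "u \<in> minimizers y t" for u y
    using A(2) minimizers_bounded[OF t that] s by (simp add: abs_mult)
  have "x - (t - s) * A \<in> S"
    unfolding S_def using b[OF uL_minimizers[OF t], of "x - (t - s) * A"]
    by (intro CollectI bexI[OF _ uL_minimizers[OF t]]) (simp add: abs_le_iff)
  then have ne: "S \<noteq> {}" by auto
  have "y \<le> x + (t - s) * A" if "y \<in> S" for y
    using that b unfolding S_def by (fastforce simp: abs_le_iff)
  then have bdd: "bdd_above S" by (auto simp: bdd_above_def)
  have "closed S" unfolding closed_sequential_limits
  proof (intro allI impI, elim conjE)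
    fix X l assume X: "\<forall>n. X n \<in> S" "X \<longlonglongrightarrow> l"
    then obtain U where U: "\<And>n. U n \<in> minimizers (X n) t" "\<And>n. X n - (t - s) * a (U n) \<le> x"
      unfolding S_def by simp metis
    obtain u r where ur: "strict_mono (r :: nat \<Rightarrow> nat)" "(U \<circ> r) \<longlonglongrightarrow> u" "u \<in> minimizers l t"
      using minimizers_subseq[OF U(1) X(2) t] by blast
    have "(\<lambda>n. (X \<circ> r) n - (t - s) * a ((U \<circ> r) n)) \<longlonglongrightarrow> l - (t - s) * a u"
      by (intro tendsto_intros LIMSEQ_subseq_LIMSEQ X ur isCont_tendsto_compose[OF isCont_a])
    then have "l - (t - s) * a u \<le> x"
      by (rule LIMSEQ_le_const2) (use U(2) in auto)
    then show "l \<in> S" using ur(3) by (auto simp: S_def)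
  qed
  define y where "y = Sup S"
  have yS: "y \<in> S" unfolding y_def by (rule closed_contains_Sup[OF ne bdd \<open>closed S\<close>])
  define X where "X = (\<lambda>n. y + inverse (real (Suc n)))"
  have X: "X \<longlonglongrightarrow> y" unfolding X_def using tendsto_add[OF tendsto_const[of y] LIMSEQ_inverse_real_of_nat] by simp
  have XS: "X n \<notin> S" for n
    using cSup_upper[OF _ bdd, of "X n"] by (auto simp: X_def y_def[symmetric])
  define U where "U = (\<lambda>n. uR (X n) t)"
  have U: "U n \<in> minimizers (X n) t" for n using uR_minimizers t by (simp add: U_def)
  obtain u r where ur: "strict_mono (r :: nat \<Rightarrow> nat)" "(U \<circ> r) \<longlonglongrightarrow> u" "u \<in> minimizers y t"
    using minimizers_subseq[OF U X t] by blast
  have "(\<lambda>n. (X \<circ> r) n - (t - s) * a ((U \<circ> r) n)) \<longlonglongrightarrow> y - (t - s) * a u"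
    by (intro tendsto_intros LIMSEQ_subseq_LIMSEQ X ur isCont_tendsto_compose[OF isCont_a])
  moreover have "x \<le> X n - (t - s) * a (U n)" for n using XS[of n] U[of n] by (force simp: S_def)
  ultimately have ge: "x \<le> y - (t - s) * a u"
    by (intro LIMSEQ_le_const[where X="(\<lambda>n. (X \<circ> r) n - (t - s) * a ((U \<circ> r) n))"]) auto
  have "(t - s) * a (uR y t) \<le> (t - s) * a u" using uR_le[OF t ur(3)] s by simp
  moreover obtain v where v: "v \<in> minimizers y t" "y - (t - s) * a v \<le> x" using yS by (auto simp: S_def)
  moreover have "(t - s) * a v \<le> (t - s) * a (uL y t)" using uL_ge[OF t v(1)] s by simp
  ultimately have "y - (t - s) * a (uL y t) \<le> x" "x \<le> y - (t - s) * a (uR y t)"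
    using ge by linarith+
  then have "below x s y t" using s by (simp add: below_def)
  moreover have "y' \<le> y" if "below x s y' t" for y'
  proof -
    have "y' \<in> S" using belowD[OF that] uL_minimizers[OF t] by (auto simp: S_def)
    then show ?thesis unfolding y_def using bdd by (rule cSup_upper)
  qed
  ultimately show thesis using that by blast
qed

text \<open>A common form of \<open>fwd_char\<close>, for \<open>t0 > 0\<close>, and
  \<open>fwd_char_axis\<close>, for \<open>t0 = 0\<close>. Continuity is left out, as it follows
  from the bound on the speeds.\<close>

definition chain :: "real \<Rightarrow> (real \<Rightarrow> real) \<Rightarrow> bool" where
  "chain t0 \<gamma> \<longleftrightarrow> 0 \<le> t0 \<and> (\<forall>s t. t0 \<le> s \<and> s < t \<longrightarrow> below (\<gamma> s) s (\<gamma> t) t)"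

lemma chainD: "chain t0 \<gamma> \<Longrightarrow> t0 \<le> s \<Longrightarrow> s < t \<Longrightarrow> below (\<gamma> s) s (\<gamma> t) t"
  by (simp add: chain_def)

text \<open>Taking the greatest apex over \<open>(x0, t0)\<close> at every time makes the choices
  compatible: an apex \<open>y\<close> over \<open>(\<gamma> s, s)\<close> is one over
  \<open>(x0, t0)\<close> by transitivity, so it is at most \<open>\<gamma> t\<close>, and it cannot
  be smaller.\<close>

lemma chain_exists:
  assumes "0 \<le> t0"
  obtains \<gamma> where "chain t0 \<gamma>" "\<gamma> t0 = x0"
proof -
  define P where "P = (\<lambda>t y. below x0 t0 y t \<and> (\<forall>y'. below x0 t0 y' t \<longrightarrow> y' \<le> y))"
  define \<gamma> where "\<gamma> = (\<lambda>t. if t \<le> t0 then x0 else SOME y. P t y)"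
  have P: "P t (\<gamma> t)" if "t > t0" for t
  proof -
    have "\<exists>y. P t y" unfolding P_def using below_greatest[OF assms that] by metis
    then show ?thesis using that by (simp add: \<gamma>_def someI_ex)
  qed
  have "below (\<gamma> s) s (\<gamma> t) t" if st: "t0 \<le> s" "s < t" for s t
  proof (cases "s = t0")
    case True
    then show ?thesis using P[of t] st by (simp add: P_def \<gamma>_def)
  next
    case False
    then have s: "t0 < s" "0 < s" "t0 < t" "0 < t" using st assms by auto
    have Ps: "below x0 t0 (\<gamma> s) s" "\<And>y'. below x0 t0 y' s \<Longrightarrow> y' \<le> \<gamma> s"
      and Pt: "below x0 t0 (\<gamma> t) t" "\<And>y'. below x0 t0 y' t \<Longrightarrow> y' \<le> \<gamma> t"
      using P s by (auto simp: P_def)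
    obtain y where y: "below (\<gamma> s) s y t" using below_greatest s st by (metis less_imp_le)
    have "y \<le> \<gamma> t" using Pt below_trans[OF Ps(1) y] by simp
    moreover have "\<not> y < \<gamma> t"
    proof
      assume less: "y < \<gamma> t"
      \<comment> \<open>The left side of the triangle at \<open>\<gamma> t\<close> passes time
        \<open>s\<close> at a point right of \<open>\<gamma> s\<close> whose own triangle still
        contains \<open>(x0, t0)\<close>, contrary to the choice of
        \<open>\<gamma> s\<close>.\<close>
      define \<xi> where "\<xi> = \<gamma> t - (t - s) * a (uL (\<gamma> t) t)"
      have m: "minimizers \<xi> s = {uL (\<gamma> t) t}" unfolding \<xi>_def using minimizers_back uL_minimizers s st by simp
      have "below \<xi> s (\<gamma> t) t" unfolding \<xi>_def
        by (rule belowI) (use s st uR_le_uL in auto)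
      then have lt: "\<gamma> s < \<xi>" using below_mono[OF y] less s by simp
      have "x0 \<le> \<xi> - (s - t0) * a (uR \<xi> s)"
      proof -
        have "\<gamma> s - (s - t0) * a (uR (\<gamma> s) s) \<le> \<xi> - (s - t0) * a (uR \<xi> s)"
          using minimizers_base_mono[OF uR_minimizers uR_minimizers lt]
            minimizers_strict_mono[OF uR_minimizers uR_minimizers lt, of s t0] s assms
          by (cases "t0 = 0") auto
        then show ?thesis using belowD(5)[OF Ps(1)] by simp
      qed
      moreover have "\<xi> - (s - t0) * a (uL \<xi> s) \<le> x0"
      proof -
        have "uL \<xi> s = uL (\<gamma> t) t" using m by (simp add: uL_def[of \<xi>])
        then show ?thesis using belowD(4)[OF Pt(1)] by (simp add: \<xi>_def algebra_simps)
      qed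
      ultimately have "below x0 t0 \<xi> s" using s assms by (simp add: below_def)
      then show False using Ps(2) lt by fastforce
    qed
    ultimately show ?thesis using y by simp
  qed
  then have "chain t0 \<gamma>" using assms by (simp add: chain_def)
  then show thesis by (rule that) (simp add: \<gamma>_def)
qed

lemma chain_shift: "chain t0 \<gamma> \<Longrightarrow> t0 \<le> t1 \<Longrightarrow> chain t1 \<gamma>"
  by (auto simp: chain_def)

lemma chain_continuous:
  assumes "chain t0 \<gamma>" shows "continuous_on {t0..} \<gamma>"
proof -
  obtain A where A: "A > 0" "\<And>u. -M \<le> u \<Longrightarrow> u \<le> M \<Longrightarrow> \<bar>a u\<bar> \<le> A" using a_bounded by blast
  have *: "\<bar>\<gamma> t - \<gamma> s\<bar> \<le> A * (t - s)" if st: "t0 \<le> s" "s < t" for s t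
  proof -
    have b: "below (\<gamma> s) s (\<gamma> t) t" using assms st by (simp add: chain_def)
    then obtain v where v: "uR (\<gamma> t) t \<le> v" "v \<le> uL (\<gamma> t) t" "\<gamma> s = \<gamma> t - (t - s) * a v"
      by (rule below_ivt)
    have "-M \<le> v" "v \<le> M" using v minimizers_bounded[OF _ uR_minimizers] minimizers_bounded[OF _ uL_minimizers] belowD(3)[OF b]
      by (meson order_trans)+
    then have "\<bar>(t - s) * a v\<bar> \<le> (t - s) * A" using A st by (simp add: abs_mult)
    then show ?thesis using v by (simp add: mult.commute)
  qed
  have "A-lipschitz_on {t0..} \<gamma>"
  proof (rule lipschitz_onI)
    fix s t assume "s \<in> {t0..}" "t \<in> {t0..}"
    then show "dist (\<gamma> s) (\<gamma> t) \<le> A * dist s t"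
      using *[of s t] *[of t s] by (cases s t rule: linorder_cases) (auto simp: dist_real_def)
  qed (use A in simp)
  then show ?thesis by (rule lipschitz_on_continuous_on)
qed

section \<open>Merging of forward characteristics and shocks\<close>

lemma chain_le:
  assumes "chain t0 \<gamma>1" "chain t0 \<gamma>2" "0 < t0" "\<gamma>1 t0 < \<gamma>2 t0" "t0 \<le> t"
  shows "\<gamma>1 t \<le> \<gamma>2 t"
proof (rule ccontr)
  assume n: "\<not> ?thesis"
  then have "t0 < t" using assms by (cases "t = t0") auto
  then have "below (\<gamma>1 t0) t0 (\<gamma>1 t) t" "below (\<gamma>2 t0) t0 (\<gamma>2 t) t" using assms by (auto simp: chain_def)
  then show False using below_mono[of "\<gamma>2 t0" t0 "\<gamma>2 t" t "\<gamma>1 t0" "\<gamma>1 t"] n assms by simp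
qed

lemma chain_eq:
  assumes "chain t0 \<gamma>1" "chain t0 \<gamma>2" "0 < t0" "\<gamma>1 t0 = \<gamma>2 t0" "t0 \<le> t"
  shows "\<gamma>1 t = \<gamma>2 t"
proof (cases "t = t0")
  case False
  then have "t0 < t" using assms by simp
  then have "below (\<gamma>1 t0) t0 (\<gamma>1 t) t" "below (\<gamma>2 t0) t0 (\<gamma>2 t) t"
    using assms(1,2) by (auto simp: chain_def)
  then show ?thesis using below_unique assms(3,4) by simp
qed (use assms in simp)

text \<open>Transitivity down to time 0: the base points of the earlier apex lie in the triangle of
  the later one, so along a chain the intervals of base points grow.\<close>

lemma base_extends:
  assumes "below x1 t1 x2 t2" "0 < t1"
  shows "x2 - t2 * a (uL x2 t2) \<le> x1 - t1 * a (uL x1 t1)"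
    "x1 - t1 * a (uR x1 t1) \<le> x2 - t2 * a (uR x2 t2)"
proof -
  have "below (x1 - t1 * a v) 0 x1 t1" if "v \<in> {uL x1 t1, uR x1 t1}" for v
    using belowI[of 0 t1 x1 v] assms(2) uR_le_uL that by auto
  then have "below (x1 - t1 * a v) 0 x2 t2" if "v \<in> {uL x1 t1, uR x1 t1}" for v
    using below_trans assms that by blast
  from belowD(4,5)[OF this] show "x2 - t2 * a (uL x2 t2) \<le> x1 - t1 * a (uL x1 t1)"
    "x1 - t1 * a (uR x1 t1) \<le> x2 - t2 * a (uR x2 t2)" by auto
qed

text \<open>The characteristics going back from \<open>\<gamma>1\<close> at the times
  \<open>T n\<close> are minimizing on ever longer time intervals, so a limit of them is minimizing
  on a whole ray. The role of \<open>\<gamma>2\<close> is to bound their base points on the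
  right.\<close>

lemma chain_disjoint_imp_supp:
  assumes c: "chain t0 \<gamma>1" "chain t0 \<gamma>2" and t0: "0 < t0" and less: "\<And>t. t0 \<le> t \<Longrightarrow> \<gamma>1 t < \<gamma>2 t"
  shows "\<exists>c y. supp c y"
proof -
  define T where "T = (\<lambda>n::nat. t0 + 1 + real n)"
  define U where "U = (\<lambda>n. uR (\<gamma>1 (T n)) (T n))"
  define Y where "Y = (\<lambda>n. \<gamma>1 (T n) - T n * a (U n))"
  have T: "T n > t0" "T n > 0" for n using t0 by (auto simp: T_def)
  have UM: "U n \<in> minimizers (\<gamma>1 (T n)) (T n)" for n unfolding U_def using uR_minimizers T by blast
  \<comment> \<open>The right base points of \<open>\<gamma>1\<close> move to the right in time and
    the left base points of \<open>\<gamma>2\<close> to the left, without passing each other. So all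
    of them stay between their positions at time \<open>t0\<close>.\<close>
  let ?p = "\<gamma>1 t0 - t0 * a (uR (\<gamma>1 t0) t0)" and ?q = "\<gamma>2 t0 - t0 * a (uL (\<gamma>2 t0) t0)"
  have "Y n \<in> {?p..?q}" for n
  proof -
    have b: "below (\<gamma>1 t0) t0 (\<gamma>1 (T n)) (T n)" "below (\<gamma>2 t0) t0 (\<gamma>2 (T n)) (T n)"
      using c T by (auto simp: chain_def)
    have "?p \<le> Y n" using base_extends(2)[OF b(1) t0] by (simp add: Y_def U_def)
    moreover have "Y n \<le> \<gamma>2 (T n) - T n * a (uL (\<gamma>2 (T n)) (T n))"
      unfolding Y_def by (rule minimizers_base_mono[OF UM uL_minimizers]) (use T less in \<open>auto simp: less_imp_le\<close>)
    moreover have "\<dots> \<le> ?q" by (rule base_extends(1)[OF b(2) t0])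
    ultimately show ?thesis by simp
  qed
  moreover have "U n \<in> {-M..M}" for n using minimizers_bounded[OF T(2) UM] by simp
  ultimately have "\<forall>n. (Y n, U n) \<in> {?p..?q} \<times> {-M..M}" by simp
  moreover have "seq_compact ({?p..?q} \<times> {-M..M})" by (intro compact_imp_seq_compact compact_Times compact_Icc)
  ultimately obtain l r where lr: "strict_mono (r :: nat \<Rightarrow> nat)" "((\<lambda>n. (Y n, U n)) \<circ> r) \<longlonglongrightarrow> l"
    unfolding seq_compact_def by (metis (no_types, lifting))
  obtain y w where l: "l = (y, w)" by fastforce
  have Yr: "(\<lambda>n. Y (r n)) \<longlonglongrightarrow> y" and Ur: "(\<lambda>n. U (r n)) \<longlonglongrightarrow> w"
    using tendsto_fst[OF lr(2)] tendsto_snd[OF lr(2)] by (auto simp: l o_def)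
  have "supp w y"
  proof (rule minimizers_ray_imp_supp)
    fix s :: real assume s: "s > 0"
    obtain k :: nat where k: "real k > s" using reals_Archimedean2 by blast
    have m: "U n \<in> minimizers (Y n + s * a (U n)) s" if "n \<ge> k" for n
    proof -
      have "s < T n" using k that t0 by (simp add: T_def)
      from minimizers_back[OF UM s this] show ?thesis by (simp add: Y_def algebra_simps)
    qed
    have "r (n + k) \<ge> k" for n using seq_suble[OF lr(1), of "n + k"] by simp
    then have mem: "U (r (n + k)) \<in> minimizers (Y (r (n + k)) + s * a (U (r (n + k)))) s" for n using m by simp
    have limU: "(\<lambda>n. U (r (n + k))) \<longlonglongrightarrow> w" by (rule LIMSEQ_ignore_initial_segment[OF Ur])
    have "(\<lambda>n. Y (r (n + k)) + s * a (U (r (n + k)))) \<longlonglongrightarrow> y + s * a w"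
      by (intro tendsto_intros isCont_tendsto_compose[OF isCont_a] LIMSEQ_ignore_initial_segment[OF Ur]
          LIMSEQ_ignore_initial_segment[OF Yr])
    then show "w \<in> minimizers (y + s * a w) s" by (rule minimizers_limit[OF _ limU mem])
  qed
  then show ?thesis by blast
qed

lemma chains_merge:
  assumes c: "chain t1 \<gamma>1" "chain t2 \<gamma>2" and none: "\<And>c y. \<not> supp c y"
  obtains T where "T \<ge> t1" "T \<ge> t2" "T > 0" "\<And>t. t \<ge> T \<Longrightarrow> \<gamma>1 t = \<gamma>2 t"
proof -
  \<comment> \<open>A positive time is chosen because order and uniqueness of forward
    characteristics may fail on the axis.\<close>
  define t0 where "t0 = max 1 (max t1 t2)"
  have t0: "t0 \<ge> t1" "t0 \<ge> t2" "t0 > 0" by (auto simp: t0_def)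
  have "\<exists>T\<ge>t0. \<gamma>1 T = \<gamma>2 T"
  proof (rule ccontr)
    assume "\<not> ?thesis"
    then have ne: "\<gamma>1 t \<noteq> \<gamma>2 t" if "t \<ge> t0" for t using that by blast
    note c0 = chain_shift[OF c(1) t0(1)] chain_shift[OF c(2) t0(2)]
    consider "\<gamma>1 t0 < \<gamma>2 t0" | "\<gamma>2 t0 < \<gamma>1 t0" using ne[of t0] by fastforce
    then show False
    proof cases
      case 1
      then have "\<gamma>1 t < \<gamma>2 t" if "t \<ge> t0" for t
        using chain_le[OF c0 t0(3) 1 that] ne[OF that] by simp
      then show False using chain_disjoint_imp_supp[OF c0 t0(3)] none by blast
    next
      case 2
      then have "\<gamma>2 t < \<gamma>1 t" if "t \<ge> t0" for t
        using chain_le[OF c0(2,1) t0(3) 2 that] ne[OF that] by simp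
      then show False using chain_disjoint_imp_supp[OF c0(2,1) t0(3)] none by blast
    qed
  qed
  then obtain T where T: "T \<ge> t0" "\<gamma>1 T = \<gamma>2 T" by blast
  have "\<gamma>1 t = \<gamma>2 t" if "t \<ge> T" for t
    using chain_eq[of T \<gamma>1 \<gamma>2 t] chain_shift[OF c(1), of T] chain_shift[OF c(2), of T] T t0 that by simp
  then show thesis using that T t0 by (meson less_le_trans order_trans)
qed

text \<open>After two chains have merged, the interval of base points contains base points of both.
  If those were apart at the start, the interval has positive length, which means a jump.\<close>

lemma shock_exists:
  assumes none: "\<And>c y. \<not> supp c y"
  obtains T \<gamma> where "T > 0" "chain T \<gamma>" "\<And>t. t > T \<Longrightarrow> uR (\<gamma> t) t < uL (\<gamma> t) t"
proof -
  obtain A where A: "A > 0" "\<And>u. -M \<le> u \<Longrightarrow> u \<le> M \<Longrightarrow> \<bar>a u\<bar> \<le> A" using a_bounded by blast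
  obtain \<gamma>1 where g1: "chain 1 \<gamma>1" "\<gamma>1 1 = 0" using chain_exists[of 1 0] by auto
  \<comment> \<open>At time 1 a base point is within \<open>A\<close> of the starting point. The
    distance \<open>2 * A + 1\<close> thus leaves base points at least 1 apart.\<close>
  obtain \<gamma>2 where g2: "chain 1 \<gamma>2" "\<gamma>2 1 = 2 * A + 1" using chain_exists[of 1 "2 * A + 1"] by auto
  obtain T where T: "T \<ge> 1" "\<And>t. t \<ge> T \<Longrightarrow> \<gamma>1 t = \<gamma>2 t"
    using chains_merge[OF g1(1) g2(1) none] by metis
  have "uR (\<gamma>1 t) t < uL (\<gamma>1 t) t" if "t > T" for t
  proof -
    have t: "1 < t" using that T by simp
    have b: "below (\<gamma>1 1) 1 (\<gamma>1 t) t" "below (\<gamma>2 1) 1 (\<gamma>1 t) t"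
      using chainD[OF g1(1) _ t] chainD[OF g2(1) _ t] T(2)[of t] that by simp_all
    have "\<gamma>1 t - t * a (uL (\<gamma>1 t) t) \<le> \<gamma>1 1 - a (uL (\<gamma>1 1) 1)" using base_extends[OF b(1)] by simp
    also have "\<dots> \<le> A" using A(2) minimizers_bounded[OF _ uL_minimizers] g1(2) by (fastforce simp: abs_le_iff)
    also have "\<dots> < \<gamma>2 1 - a (uR (\<gamma>2 1) 1)"
    proof -
      have "\<bar>a (uR (\<gamma>2 1) 1)\<bar> \<le> A" using A(2) minimizers_bounded[OF _ uR_minimizers] by simp
      then show ?thesis using g2(2) by simp
    qed
    also have "\<dots> \<le> \<gamma>1 t - t * a (uR (\<gamma>1 t) t)" using base_extends[OF b(2)] by simp
    finally have "t * a (uR (\<gamma>1 t) t) < t * a (uL (\<gamma>1 t) t)" by simp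
    then show ?thesis using t by simp
  qed
  then show thesis using that[of T \<gamma>1] T chain_shift[OF g1(1)] by simp
qed

text \<open>Comparing the minimizer \<open>u\<close> with the competitor \<open>u - \<epsilon>\<close> shows that the mean of the data
  between the two base points is at least \<open>u - \<epsilon>\<close>, and the base points are far apart for
  large \<open>t\<close>.\<close>

lemma minimizers_upper:
  assumes "\<epsilon> > 0" and S: "\<And>p q. (p, q) \<in> S \<Longrightarrow> p \<le> q \<Longrightarrow> \<Phi> q - \<Phi> p \<le> (c + \<epsilon>) * (q - p) + C"
  obtains T where "T > 0" "\<And>t x u. t \<ge> T \<Longrightarrow> u \<in> minimizers x t \<Longrightarrow>
    (c + 3 * \<epsilon> < u \<Longrightarrow> (x - t * a u, x - t * a (u - \<epsilon>)) \<in> S) \<Longrightarrow> u \<le> c + 3 * \<epsilon>"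
proof -
  \<comment> \<open>The minimum \<open>\<eta>\<close> of this difference of speeds over all possible
    states is positive and keeps the two base points at least \<open>t * \<eta>\<close> apart,
    uniformly in \<open>u\<close>.\<close>
  have "continuous_on {-M..M} (\<lambda>u. a u - a (u - \<epsilon>))"
    by (intro continuous_at_imp_continuous_on ballI continuous_intros isCont_a
      isCont_o2[where f="\<lambda>u. u - \<epsilon>" and g=a])
  then have "\<exists>v\<in>{-M..M}. \<forall>u\<in>{-M..M}. a v - a (v - \<epsilon>) \<le> a u - a (u - \<epsilon>)"
    by (intro continuous_attains_inf) (use M_nonneg in auto)
  then obtain v where v: "\<And>u. u \<in> {-M..M} \<Longrightarrow> a v - a (v - \<epsilon>) \<le> a u - a (u - \<epsilon>)"
    by blast
  define \<eta> where "\<eta> = a v - a (v - \<epsilon>)"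
  have \<eta>: "\<eta> > 0" using assms by (simp add: \<eta>_def)
  \<comment> \<open>Of the margin \<open>3 * \<epsilon>\<close>, the competitor uses up one
    \<open>\<epsilon>\<close> and the mean of the data another. The third, times the distance of the
    base points, exceeds \<open>C\<close> from this time on.\<close>
  define T where "T = (\<bar>C\<bar> + 1) / (\<epsilon> * \<eta>)"
  have T: "T > 0" "T * (\<epsilon> * \<eta>) = \<bar>C\<bar> + 1" using assms \<eta> by (auto simp: T_def)
  show thesis
  proof (rule that[OF T(1)], rule ccontr)
    \<comment> \<open>Membership in \<open>S\<close> is demanded only of a \<open>u\<close> that
      violates the bound. In one-sided regions it is this violation that puts the competitor's base
      point on the right side.\<close>
    fix t x u assume t: "T \<le> t" and u: "u \<in> minimizers x t"
      and mem: "c + 3 * \<epsilon> < u \<Longrightarrow> (x - t * a u, x - t * a (u - \<epsilon>)) \<in> S" and "\<not> u \<le> c + 3 * \<epsilon>"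
    then have big: "c + 3 * \<epsilon> < u" by simp
    have t0: "t > 0" using t T by simp
    let ?p = "x - t * a u" and ?q = "x - t * a (u - \<epsilon>)"
    have len: "?q - ?p = t * (a u - a (u - \<epsilon>))" by (simp add: algebra_simps)
    have "T * \<eta> \<le> t * (a u - a (u - \<epsilon>))"
      using v[of u] minimizers_bounded[OF t0 u] t T \<eta> by (intro mult_mono) (auto simp: \<eta>_def)
    then have far: "T * \<eta> \<le> ?q - ?p" using len by simp
    have le: "?p \<le> ?q" using t0 assms by simp
    have "G u x t \<le> G (u - \<epsilon>) x t" using u by (simp add: minimizers_def)
    then have "t * L u - t * L (u - \<epsilon>) \<le> \<Phi> ?q - \<Phi> ?p" by (simp add: G_def)
    moreover have "t * (L (u - \<epsilon>) + (u - \<epsilon>) * (a u - a (u - \<epsilon>))) \<le> t * L u" using L_ge t0 by simp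
    ultimately have "(u - \<epsilon>) * (?q - ?p) \<le> \<Phi> ?q - \<Phi> ?p" unfolding len by (simp add: algebra_simps)
    also have "\<dots> \<le> (c + \<epsilon>) * (?q - ?p) + C" by (rule S[OF mem[OF big] le])
    finally have "(u - c - 2 * \<epsilon>) * (?q - ?p) \<le> C" by (simp add: algebra_simps)
    moreover have "\<epsilon> * (T * \<eta>) \<le> (u - c - 2 * \<epsilon>) * (?q - ?p)"
      using big far assms T \<eta> by (intro mult_mono) auto
    ultimately show False using T(2) by (simp add: algebra_simps)
  qed
qed

text \<open>Now the competitor is \<open>u + \<epsilon>\<close>. Its base point lies left of that of
  \<open>u\<close>, and the mean of the data between them is at most
  \<open>u + \<epsilon>\<close>.\<close>

lemma minimizers_lower:
  assumes "\<epsilon> > 0" and S: "\<And>p q. (p, q) \<in> S \<Longrightarrow> p \<le> q \<Longrightarrow> (c - \<epsilon>) * (q - p) - C \<le> \<Phi> q - \<Phi> p"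
  obtains T where "T > 0" "\<And>t x u. t \<ge> T \<Longrightarrow> u \<in> minimizers x t \<Longrightarrow>
    (u < c - 3 * \<epsilon> \<Longrightarrow> (x - t * a (u + \<epsilon>), x - t * a u) \<in> S) \<Longrightarrow> c - 3 * \<epsilon> \<le> u"
proof -
  have "continuous_on {-M..M} (\<lambda>u. a (u + \<epsilon>) - a u)"
    by (intro continuous_at_imp_continuous_on ballI continuous_intros isCont_a
      isCont_o2[where f="\<lambda>u. u + \<epsilon>" and g=a])
  then have "\<exists>v\<in>{-M..M}. \<forall>u\<in>{-M..M}. a (v + \<epsilon>) - a v \<le> a (u + \<epsilon>) - a u"
    by (intro continuous_attains_inf) (use M_nonneg in auto)
  then obtain v where v: "\<And>u. u \<in> {-M..M} \<Longrightarrow> a (v + \<epsilon>) - a v \<le> a (u + \<epsilon>) - a u"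
    by blast
  define \<eta> where "\<eta> = a (v + \<epsilon>) - a v"
  have \<eta>: "\<eta> > 0" using assms by (simp add: \<eta>_def)
  define T where "T = (\<bar>C\<bar> + 1) / (\<epsilon> * \<eta>)"
  have T: "T > 0" "T * (\<epsilon> * \<eta>) = \<bar>C\<bar> + 1" using assms \<eta> by (auto simp: T_def)
  show thesis
  proof (rule that[OF T(1)], rule ccontr)
    fix t x u assume t: "T \<le> t" and u: "u \<in> minimizers x t"
      and mem: "u < c - 3 * \<epsilon> \<Longrightarrow> (x - t * a (u + \<epsilon>), x - t * a u) \<in> S" and "\<not> c - 3 * \<epsilon> \<le> u"
    then have big: "u < c - 3 * \<epsilon>" by simp
    have t0: "t > 0" using t T by simp
    let ?q = "x - t * a u" and ?p = "x - t * a (u + \<epsilon>)"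
    have len: "?q - ?p = t * (a (u + \<epsilon>) - a u)" by (simp add: algebra_simps)
    have "T * \<eta> \<le> t * (a (u + \<epsilon>) - a u)"
      using v[of u] minimizers_bounded[OF t0 u] t T \<eta> by (intro mult_mono) (auto simp: \<eta>_def)
    then have far: "T * \<eta> \<le> ?q - ?p" using len by simp
    have le: "?p \<le> ?q" using t0 assms by simp
    have "G u x t \<le> G (u + \<epsilon>) x t" using u by (simp add: minimizers_def)
    then have "\<Phi> ?q - \<Phi> ?p \<le> t * L (u + \<epsilon>) - t * L u" by (simp add: G_def)
    moreover have "t * (L (u + \<epsilon>) + (u + \<epsilon>) * (a u - a (u + \<epsilon>))) \<le> t * L u" using L_ge t0 by simp
    ultimately have "\<Phi> ?q - \<Phi> ?p \<le> (u + \<epsilon>) * (?q - ?p)" unfolding len by (simp add: algebra_simps)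
    moreover have "(c - \<epsilon>) * (?q - ?p) - C \<le> \<Phi> ?q - \<Phi> ?p" by (rule S[OF mem[OF big] le])
    ultimately have "(c - 2 * \<epsilon> - u) * (?q - ?p) \<le> C" by (simp add: algebra_simps)
    moreover have "\<epsilon> * (T * \<eta>) \<le> (c - 2 * \<epsilon> - u) * (?q - ?p)"
      using big far assms T \<eta> by (intro mult_mono) auto
    ultimately show False using T(2) by (simp add: algebra_simps)
  qed
qed

end

section \<open>The solution formula\<close>

definition locally_integrable :: "(real \<Rightarrow> real) \<Rightarrow> bool" where
  "locally_integrable \<psi> \<longleftrightarrow> (\<forall>p q. \<psi> absolutely_integrable_on {p..q})"

lemma LINT_eq_integral:
  assumes "locally_integrable \<psi>" "p \<le> q"
  shows "(LINT s=ereal p..ereal q|lebesgue. \<psi> s) = integral {p..q} \<psi>"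
proof -
  have "(LINT s:{p<..<q}|lebesgue. \<psi> s) = integral {p<..<q} \<psi>"
  proof (rule set_lebesgue_integral_eq_integral(2))
    show "set_integrable lebesgue {p<..<q} \<psi>"
      using assms by (auto simp: locally_integrable_def intro: set_integrable_subset[of _ "{p..q}"])
  qed
  then show ?thesis
    using assms(2) integral_open_interval_real[of p q \<psi>]
    by (simp add: interval_lebesgue_integral_def einterval_eq)
qed

lemma LINT_rev:
  fixes p q :: real
  shows "(LINT s=ereal q..ereal p|lebesgue. \<psi> s) = - (LINT s=ereal p..ereal q|lebesgue. \<psi> s)"
  by (cases p q rule: linorder_cases) (auto simp: interval_lebesgue_integral_def set_lebesgue_integral_def)

lemma Phi_0: "Phi \<psi> 0 = 0"
  by (simp add: Phi_def zero_ereal_def interval_lebesgue_integral_def set_lebesgue_integral_def)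

lemma Phi_diff:
  assumes "locally_integrable \<psi>" "x \<le> y"
  shows "Phi \<psi> y - Phi \<psi> x = integral {x..y} \<psi>"
proof -
  have int: "\<psi> integrable_on {p..q}" for p q
    using assms(1) by (auto simp: locally_integrable_def intro: set_lebesgue_integral_eq_integral(1))
  have pos: "Phi \<psi> z = integral {0..z} \<psi>" if "0 \<le> z" for z
    using LINT_eq_integral[OF assms(1) that] by (simp add: Phi_def zero_ereal_def)
  have neg: "Phi \<psi> z = - integral {z..0} \<psi>" if "z \<le> 0" for z
    using LINT_eq_integral[OF assms(1) that] LINT_rev[of 0 z \<psi>] by (simp add: Phi_def zero_ereal_def)
  consider "0 \<le> x" | "x \<le> 0" "0 \<le> y" | "y \<le> 0" using assms by linarith
  then show ?thesis
  proof cases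
    case 1
    then show ?thesis
      using Henstock_Kurzweil_Integration.integral_combine[of 0 x y, OF _ assms(2) int] pos assms(2) by simp
  next
    case 2
    then show ?thesis
      using Henstock_Kurzweil_Integration.integral_combine[of x 0 y, OF _ _ int] pos neg by simp
  next
    case 3
    then show ?thesis
      using Henstock_Kurzweil_Integration.integral_combine[of x y 0, OF assms(2) _ int] neg assms(2) by simp
  qed
qed

lemma LINT_eq_Phi:
  assumes "locally_integrable \<psi>"
  shows "(LINT s=ereal x..ereal y|lebesgue. \<psi> s) = Phi \<psi> y - Phi \<psi> x"
proof (cases "x \<le> y")
  case True
  then show ?thesis using LINT_eq_integral Phi_diff assms by simp
next
  case False
  then show ?thesis using LINT_eq_integral[of \<psi> y x] Phi_diff[of \<psi> y x] LINT_rev[where p=y and q=x and \<psi>=\<psi>] assms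
    by linarith
qed

lemma bounded_imp_locally_integrable:
  assumes "\<psi> \<in> borel_measurable lebesgue" "AE x in lebesgue. \<bar>\<psi> x\<bar> \<le> C"
  shows "locally_integrable \<psi>"
  unfolding locally_integrable_def set_integrable_def
  by (intro allI integrableI_bounded_set_indicator[where B=C])
    (use assms in \<open>auto simp: emeasure_lborel_Icc_eq\<close>)

lemma bounded_imp_Phi_lipschitz:
  assumes "\<psi> \<in> borel_measurable lebesgue" "AE x in lebesgue. \<bar>\<psi> x\<bar> \<le> C"
  shows "\<bar>Phi \<psi> y - Phi \<psi> x\<bar> \<le> C * \<bar>y - x\<bar>"
proof -
  note li = bounded_imp_locally_integrable[OF assms]
  have *: "\<bar>Phi \<psi> q - Phi \<psi> p\<bar> \<le> C * (q - p)" if pq: "p \<le> q" for p q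
  proof -
    have si: "set_integrable lebesgue {p..q} \<psi>" using li by (simp add: locally_integrable_def)
    have "Phi \<psi> q - Phi \<psi> p = (LINT s:{p..q}|lebesgue. \<psi> s)"
      using Phi_diff[OF li pq] set_lebesgue_integral_eq_integral(2)[OF si] by simp
    also have "\<bar>\<dots>\<bar> \<le> (LINT s|lebesgue. norm (indicator {p..q} s *\<^sub>R \<psi> s))"
      unfolding set_lebesgue_integral_def using integral_norm_bound by (metis real_norm_def)
    also have "\<dots> \<le> (LINT s|lebesgue. indicator {p..q} s *\<^sub>R C)"
    proof (rule integral_mono_AE)
      show "integrable lebesgue (\<lambda>s. norm (indicator {p..q} s *\<^sub>R \<psi> s))"
        using si by (simp add: set_integrable_def del: norm_scaleR)
      show "integrable lebesgue (\<lambda>s. indicator {p..q} s *\<^sub>R C)"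
        by (simp add: emeasure_lborel_Icc_eq)
      show "AE s in lebesgue. norm (indicator {p..q} s *\<^sub>R \<psi> s) \<le> indicator {p..q} s *\<^sub>R C"
        using assms(2) by eventually_elim (auto simp: indicator_def)
    qed
    also have "\<dots> = C * (q - p)" using pq by simp
    finally show ?thesis .
  qed
  show ?thesis using *[of x y] *[of y x] by (cases "x \<le> y") (auto simp: abs_minus_commute)
qed

section \<open>The substitution in the solution formula\<close>

locale flux =
  fixes f :: "real \<Rightarrow> real"
  assumes f_C2: "C2 f"
    and f_convex: "\<And>s. deriv (deriv f) s \<ge> 0"
    and f_nondeg: "{s. deriv (deriv f) s = 0} \<in> null_sets lebesgue"
begin

abbreviation a :: "real \<Rightarrow> real" where "a \<equiv> deriv f"

lemma f_deriv: "(f has_real_derivative a u) (at u)"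
  using f_C2 by (simp add: C2_def DERIV_deriv_iff_real_differentiable)

lemma a_deriv: "(a has_real_derivative deriv a u) (at u)"
  using f_C2 by (simp add: C2_def DERIV_deriv_iff_real_differentiable)

lemma a_cont: "continuous_on UNIV a"
  using a_deriv DERIV_isCont continuous_at_imp_continuous_on by blast

text \<open>If the nondecreasing function \<open>a\<close> took the same value at \<open>p\<close>
  and \<open>q\<close>, its derivative would vanish on the whole interval between them, which is not
  a null set.\<close>

lemma a_mono: "strict_mono a"
proof (rule strict_monoI)
  have le: "a x \<le> a y" if "x \<le> y" for x y
    by (rule DERIV_nonneg_imp_nondecreasing[OF that]) (use a_deriv f_convex in blast)
  fix p q :: real assume pq: "p < q"
  have "a p \<noteq> a q"
  proof
    assume eq: "a p = a q"
    have const: "a s = a p" if "s \<in> {p<..<q}" for s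
      using le[of p s] le[of s q] eq that by auto
    have "deriv a s = 0" if s: "s \<in> {p<..<q}" for s
    proof -
      have "((\<lambda>_. a p) has_real_derivative 0) (at s)" by simp
      then have "(a has_real_derivative 0) (at s)"
        by (rule has_field_derivative_transform_within_open[of _ _ _ "{p<..<q}"]) (use s const in auto)
      then show ?thesis by (rule DERIV_imp_deriv)
    qed
    then have "{p<..<q} \<subseteq> {s. deriv a s = 0}" by blast
    then have "{p<..<q} \<in> null_sets lebesgue"
      by (rule null_sets_subset[OF f_nondeg, rotated]) simp
    then show False using pq by (simp add: null_sets_def emeasure_lborel_Ioo)
  qed
  then show "a p < a q" using le[of p q] pq by simp
qed

lemma substitution:
  fixes x :: real
  assumes li: "locally_integrable \<psi>" and t: "t > 0" and pq: "p \<le> q"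
  defines "k \<equiv> \<lambda>s. deriv a s * (\<psi> (x - t * a s) - s)"
  shows "k absolutely_integrable_on {p..q}"
    and "t * integral {p..q} k = Phi \<psi> (x - t * a p) - Phi \<psi> (x - t * a q)
      - t * ((q * a q - f q) - (p * a p - f p))"
proof -
  let ?g = "\<lambda>s. x - t * a s"
  have g: "(?g has_real_derivative - (t * deriv a s)) (at s within {p..q})" for s
    by (auto intro!: derivative_eq_intros has_field_derivative_at_within[OF a_deriv])
  have inj: "inj_on ?g {p..q}" using t a_mono by (auto simp: inj_on_def strict_mono_eq)
  have img: "?g ` {p..q} = {?g q..?g p}"
  proof (intro equalityI subsetI)
    fix z assume "z \<in> ?g ` {p..q}"
    then show "z \<in> {?g q..?g p}" using t a_mono by (auto simp: strict_mono_less_eq)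
  next
    fix z assume z: "z \<in> {?g q..?g p}"
    have "a p \<le> (x - z) / t" "(x - z) / t \<le> a q" using z t by (auto simp: field_simps)
    then obtain s where "p \<le> s" "s \<le> q" "a s = (x - z) / t"
      using IVT'[of a p "(x - z) / t" q] pq a_cont continuous_on_subset by blast
    then show "z \<in> ?g ` {p..q}" using t by (intro image_eqI[of _ _ s]) auto
  qed
  have abs: "\<bar>- (t * deriv a s)\<bar> = t * deriv a s" for s using t f_convex[of s] by (simp add: abs_mult)
  have "\<psi> absolutely_integrable_on ?g ` {p..q}" using li img by (simp add: locally_integrable_def)
  then have cv: "(\<lambda>s. t * deriv a s * \<psi> (?g s)) absolutely_integrable_on {p..q}"
      "integral {p..q} (\<lambda>s. t * deriv a s * \<psi> (?g s)) = integral {?g q..?g p} \<psi>"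
    using has_absolute_integral_change_of_variables_1'[OF _ g inj, of \<psi> "integral {?g q..?g p} \<psi>"] img
    unfolding abs by auto
  have "continuous_on {p..q} (\<lambda>s. t * (deriv a s * s))"
    using f_C2 unfolding C2_def by (auto intro!: continuous_intros intro: continuous_on_subset)
  then have abs2: "(\<lambda>s. t * (deriv a s * s)) absolutely_integrable_on {p..q}"
    by (rule absolutely_integrable_continuous_real)
  \<comment> \<open>The antiderivative of \<open>deriv a s * s\<close> is
    \<open>s * a s - f s\<close>, by parts; this is how the Legendre transform enters.\<close>
  have "((\<lambda>s. t * (deriv a s * s)) has_integral t * (q * a q - f q) - t * (p * a p - f p)) {p..q}"
    by (rule fundamental_theorem_of_calculus[OF pq],
        unfold has_real_derivative_iff_has_vector_derivative[symmetric])
      (auto intro!: derivative_eq_intros has_field_derivative_at_within[OF a_deriv]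
        has_field_derivative_at_within[OF f_deriv] simp: algebra_simps)
  then have int2: "integral {p..q} (\<lambda>s. t * (deriv a s * s)) = t * ((q * a q - f q) - (p * a p - f p))"
    by (simp add: integral_unique algebra_simps)
  have tk: "(\<lambda>s. t * k s) = (\<lambda>s. t * deriv a s * \<psi> (?g s) - t * (deriv a s * s))"
    by (simp add: k_def algebra_simps)
  have "(\<lambda>s. t * k s) absolutely_integrable_on {p..q}"
    unfolding tk by (rule set_integral_diff(1)[OF cv(1) abs2])
  then show "k absolutely_integrable_on {p..q}"
    using t absolutely_integrable_on_scaleR_iff[where c=t and f=k and S="{p..q}"] by simp
  have "t * integral {p..q} k = integral {p..q} (\<lambda>s. t * k s)" by simp
  also have "\<dots> = integral {?g q..?g p} \<psi> - t * ((q * a q - f q) - (p * a p - f p))"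
    unfolding tk using Henstock_Kurzweil_Integration.integral_diff[OF
      set_lebesgue_integral_eq_integral(1)[OF cv(1)] set_lebesgue_integral_eq_integral(1)[OF abs2]] cv(2) int2
    by simp
  also have "integral {?g q..?g p} \<psi> = Phi \<psi> (?g p) - Phi \<psi> (?g q)"
    using Phi_diff[OF li, of "?g q" "?g p"] t a_mono pq by (simp add: strict_mono_less_eq)
  finally show "t * integral {p..q} k = Phi \<psi> (x - t * a p) - Phi \<psi> (x - t * a q)
      - t * ((q * a q - f q) - (p * a p - f p))" .
qed

lemma E_eq:
  assumes li: "locally_integrable \<psi>" and t: "t > 0"
  shows "E f \<psi> u x t = Phi \<psi> (x - t * a 0) - t * f 0 - (Phi \<psi> (x - t * a u) + t * (u * a u - f u))"
proof -
  define k where "k = (\<lambda>s. deriv a s * (\<psi> (x - t * a s) - s))"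
  have k: "locally_integrable k"
    unfolding locally_integrable_def
  proof (intro allI)
    fix p q show "k absolutely_integrable_on {p..q}"
      using substitution(1)[OF li t, of p q x] by (cases "p \<le> q") (auto simp: k_def)
  qed
  have E: "E f \<psi> u x t = t * (LINT s=ereal 0..ereal u|lebesgue. k s)"
    by (simp add: E_def k_def zero_ereal_def)
  show ?thesis
  proof (cases "0 \<le> u")
    case True
    then show ?thesis
      using LINT_eq_integral[OF k True] substitution(2)[OF li t True, of x]
      unfolding E k_def[symmetric] by (simp add: algebra_simps)
  next
    case False
    then have u: "u \<le> 0" by simp
    show ?thesis
      using LINT_eq_integral[OF k u] LINT_rev[where p=u and q=0 and \<psi>=k] substitution(2)[OF li t u, of x]
      unfolding E k_def[symmetric] by (simp add: algebra_simps)
  qed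
qed

text \<open>The offset \<open>d\<close> is for the hull: \<open>Phi\<close> of its derivative
  vanishes at 0, whereas the hull need not. Constants do not affect minimizers.\<close>

lemma maximizers_eq:
  assumes "locally_integrable \<psi>" "t > 0" and h: "hopf_lax f a \<Psi> M" and d: "\<And>z. Phi \<psi> z = \<Psi> z + d"
  shows "maximizers f \<psi> x t = hopf_lax.minimizers f a \<Psi> x t"
proof -
  have "E f \<psi> v x t \<le> E f \<psi> u x t \<longleftrightarrow> hopf_lax.G f a \<Psi> u x t \<le> hopf_lax.G f a \<Psi> v x t" for u v
    using E_eq[OF assms(1,2)] d by (auto simp: hopf_lax.G_def[OF h] hopf_lax.L_def[OF h])
  then show ?thesis by (simp add: maximizers_def hopf_lax.minimizers_def[OF h])
qed

lemma hopf_laxI: "(\<And>x y. \<bar>\<Psi> x - \<Psi> y\<bar> \<le> M * \<bar>x - y\<bar>) \<Longrightarrow> hopf_lax f a \<Psi> M"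
  by unfold_locales (use f_deriv a_mono a_cont in auto)

end

section \<open>Support lines and the convex hull\<close>

lemma supportsD: "supports \<Phi> c y \<Longrightarrow> \<Phi> y + c * (z - y) \<le> \<Phi> z"
  by (simp add: supports_def)

lemma supports_mono:
  assumes "supports \<Phi> c y" "supports \<Phi> c' y'" "y < y'"
  shows "c \<le> c'"
proof -
  have "c * (y' - y) \<le> c' * (y' - y)"
    using supportsD[OF assms(1), of y'] supportsD[OF assms(2), of y] by (simp add: algebra_simps)
  then show ?thesis using assms(3) by simp
qed

lemma supports_reflect: "supports (\<lambda>x. \<Phi> (- x)) c y \<longleftrightarrow> supports \<Phi> (- c) (- y)"
proof -
  have "(\<forall>z. P (- z)) \<longleftrightarrow> (\<forall>z. P z)" for P :: "real \<Rightarrow> bool" by (metis minus_minus)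
  from this[of "\<lambda>z. \<Phi> (- y) + - c * (z + y) \<le> \<Phi> z"]
  show ?thesis by (simp add: supports_def algebra_simps)
qed

text \<open>A minimum of \<open>\<Phi> y - c * y\<close> over the interval is global as soon as a
  single point \<open>w\<close> of the interval is at least as good as all points outside.\<close>

lemma supports_attained:
  assumes "continuous_on UNIV \<Phi>" "w \<in> {p..q}"
    and out: "\<And>y. y \<notin> {p..q} \<Longrightarrow> \<Phi> w + c * (y - w) \<le> \<Phi> y"
  obtains z where "z \<in> {p..q}" "supports \<Phi> c z" "\<Phi> z - c * z \<le> \<Phi> w - c * w"
proof -
  have "continuous_on {p..q} (\<lambda>y. \<Phi> y - c * y)"
    by (intro continuous_intros continuous_on_subset[OF assms(1)]) auto
  then obtain z where z: "z \<in> {p..q}" "\<And>y. y \<in> {p..q} \<Longrightarrow> \<Phi> z - c * z \<le> \<Phi> y - c * y"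
    using continuous_attains_inf[of "{p..q}" "\<lambda>y. \<Phi> y - c * y"] assms(2) by auto
  have w: "\<Phi> z - c * z \<le> \<Phi> w - c * w" using z assms(2) by simp
  have "\<Phi> z + c * (y - z) \<le> \<Phi> y" for y
    using z(2)[of y] out[of y] w by (cases "y \<in> {p..q}") (auto simp: algebra_simps)
  then show thesis using that z(1) w by (simp add: supports_def)
qed

lemma supports_le_slope:
  assumes "supports \<Phi> c y" "((\<lambda>x. \<Phi> x / x) \<longlongrightarrow> r) at_top"
  shows "c \<le> r"
proof (rule tendsto_le[OF _ assms(2)])
  have "((\<lambda>x. (\<Phi> y - c * y) / x) \<longlongrightarrow> 0) at_top"
    by (rule tendsto_divide_0[OF tendsto_const]) (simp add: filterlim_at_top_imp_at_infinity filterlim_ident)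
  from tendsto_add[OF this tendsto_const[of c]]
  show "((\<lambda>x. (\<Phi> y - c * y) / x + c) \<longlongrightarrow> c) at_top" by simp
  show "\<forall>\<^sub>F x in at_top. (\<Phi> y - c * y) / x + c \<le> \<Phi> x / x"
    using eventually_gt_at_top[of 0]
  proof eventually_elim
    fix x :: real assume x: "0 < x"
    have "(\<Phi> y - c * y) / x + c = (\<Phi> y - c * y + c * x) / x" using x by (simp add: field_simps)
    also have "\<dots> \<le> \<Phi> x / x"
      using supportsD[OF assms(1), of x] x by (intro divide_right_mono) (auto simp: algebra_simps)
    finally show "(\<Phi> y - c * y) / x + c \<le> \<Phi> x / x" .
  qed
qed simp

lemma slope_tendsto_reflect:
  fixes \<Phi> :: "real \<Rightarrow> real"
  assumes "((\<lambda>x. \<Phi> x / x) \<longlongrightarrow> l) at_bot"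
  shows "((\<lambda>x. \<Phi> (- x) / x) \<longlongrightarrow> - l) at_top"
  using tendsto_minus[OF filterlim_compose[OF assms filterlim_uminus_at_bot_at_top]] by simp

lemma supports_ge_slope:
  assumes "supports \<Phi> c y" "((\<lambda>x. \<Phi> x / x) \<longlongrightarrow> l) at_bot"
  shows "l \<le> c"
  using supports_le_slope[of "\<lambda>x. \<Phi> (- x)" "- c" "- y", OF _ slope_tendsto_reflect[OF assms(2)]] assms(1)
  by (simp add: supports_reflect)

lemma slope_eventually_above:
  fixes \<Phi> :: "real \<Rightarrow> real"
  assumes "((\<lambda>x. \<Phi> x / x) \<longlongrightarrow> r) at_top" "c < r"
  shows "\<forall>\<^sub>F x in at_top. k + c * x \<le> \<Phi> x"
proof -
  define d where "d = (c + r) / 2"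
  have d: "c < d" "d < r" using assms by (auto simp: d_def)
  show ?thesis
    using order_tendstoD(1)[OF assms(1) d(2)] eventually_ge_at_top[of "\<bar>k\<bar> / (d - c)"] eventually_gt_at_top[of 0]
  proof eventually_elim
    case (elim x)
    have "k \<le> (d - c) * x" using elim d by (auto simp: pos_divide_le_eq algebra_simps)
    moreover have "d * x \<le> \<Phi> x" using elim by (simp add: field_simps)
    ultimately show ?case by (simp add: algebra_simps)
  qed
qed

text \<open>If the line of slope \<open>r\<close> at \<open>e\<close> failed at some
  \<open>y\<close> to the right, a line of slope \<open>c\<close> slightly below \<open>r\<close>
  would fail there, too. Then \<open>\<Phi>\<close> minus this line is below its value at
  \<open>e\<close> in \<open>y\<close>, but not left of \<open>e\<close>, and it grows at infinity
  because \<open>c < r\<close>. Its minimum would be a support point right of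
  \<open>e\<close>.\<close>

lemma supports_right_end:
  assumes cont: "continuous_on UNIV \<Phi>" and lim: "((\<lambda>x. \<Phi> x / x) \<longlongrightarrow> r) at_top"
    and c1: "supports \<Phi> c1 e" and none: "\<And>y c. e < y \<Longrightarrow> \<not> supports \<Phi> c y"
  shows "supports \<Phi> r e"
proof -
  have c1r: "c1 \<le> r" by (rule supports_le_slope[OF c1 lim])
  have left: "\<Phi> e + c * (y - e) \<le> \<Phi> y" if "y < e" "c1 \<le> c" for y c
    using supportsD[OF c1, of y] mult_right_mono[OF that(2), of "e - y"] that by (simp add: algebra_simps)
  have right: "\<Phi> e + r * (y - e) \<le> \<Phi> y" if y: "e < y" for y
  proof (rule ccontr)
    assume "\<not> ?thesis"
    then have less: "(\<Phi> y - \<Phi> e) / (y - e) < r" using y by (simp add: pos_divide_less_eq algebra_simps)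
    have "c1 \<le> (\<Phi> y - \<Phi> e) / (y - e)"
      using supportsD[OF c1, of y] y by (simp add: pos_le_divide_eq algebra_simps)
    \<comment> \<open>The slope \<open>c\<close> must exceed the chord slope, so that
      \<open>y\<close> beats \<open>e\<close>, and stay below \<open>r\<close>, so that the minimum
      is attained.\<close>
    moreover obtain c where "(\<Phi> y - \<Phi> e) / (y - e) < c" "c < r" using dense[OF less] by blast
    ultimately have c: "c1 < c" "(\<Phi> y - \<Phi> e) / (y - e) < c" "c < r" by simp_all
    have yc: "\<Phi> y < \<Phi> e + c * (y - e)" using c(2) y by (simp add: pos_divide_less_eq algebra_simps)
    obtain Z where Z: "Z \<ge> y" "\<And>z. z \<ge> Z \<Longrightarrow> (\<Phi> y - c * y) + c * z \<le> \<Phi> z"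
      using eventually_conj[OF slope_eventually_above[OF lim c(3), of "\<Phi> y - c * y"] eventually_ge_at_top[of y]]
      unfolding eventually_at_top_linorder by auto
    obtain z where z: "z \<in> {e..Z}" "supports \<Phi> c z" "\<Phi> z - c * z \<le> \<Phi> y - c * y"
    proof (rule supports_attained[OF cont, of y e Z c])
      show "y \<in> {e..Z}" using y Z by simp
      fix w assume "w \<notin> {e..Z}"
      then consider "w < e" | "w > Z" by fastforce
      then show "\<Phi> y + c * (w - y) \<le> \<Phi> w"
      proof cases
        case 1
        then show ?thesis using left[of w c] c(1) yc by (simp add: algebra_simps)
      next
        case 2
        then show ?thesis using Z(2)[of w] by (simp add: algebra_simps)
      qed
    qed
    have "z \<noteq> e" using z(3) yc by (auto simp: algebra_simps)
    then show False using none[of z c] z by simp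
  qed
  have "\<Phi> e + r * (y - e) \<le> \<Phi> y" for y
    using left[of y r] right[of y] c1r by (cases y e rule: linorder_cases) auto
  then show ?thesis by (simp add: supports_def)
qed

lemma supports_left_end:
  assumes cont: "continuous_on UNIV \<Phi>" and lim: "((\<lambda>x. \<Phi> x / x) \<longlongrightarrow> l) at_bot"
    and c1: "supports \<Phi> c1 h" and none: "\<And>y c. y < h \<Longrightarrow> \<not> supports \<Phi> c y"
  shows "supports \<Phi> l h"
proof -
  have "continuous_on UNIV (\<lambda>x. \<Phi> (- x))"
    by (intro continuous_on_compose2[OF cont] continuous_intros) auto
  then have "supports (\<lambda>x. \<Phi> (- x)) (- l) (- h)"
    by (rule supports_right_end[OF _ slope_tendsto_reflect[OF lim], of "- c1"])
      (use c1 none in \<open>auto simp: supports_reflect\<close>)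
  then show ?thesis by (simp add: supports_reflect)
qed

text \<open>For \<open>l < c < r\<close> the function \<open>\<Phi> y - c * y\<close> exceeds its
  value at 0 far out on both sides, so it has a global minimum.\<close>

lemma supports_exists:
  assumes cont: "continuous_on UNIV \<Phi>" and "((\<lambda>x. \<Phi> x / x) \<longlongrightarrow> r) at_top"
    "((\<lambda>x. \<Phi> x / x) \<longlongrightarrow> l) at_bot" "l < r"
  obtains c y where "supports \<Phi> c y"
proof -
  obtain c where c: "l < c" "c < r" using dense assms(4) by blast
  obtain Z where Z: "Z \<ge> 0" "\<And>z. z \<ge> Z \<Longrightarrow> \<Phi> 0 + c * z \<le> \<Phi> z"
    using eventually_conj[OF slope_eventually_above[OF assms(2) c(2), of "\<Phi> 0"] eventually_ge_at_top[of 0]]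
    unfolding eventually_at_top_linorder by auto
  obtain Y where Y: "Y \<ge> 0" "\<And>z. z \<ge> Y \<Longrightarrow> \<Phi> 0 + (- c) * z \<le> \<Phi> (- z)"
    using eventually_conj[OF slope_eventually_above[OF slope_tendsto_reflect[OF assms(3)], of "- c" "\<Phi> 0"]
        eventually_ge_at_top[of 0]] c(1)
    unfolding eventually_at_top_linorder by auto
  show thesis
  proof (rule supports_attained[OF cont, of 0 "- Y" Z c])
    show "0 \<in> {-Y..Z}" using Z Y by simp
    fix y assume "y \<notin> {-Y..Z}"
    then show "\<Phi> 0 + c * (y - 0) \<le> \<Phi> y" using Z(2)[of y] Y(2)[of "- y"] by fastforce
  qed (rule that)
qed

text \<open>The chord slope lies between \<open>c1\<close> and \<open>c2\<close>, so subtracting the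
  chord leaves a minimum in \<open>{e..h}\<close>. It is attained at an end point, since no inner
  point has a support line, and both end points give the same value.\<close>

lemma supports_chord:
  assumes cont: "continuous_on UNIV \<Phi>" and c1: "supports \<Phi> c1 e" and c2: "supports \<Phi> c2 h" and "e < h"
    and none: "\<And>y c. e < y \<Longrightarrow> y < h \<Longrightarrow> \<not> supports \<Phi> c y"
  defines "c \<equiv> (\<Phi> h - \<Phi> e) / (h - e)"
  shows "supports \<Phi> c e" "supports \<Phi> c h"
proof -
  have eq: "\<Phi> h - c * h = \<Phi> e - c * e" using \<open>e < h\<close> by (simp add: c_def field_simps)
  have c1c: "c1 \<le> c"
    using supportsD[OF c1, of h] \<open>e < h\<close> by (simp add: c_def pos_le_divide_eq algebra_simps)
  have cc2: "c \<le> c2"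
    using supportsD[OF c2, of e] \<open>e < h\<close> by (simp add: c_def pos_divide_le_eq algebra_simps)
  obtain z where z: "z \<in> {e..h}" "supports \<Phi> c z" "\<Phi> z - c * z \<le> \<Phi> e - c * e"
  proof (rule supports_attained[OF cont, of e e h c])
    show "e \<in> {e..h}" using \<open>e < h\<close> by simp
    fix y assume "y \<notin> {e..h}"
    then consider "y < e" | "y > h" by fastforce
    then show "\<Phi> e + c * (y - e) \<le> \<Phi> y"
    proof cases
      case 1
      then show ?thesis
        using supportsD[OF c1, of y] mult_right_mono[OF c1c, of "e - y"] by (simp add: algebra_simps)
    next
      case 2
      then show ?thesis
        using supportsD[OF c2, of y] mult_right_mono[OF cc2, of "y - h"] eq by (simp add: algebra_simps)
    qed
  qed
  have "z = e \<or> z = h" using none[of z c] z by fastforce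
  then have ze: "\<Phi> z - c * z = \<Phi> e - c * e" using eq by auto
  have "\<Phi> e + c * (y - e) \<le> \<Phi> y" "\<Phi> h + c * (y - h) \<le> \<Phi> y" for y
    using supportsD[OF z(2), of y] ze eq by (simp_all add: right_diff_distrib)
  then show "supports \<Phi> c e" "supports \<Phi> c h" by (simp_all add: supports_def)
qed

lemma supports_limit:
  assumes "continuous_on UNIV \<Phi>" "X \<longlonglongrightarrow> x" "S \<longlonglongrightarrow> c" "\<And>n. supports \<Phi> (S n) (X n)"
  shows "supports \<Phi> c x"
  unfolding supports_def
proof
  fix z
  have "isCont \<Phi> x" using assms(1) by (simp add: continuous_on_eq_continuous_at)
  then have "(\<lambda>n. \<Phi> (X n) + S n * (z - X n)) \<longlonglongrightarrow> \<Phi> x + c * (z - x)"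
    by (intro tendsto_intros isCont_tendsto_compose[of _ \<Phi>] assms)
  then show "\<Phi> x + c * (z - x) \<le> \<Phi> z"
    by (rule LIMSEQ_le_const2) (use assms(4) in \<open>auto simp: supports_def\<close>)
qed

text \<open>Slopes of support lines play the role of the derivative. The difference of the function
  and the integral of the slopes has increments of size at most \<open>(s y - s x) (y - x)\<close>, and
  halving the interval repeatedly makes this bound arbitrarily small.\<close>

locale supported =
  fixes h s :: "real \<Rightarrow> real" and C :: real
  assumes supp: "\<And>z. supports h (s z) z" and s_bounded: "\<And>z. \<bar>s z\<bar> \<le> C"
begin

section \<open>Convex functions as integrals of support slopes\<close>

lemma s_mono: "mono s"
proof (rule monoI)
  fix x y :: real assume "x \<le> y"
  then show "s x \<le> s y" using supports_mono[OF supp supp, of x y] by (cases "x = y") auto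
qed

lemma increment: "s x * (y - x) \<le> h y - h x" "h y - h x \<le> s y * (y - x)"
  using supportsD[OF supp, of x y] supportsD[OF supp, of y x] by (auto simp: algebra_simps)

lemma lipschitz: "\<bar>h x - h y\<bar> \<le> C * \<bar>x - y\<bar>"
proof -
  have "\<bar>s x * (x - y)\<bar> \<le> C * \<bar>x - y\<bar>" "\<bar>s y * (x - y)\<bar> \<le> C * \<bar>x - y\<bar>"
    using s_bounded by (auto simp: abs_mult intro!: mult_right_mono)
  then show ?thesis using increment[where x=y and y=x] by linarith
qed

lemma s_measurable: "s \<in> borel_measurable lebesgue"
  by (intro measurable_completion) (use borel_measurable_mono[OF s_mono] in simp)

lemma s_AE: "AE x in lebesgue. \<bar>s x\<bar> \<le> C"
  using s_bounded by simp

lemma s_loc: "locally_integrable s"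
  by (rule bounded_imp_locally_integrable[OF s_measurable s_AE])

lemma Phi_s_increment:
  assumes "x \<le> y" shows "s x * (y - x) \<le> Phi s y - Phi s x" "Phi s y - Phi s x \<le> s y * (y - x)"
proof -
  have int: "s integrable_on {x..y}"
    using s_loc by (auto simp: locally_integrable_def intro: set_lebesgue_integral_eq_integral(1))
  have "integral {x..y} (\<lambda>_. s x) \<le> integral {x..y} s"
    by (rule integral_le) (use int s_mono in \<open>auto simp: mono_def\<close>)
  moreover have "integral {x..y} s \<le> integral {x..y} (\<lambda>_. s y)"
    by (rule integral_le) (use int s_mono in \<open>auto simp: mono_def\<close>)
  ultimately show "s x * (y - x) \<le> Phi s y - Phi s x" "Phi s y - Phi s x \<le> s y * (y - x)"
    using assms by (auto simp: Phi_diff[OF s_loc assms] mult.commute)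
qed

lemma Phi_s_diff: "Phi s y - Phi s x = h y - h x"
proof -
  define D where "D = (\<lambda>x. h x - Phi s x)"
  have base: "\<bar>D y - D x\<bar> \<le> (s y - s x) * (y - x)" if "x \<le> y" for x y
    using increment[where x=x and y=y] Phi_s_increment[OF that] by (simp add: D_def abs_le_iff algebra_simps)
  have half: "x \<le> y \<Longrightarrow> \<bar>D y - D x\<bar> \<le> (s y - s x) * (y - x) / 2 ^ n" for x y n
  proof (induction n arbitrary: x y)
    case 0
    then show ?case using base by simp
  next
    case (Suc n)
    define m where "m = (x + y) / 2"
    have m: "x \<le> m" "m \<le> y" "m - x = (y - x) / 2" "y - m = (y - x) / 2" using Suc.prems by (auto simp: m_def field_simps)
    have "\<bar>D y - D x\<bar> \<le> \<bar>D y - D m\<bar> + \<bar>D m - D x\<bar>" by simp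
    also have "\<dots> \<le> (s y - s m) * ((y - x) / 2) / 2 ^ n + (s m - s x) * ((y - x) / 2) / 2 ^ n"
      using Suc.IH[OF m(1)] Suc.IH[OF m(2)] m(3,4) by simp
    also have "\<dots> = (s y - s x) * (y - x) / 2 ^ Suc n" by (simp add: field_simps)
    finally show ?case .
  qed
  have const: "D y = D x" if "x \<le> y" for x y
  proof -
    have "(\<lambda>n. ((s y - s x) * (y - x)) * (1 / 2) ^ n) \<longlonglongrightarrow> ((s y - s x) * (y - x)) * 0"
      by (intro tendsto_intros LIMSEQ_power_zero) simp
    then have "\<bar>D y - D x\<bar> \<le> ((s y - s x) * (y - x)) * 0"
      by (rule LIMSEQ_le_const) (use half[OF that] in \<open>auto simp: power_divide\<close>)
    then show ?thesis by simp
  qed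
  have "D y = D x" using const[of x y] const[of y x] by (cases "x \<le> y") auto
  then show ?thesis by (simp add: D_def)
qed

text \<open>The difference quotient of \<open>h\<close> between \<open>x\<close> and
  \<open>y\<close> lies between \<open>s x\<close> and \<open>s y\<close>.\<close>

lemma deriv_eq:
  assumes "isCont s x" shows "deriv h x = s x"
proof (rule DERIV_imp_deriv)
  have "\<bar>(h y - h x) / (y - x) - s x\<bar> \<le> \<bar>s y - s x\<bar>" if "y \<noteq> x" for y
  proof (cases "x < y")
    case True
    then have "s x \<le> (h y - h x) / (y - x)" "(h y - h x) / (y - x) \<le> s y"
      using increment[where x=x and y=y] by (simp_all add: pos_le_divide_eq pos_divide_le_eq)
    then show ?thesis by linarith
  next
    case False
    then have "s y \<le> (h y - h x) / (y - x)" "(h y - h x) / (y - x) \<le> s x"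
      using increment[where x=x and y=y] that by (simp_all add: neg_le_divide_eq neg_divide_le_eq)
    then show ?thesis by linarith
  qed
  then have "\<forall>\<^sub>F y in at x. norm ((h y - h x) / (y - x) - s x) \<le> \<bar>s y - s x\<bar>"
    by (simp add: eventually_at_filter)
  moreover have "((\<lambda>y. \<bar>s y - s x\<bar>) \<longlongrightarrow> 0) (at x)"
    using assms by (simp add: isCont_def tendsto_rabs_zero LIM_zero)
  ultimately have "((\<lambda>y. (h y - h x) / (y - x) - s x) \<longlongrightarrow> 0) (at x)"
    by (rule Lim_null_comparison)
  then show "(h has_real_derivative s x) (at x)"
    by (simp add: has_field_derivative_iff LIM_zero_iff)
qed

lemma negligible_discont: "negligible {x. \<not> isCont s x}"
  using countable_imp_null_set_lborel[OF mono_ctble_discont[OF s_mono]]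
  by (simp add: negligible_iff_null_sets null_sets_completionI)

lemma deriv_loc: "locally_integrable (deriv h)"
  unfolding locally_integrable_def
proof (intro allI)
  fix p q
  show "deriv h absolutely_integrable_on {p..q}"
    by (rule absolutely_integrable_spike[OF _ negligible_discont, where f=s])
      (use s_loc deriv_eq in \<open>auto simp: locally_integrable_def\<close>)
qed

text \<open>The values of \<open>deriv h\<close> are unspecified at most where the monotone function
  \<open>s\<close> jumps, a countable set that integrals ignore.\<close>

lemma Phi_deriv: "Phi (deriv h) z = h z - h 0"
proof -
  have eq: "Phi (deriv h) y - Phi (deriv h) x = Phi s y - Phi s x" if "x \<le> y" for x y
    unfolding Phi_diff[OF deriv_loc that] Phi_diff[OF s_loc that]
    by (rule integral_spike[OF negligible_discont]) (use deriv_eq in auto)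
  have "Phi (deriv h) z - Phi (deriv h) 0 = Phi s z - Phi s 0"
    using eq[of 0 z] eq[of z 0] by (cases "0 \<le> z") auto
  then show ?thesis using Phi_s_diff[of z 0] by (simp add: Phi_0)
qed

end

section \<open>The convex hull and its contact set\<close>

locale bounded_data =
  fixes \<phi> :: "real \<Rightarrow> real" and C :: real
  assumes meas: "\<phi> \<in> borel_measurable lebesgue" and bound: "AE x in lebesgue. \<bar>\<phi> x\<bar> \<le> C"
begin

lemma phi_loc: "locally_integrable \<phi>"
  by (rule bounded_imp_locally_integrable[OF meas bound])

lemma Phi_lipschitz: "\<bar>Phi \<phi> x - Phi \<phi> y\<bar> \<le> C * \<bar>x - y\<bar>"
  using bounded_imp_Phi_lipschitz[OF meas bound, of x y] by (simp add: abs_minus_commute)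

lemma C_nonneg: "0 \<le> C"
  using Phi_lipschitz[of 1 0] by simp

lemma cont_Phi: "continuous_on UNIV (Phi \<phi>)"
proof -
  have "C-lipschitz_on UNIV (Phi \<phi>)"
    by (rule lipschitz_onI) (use Phi_lipschitz C_nonneg in \<open>auto simp: dist_real_def\<close>)
  then show ?thesis by (rule lipschitz_on_continuous_on)
qed

lemma slope_bounded:
  assumes "supports (Phi \<phi>) c y" shows "\<bar>c\<bar> \<le> C"
  using supportsD[OF assms, of "y + 1"] supportsD[OF assms, of "y - 1"]
    Phi_lipschitz[of "y + 1" y] Phi_lipschitz[of "y - 1" y] by (simp add: abs_le_iff)

lemma supports_subseq:
  assumes "\<And>n. supports (Phi \<phi>) (S n) (X n)" "X \<longlonglongrightarrow> x"
  obtains c r where "strict_mono (r :: nat \<Rightarrow> nat)" "(S \<circ> r) \<longlonglongrightarrow> c" "supports (Phi \<phi>) c x"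
proof -
  have "seq_compact {-C..C}" by (simp add: compact_imp_seq_compact)
  moreover have "\<forall>n. S n \<in> {-C..C}" using slope_bounded[OF assms(1)] by (simp add: abs_le_iff minus_le_iff)
  ultimately obtain c r where cr: "strict_mono (r :: nat \<Rightarrow> nat)" "(S \<circ> r) \<longlonglongrightarrow> c"
    unfolding seq_compact_def by blast
  have "(X \<circ> r) \<longlonglongrightarrow> x" using LIMSEQ_subseq_LIMSEQ assms(2) cr(1) by blast
  from supports_limit[OF cont_Phi this cr(2)] have "supports (Phi \<phi>) c x" using assms(1) by simp
  then show thesis using that cr by blast
qed

definition minorants :: "real \<Rightarrow> (real \<Rightarrow> real) set" where
  "minorants N = {g. convex_on {-N..N} g \<and> (\<forall>y\<in>{-N..N}. g y \<le> Phi \<phi> y)}"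

lemma hull_N_eq: "\<bar>z\<bar> < N \<Longrightarrow> Phi_hull_N \<phi> N z = Sup ((\<lambda>g. g z) ` minorants N)"
  by (auto simp: Phi_hull_N_def minorants_def image_def intro!: arg_cong[where f=Sup])

lemma affine_minorant:
  assumes "\<And>y. y \<in> {-N..N} \<Longrightarrow> k + c * y \<le> Phi \<phi> y"
  shows "(\<lambda>y. k + c * y) \<in> minorants N"
proof -
  have "convex_on {-N..N} (\<lambda>y. k + c * y)"
    by (rule convex_onI) (auto simp: algebra_simps)
  then show ?thesis using assms by (simp add: minorants_def)
qed

lemma minorants_nonempty: "minorants N \<noteq> {}"
proof -
  have "Phi \<phi> 0 - C * N + 0 * y \<le> Phi \<phi> y" if "y \<in> {-N..N}" for y
    using Phi_lipschitz[of y 0] mult_left_mono[of "\<bar>y\<bar>" N C] C_nonneg that by (simp add: abs_le_iff)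
  then show ?thesis using affine_minorant by blast
qed

lemma minorantsD: "g \<in> minorants N \<Longrightarrow> \<bar>z\<bar> < N \<Longrightarrow> g z \<le> Phi \<phi> z"
  by (auto simp: minorants_def abs_less_iff)

lemma minorants_bdd: "\<bar>z\<bar> < N \<Longrightarrow> bdd_above ((\<lambda>g. g z) ` minorants N)"
  by (intro bdd_aboveI[of _ "Phi \<phi> z"]) (auto simp: minorantsD)

lemma hull_N_ge:
  assumes "\<And>y. k + c * y \<le> Phi \<phi> y"
  shows "k + c * z \<le> Phi_hull_N \<phi> N z"
proof (cases "\<bar>z\<bar> < N")
  case True
  then show ?thesis
    unfolding hull_N_eq[OF True]
    by (intro cSup_upper minorants_bdd image_eqI[OF _ affine_minorant]) (use assms in auto)
next
  case False
  then show ?thesis using assms by (simp add: Phi_hull_N_def)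
qed

lemma hull_N_le: "Phi_hull_N \<phi> N z \<le> Phi \<phi> z"
proof (cases "\<bar>z\<bar> < N")
  case True
  then show ?thesis
    unfolding hull_N_eq[OF True] by (intro cSup_least) (use minorants_nonempty minorantsD True in auto)
qed (simp add: Phi_hull_N_def)

lemma hull_N_chord:
  assumes "p < z" "z < q" "-N \<le> p" "q \<le> N"
  shows "Phi_hull_N \<phi> N z \<le> Phi \<phi> p + (z - p) * ((Phi \<phi> q - Phi \<phi> p) / (q - p))"
proof -
  have z: "\<bar>z\<bar> < N" using assms by linarith
  have "g z \<le> Phi \<phi> p + (z - p) * ((Phi \<phi> q - Phi \<phi> p) / (q - p))" if g: "g \<in> minorants N" for g
  proof -
    define k where "k = (z - p) / (q - p)"
    have k: "0 \<le> k" "k \<le> 1" using assms by (auto simp: k_def)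
    have "k * (q - p) = z - p" using assms by (simp add: k_def)
    then have zk: "z = (1 - k) * p + k * q" by (simp add: algebra_simps)
    have "g z \<le> (1 - k) * g p + k * g q"
      using convex_onD[of "{-N..N}" g k p q] g k assms unfolding zk minorants_def by simp
    also have "\<dots> \<le> (1 - k) * Phi \<phi> p + k * Phi \<phi> q"
      using g k assms by (intro add_mono mult_left_mono) (auto simp: minorants_def)
    also have "\<dots> = Phi \<phi> p + k * (Phi \<phi> q - Phi \<phi> p)" by (simp add: algebra_simps)
    finally show ?thesis by (simp add: k_def)
  qed
  then show ?thesis unfolding hull_N_eq[OF z] by (intro cSup_least) (use minorants_nonempty in auto)
qed

lemma hull_N_antimono:
  assumes "\<bar>z\<bar> < N" "N \<le> N'" shows "Phi_hull_N \<phi> N' z \<le> Phi_hull_N \<phi> N z"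
proof -
  have "minorants N' \<subseteq> minorants N"
    unfolding minorants_def using assms by (auto intro: convex_on_subset)
  moreover have "\<bar>z\<bar> < N'" using assms by simp
  ultimately show ?thesis
    using assms minorants_nonempty by (auto simp: hull_N_eq intro!: cSup_subset_mono minorants_bdd)
qed

text \<open>\<open>Phi_hull\<close> is a \<open>Lim\<close>, so the limit has to be shown to exist
  before anything is known about it. The hulls decrease once \<open>N\<close> exceeds the modulus of
  \<open>z\<close>, and the limit is their infimum in the extended reals.\<close>

lemma hull_tendsto: "((\<lambda>N. ereal (Phi_hull_N \<phi> N z)) \<longlongrightarrow> Phi_hull \<phi> z) at_top"
proof -
  define l where "l = (INF N\<in>{\<bar>z\<bar><..}. ereal (Phi_hull_N \<phi> N z))"
  have "((\<lambda>N. ereal (Phi_hull_N \<phi> N z)) \<longlongrightarrow> l) at_top"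
  proof (rule order_tendstoI)
    fix b assume b: "b < l"
    have "b < ereal (Phi_hull_N \<phi> N z)" if "\<bar>z\<bar> < N" for N
      using INF_lower[of N "{\<bar>z\<bar><..}" "\<lambda>N. ereal (Phi_hull_N \<phi> N z)"] that b unfolding l_def
      by (metis greaterThan_iff less_le_trans)
    then show "\<forall>\<^sub>F N in at_top. b < ereal (Phi_hull_N \<phi> N z)"
      using eventually_gt_at_top[of "\<bar>z\<bar>"] by (rule eventually_mono[rotated])
  next
    fix b assume "l < b"
    then obtain N where N: "\<bar>z\<bar> < N" "ereal (Phi_hull_N \<phi> N z) < b"
      unfolding l_def by (auto simp: INF_less_iff)
    have "ereal (Phi_hull_N \<phi> N' z) < b" if "N \<le> N'" for N'
      using hull_N_antimono[OF N(1) that] N(2) by (meson ereal_less_eq(3) le_less_trans)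
    then show "\<forall>\<^sub>F N in at_top. ereal (Phi_hull_N \<phi> N z) < b"
      using eventually_ge_at_top[of N] by (rule eventually_mono[rotated])
  qed
  then show ?thesis
    unfolding Phi_hull_def by (metis tendsto_Lim trivial_limit_at_top_linorder)
qed

lemma hull_ge:
  assumes "supports (Phi \<phi>) c y"
  shows "ereal (Phi \<phi> y + c * (z - y)) \<le> Phi_hull \<phi> z"
proof (rule tendsto_lowerbound[OF hull_tendsto])
  have "Phi \<phi> y + c * (z - y) \<le> Phi_hull_N \<phi> N z" for N
    using hull_N_ge[of "Phi \<phi> y - c * y" c z N] supportsD[OF assms] by (simp add: algebra_simps)
  then show "\<forall>\<^sub>F N in at_top. ereal (Phi \<phi> y + c * (z - y)) \<le> ereal (Phi_hull_N \<phi> N z)" by simp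
qed simp

lemma hull_le: "Phi_hull \<phi> z \<le> ereal (Phi \<phi> z)"
  by (rule tendsto_upperbound[OF hull_tendsto]) (use hull_N_le in auto)

lemma hull_chord:
  assumes "p < z" "z < q"
  shows "Phi_hull \<phi> z \<le> ereal (Phi \<phi> p + (z - p) * ((Phi \<phi> q - Phi \<phi> p) / (q - p)))"
proof (rule tendsto_upperbound[OF hull_tendsto])
  show "\<forall>\<^sub>F N in at_top. ereal (Phi_hull_N \<phi> N z)
      \<le> ereal (Phi \<phi> p + (z - p) * ((Phi \<phi> q - Phi \<phi> p) / (q - p)))"
    using eventually_ge_at_top[of "max (- p) q"]
    by eventually_elim (use hull_N_chord assms in auto)
qed simp

text \<open>By \<open>hull_chord\<close>, contact at \<open>y\<close> puts every chord slope on the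
  left of \<open>y\<close> below every chord slope on the right. The supremum of the left ones is
  then a support slope.\<close>

lemma K0_iff: "y \<in> K0 \<phi> \<longleftrightarrow> (\<exists>c. supports (Phi \<phi>) c y)"
proof
  assume "\<exists>c. supports (Phi \<phi>) c y"
  then obtain c where "supports (Phi \<phi>) c y" by blast
  from hull_ge[OF this, of y] show "y \<in> K0 \<phi>" using hull_le[of y] by (simp add: K0_def antisym)
next
  assume "y \<in> K0 \<phi>"
  then have y: "Phi_hull \<phi> y = ereal (Phi \<phi> y)" by (simp add: K0_def)
  let ?s = "\<lambda>p. (Phi \<phi> y - Phi \<phi> p) / (y - p)"
  have le: "?s p \<le> ?s q" if "p < y" "y < q" for p q
  proof -
    have "Phi \<phi> y \<le> Phi \<phi> p + (y - p) * ((Phi \<phi> q - Phi \<phi> p) / (q - p))"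
      using hull_chord[OF that] unfolding y by simp
    then have "(q - p) * (Phi \<phi> y - Phi \<phi> p) \<le> (y - p) * (Phi \<phi> q - Phi \<phi> p)"
      using that by (simp add: field_simps)
    then have "(Phi \<phi> y - Phi \<phi> p) * (q - y) \<le> (Phi \<phi> q - Phi \<phi> y) * (y - p)"
      by (simp add: algebra_simps)
    then have "(Phi \<phi> y - Phi \<phi> p) / (y - p) \<le> (Phi \<phi> q - Phi \<phi> y) / (q - y)"
      using that by (simp add: divide_simps)
    also have "\<dots> = ?s q" using that by (metis minus_diff_eq minus_divide_divide)
    finally show ?thesis .
  qed
  define c where "c = Sup (?s ` {..<y})"
  have bdd: "bdd_above (?s ` {..<y})"
  proof (rule bdd_aboveI2)
    fix p assume "p \<in> {..<y}"
    then show "?s p \<le> ?s (y + 1)" by (intro le) auto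
  qed
  have "Phi \<phi> y + c * (z - y) \<le> Phi \<phi> z" for z
  proof (cases z y rule: linorder_cases)
    case less
    have "?s z \<le> c" unfolding c_def by (rule cSup_upper[OF _ bdd]) (use less in auto)
    then show ?thesis using less by (simp add: pos_divide_le_eq algebra_simps)
  next
    case greater
    have "c \<le> ?s z" unfolding c_def by (rule cSup_least) (use le greater in auto)
    then show ?thesis using greater by (simp add: neg_le_divide_eq algebra_simps)
  qed simp
  then show "\<exists>c. supports (Phi \<phi>) c y" by (auto simp: supports_def)
qed

lemma K0_supports: "supports (Phi \<phi>) c y \<Longrightarrow> y \<in> K0 \<phi>"
  using K0_iff by blast

text \<open>Support slopes are bounded, so they converge along a subsequence. With
  \<open>b = (\<lambda>_. 0)\<close> this gives closedness of \<open>K0\<close>; with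
  \<open>b c = t * a c\<close> it handles the points whose divide is at or on one side of a given
  \<open>x\<close> at time \<open>t\<close>.\<close>

lemma closed_slopes:
  assumes "continuous_on UNIV b" "closed T"
  shows "closed {y. \<exists>c. supports (Phi \<phi>) c y \<and> y + b c \<in> T}"
  unfolding closed_sequential_limits
proof (intro allI impI, elim conjE)
  fix X x assume X: "\<forall>n. X n \<in> {y. \<exists>c. supports (Phi \<phi>) c y \<and> y + b c \<in> T}" "X \<longlonglongrightarrow> x"
  then obtain S where S: "\<And>n. supports (Phi \<phi>) (S n) (X n)" "\<And>n. X n + b (S n) \<in> T"
    by simp metis
  obtain c r where cr: "strict_mono (r :: nat \<Rightarrow> nat)" "(S \<circ> r) \<longlonglongrightarrow> c" "supports (Phi \<phi>) c x"
    using supports_subseq[OF S(1) X(2)] by blast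
  have "isCont b c" using assms(1) by (simp add: continuous_on_eq_continuous_at)
  then have "(\<lambda>n. (X \<circ> r) n + b ((S \<circ> r) n)) \<longlonglongrightarrow> x + b c"
    by (intro tendsto_intros LIMSEQ_subseq_LIMSEQ[OF X(2) cr(1)] isCont_tendsto_compose[OF _ cr(2)])
  then have "x + b c \<in> T" by (rule closed_sequentially[OF assms(2), rotated]) (use S(2) in auto)
  then show "x \<in> {y. \<exists>c. supports (Phi \<phi>) c y \<and> y + b c \<in> T}" using cr(3) by blast
qed

lemma closed_K0: "closed (K0 \<phi>)"
proof -
  have "K0 \<phi> = {y. \<exists>c. supports (Phi \<phi>) c y \<and> y + 0 \<in> UNIV}" using K0_iff by auto
  then show ?thesis using closed_slopes[of "\<lambda>_. 0" UNIV] by simp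
qed

section \<open>The gaps of the contact set\<close>

lemma connected_einterval: "connected (einterval e h)"
  unfolding is_interval_connected_1[symmetric] is_interval_1
proof (intro ballI allI impI)
  fix a b x assume ab: "a \<in> einterval e h" "b \<in> einterval e h" "a \<le> x \<and> x \<le> b"
  then have "ereal a \<le> ereal x" "ereal x \<le> ereal b" by auto
  then show "x \<in> einterval e h"
    using ab by (auto simp: einterval_iff simp del: ereal_less_eq intro: less_le_trans le_less_trans)
qed

text \<open>A finite end point outside the closed set \<open>K0\<close> would have a neighbourhood
  outside \<open>K0\<close>, and the component could be enlarged.\<close>

lemma gapD:
  assumes "(e, h) \<in> gaps \<phi>"
  shows "e < h" "einterval e h \<inter> K0 \<phi> = {}" "\<And>r. e = ereal r \<Longrightarrow> r \<in> K0 \<phi>" "\<And>r. h = ereal r \<Longrightarrow> r \<in> K0 \<phi>"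
proof -
  have comp: "einterval e h \<in> components (- K0 \<phi>)" using assms by (simp add: gaps_def)
  then have ne: "einterval e h \<noteq> {}" by (rule in_components_nonempty)
  then obtain x where x: "e < ereal x" "ereal x < h" by (auto simp: einterval_iff)
  show "e < h" using x by (rule less_trans)
  have sub: "einterval e h \<subseteq> - K0 \<phi>" using comp by (rule in_components_subset)
  then show "einterval e h \<inter> K0 \<phi> = {}" by blast
  have max: "D \<subseteq> einterval e h" if "connected D" "einterval e h \<subseteq> D" "D \<subseteq> - K0 \<phi>" for D
    using components_maximal[OF comp that(1,3)] ne that(2) by blast
  have op: "open (- K0 \<phi>)" using closed_K0 by (simp add: open_Compl)
  show "r \<in> K0 \<phi>" if e: "e = ereal r" for r
  proof (rule ccontr)
    assume "r \<notin> K0 \<phi>"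
    then obtain d where d: "d > 0" "ball r d \<subseteq> - K0 \<phi>" using op by (auto simp: open_contains_ball)
    have "einterval (ereal (r - d)) h \<subseteq> - K0 \<phi>"
    proof
      fix y assume y: "y \<in> einterval (ereal (r - d)) h"
      show "y \<in> - K0 \<phi>"
        using y d sub e by (cases "y \<le> r") (auto simp: einterval_iff dist_real_def subset_iff)
    qed
    moreover have "einterval e h \<subseteq> einterval (ereal (r - d)) h"
    proof
      fix y assume "y \<in> einterval e h"
      then show "y \<in> einterval (ereal (r - d)) h" using d e by (auto simp: einterval_iff)
    qed
    ultimately have "einterval (ereal (r - d)) h \<subseteq> einterval e h" using max connected_einterval by blast
    moreover have "r < x" "r - d < r" using x e d by auto
    then have "r \<in> einterval (ereal (r - d)) h"
      using x by (auto simp: einterval_iff) (metis ereal_less_eq(3) less_imp_le le_less_trans)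
    ultimately have "r \<in> einterval e h" by blast
    then show False using e by (simp add: einterval_iff)
  qed
  show "r \<in> K0 \<phi>" if h: "h = ereal r" for r
  proof (rule ccontr)
    assume "r \<notin> K0 \<phi>"
    then obtain d where d: "d > 0" "ball r d \<subseteq> - K0 \<phi>" using op by (auto simp: open_contains_ball)
    have "einterval e (ereal (r + d)) \<subseteq> - K0 \<phi>"
    proof
      fix y assume y: "y \<in> einterval e (ereal (r + d))"
      show "y \<in> - K0 \<phi>"
        using y d sub h by (cases "r \<le> y") (auto simp: einterval_iff dist_real_def subset_iff)
    qed
    moreover have "einterval e h \<subseteq> einterval e (ereal (r + d))"
    proof
      fix y assume "y \<in> einterval e h"
      then show "y \<in> einterval e (ereal (r + d))" using d h by (auto simp: einterval_iff)
    qed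
    ultimately have "einterval e (ereal (r + d)) \<subseteq> einterval e h" using max connected_einterval by blast
    moreover have "x < r" "r < r + d" using x h d by auto
    then have "r \<in> einterval e (ereal (r + d))"
      using x by (auto simp: einterval_iff) (metis ereal_less_eq(3) less_imp_le less_le_trans)
    ultimately have "r \<in> einterval e h" by blast
    then show False using h by (simp add: einterval_iff)
  qed
qed

lemma gapI:
  assumes "e < h" "einterval e h \<inter> K0 \<phi> = {}" "e = -\<infinity> \<or> (\<exists>r\<in>K0 \<phi>. e = ereal r)" "h = \<infinity> \<or> (\<exists>r\<in>K0 \<phi>. h = ereal r)"
  shows "(e, h) \<in> gaps \<phi>"
  unfolding gaps_def in_components_maximal
proof (intro CollectI case_prodI conjI allI impI, goal_cases)
  case 1
  then show ?case using einterval_nonempty[OF assms(1)] by blast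
next
  case 2
  then show ?case using assms(2) by blast
next
  case 3
  then show ?case by (rule connected_einterval)
next
  case (4 D)
  obtain y where y: "y \<in> einterval e h" using einterval_nonempty[OF assms(1)] by blast
  have "is_interval D" using 4 by (simp add: is_interval_connected_1)
  then have int: "r \<in> D" if "u \<in> D" "v \<in> D" "u \<le> r" "r \<le> v" for u v r
    using that unfolding is_interval_1 by blast
  have yD: "y \<in> D" using y 4 by blast
  have "x \<in> einterval e h" if x: "x \<in> D" for x
  proof (rule ccontr)
    assume "x \<notin> einterval e h"
    then consider "ereal x \<le> e" | "h \<le> ereal x" by (auto simp: einterval_iff not_less)
    then show False
    proof cases
      case 1
      then obtain r where "r \<in> K0 \<phi>" "e = ereal r" using assms(3) by auto
      moreover from this have "r \<in> D" using 1 int[OF x yD, of r] y by (auto simp: einterval_iff)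
      ultimately show False using 4 by blast
    next
      case 2
      then obtain r where "r \<in> K0 \<phi>" "h = ereal r" using assms(4) by auto
      moreover from this have "r \<in> D" using 2 int[OF yD x, of r] y by (auto simp: einterval_iff)
      ultimately show False using 4 by blast
    qed
  qed
  then show ?case using 4 by blast
qed

text \<open>Used twice, with \<open>K0\<close> split at a point of the axis and with
  \<open>K0\<close> split by the position of the divides at a fixed time. Boundedness is assumed
  separately because it does not follow from \<open>less\<close> if one of the parts is
  empty.\<close>

lemma split_gap:
  assumes K: "K0 \<phi> = A \<union> B" "K0 \<phi> \<noteq> {}" and cl: "closed A" "closed B"
    and less: "\<And>x y. x \<in> A \<Longrightarrow> y \<in> B \<Longrightarrow> x < y" and bdd: "bdd_above A" "bdd_below B"
  obtains e h where "(e, h) \<in> gaps \<phi>" "e = -\<infinity> \<or> (\<exists>r\<in>A. e = ereal r)" "h = \<infinity> \<or> (\<exists>r\<in>B. h = ereal r)"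
    "e = -\<infinity> \<Longrightarrow> h \<noteq> \<infinity>"
proof -
  define e where "e = (if A = {} then -\<infinity> else ereal (Sup A))"
  define h where "h = (if B = {} then \<infinity> else ereal (Inf B))"
  have A: "Sup A \<in> A" "\<And>x. x \<in> A \<Longrightarrow> x \<le> Sup A" if "A \<noteq> {}"
    using closed_contains_Sup[OF that bdd(1) cl(1)] cSup_upper[OF _ bdd(1)] by auto
  have B: "Inf B \<in> B" "\<And>x. x \<in> B \<Longrightarrow> Inf B \<le> x" if "B \<noteq> {}"
    using closed_contains_Inf[OF that bdd(2) cl(2)] cInf_lower[OF _ bdd(2)] by auto
  have "e < h" using A B less by (auto simp: e_def h_def)
  moreover have "einterval e h \<inter> K0 \<phi> = {}"
    using A(2) B(2) K(1) by (fastforce simp: e_def h_def einterval_iff split: if_splits)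
  moreover have e: "e = -\<infinity> \<or> (\<exists>r\<in>A. e = ereal r)" using A by (auto simp: e_def)
  moreover have h: "h = \<infinity> \<or> (\<exists>r\<in>B. h = ereal r)" using B by (auto simp: h_def)
  ultimately have "(e, h) \<in> gaps \<phi>" using K(1) by (intro gapI) auto
  moreover have "e = -\<infinity> \<Longrightarrow> h \<noteq> \<infinity>" using K by (auto simp: e_def h_def split: if_splits)
  ultimately show thesis using that e h by blast
qed

end

section \<open>The hull on the gaps\<close>

locale asymptotic_data = bounded_data +
  fixes l r :: real
  assumes slope_r: "((\<lambda>x. Phi \<phi> x / x) \<longlongrightarrow> r) at_top"
    and slope_l: "((\<lambda>x. Phi \<phi> x / x) \<longlongrightarrow> l) at_bot"
begin

lemma gap_bounded:
  assumes "(ereal e, ereal h) \<in> gaps \<phi>"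
  shows "e < h" "supports (Phi \<phi>) (gap_slope \<phi> e h) e" "supports (Phi \<phi>) (gap_slope \<phi> e h) h"
proof -
  note g = gapD[OF assms]
  show "e < h" using g(1) by simp
  obtain c1 c2 where c: "supports (Phi \<phi>) c1 e" "supports (Phi \<phi>) c2 h" using g(3,4) K0_iff by blast
  have none: "\<not> supports (Phi \<phi>) c y" if "e < y" "y < h" for y c
    using g(2) that K0_supports by (auto simp: einterval_iff)
  show "supports (Phi \<phi>) (gap_slope \<phi> e h) e" "supports (Phi \<phi>) (gap_slope \<phi> e h) h"
    using supports_chord[OF cont_Phi c \<open>e < h\<close> none] by (auto simp: gap_slope_def)
qed

lemma gap_right:
  assumes "(ereal e, \<infinity>) \<in> gaps \<phi>" shows "supports (Phi \<phi>) r e"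
proof -
  note g = gapD[OF assms]
  obtain c where c: "supports (Phi \<phi>) c e" using g(3) K0_iff by blast
  have "\<not> supports (Phi \<phi>) c y" if "e < y" for y c
    using g(2) that K0_supports by (auto simp: einterval_iff)
  then show ?thesis by (rule supports_right_end[OF cont_Phi slope_r c])
qed

lemma gap_left:
  assumes "(-\<infinity>, ereal h) \<in> gaps \<phi>" shows "supports (Phi \<phi>) l h"
proof -
  note g = gapD[OF assms]
  obtain c where c: "supports (Phi \<phi>) c h" using g(4) K0_iff by blast
  have "\<not> supports (Phi \<phi>) c y" if "y < h" for y c
    using g(2) that K0_supports by (auto simp: einterval_iff)
  then show ?thesis by (rule supports_left_end[OF cont_Phi slope_l c])
qed

lemma hull_bounded_gap:
  assumes "(ereal e, ereal h) \<in> gaps \<phi>" "e < z" "z < h"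
  shows "Phi_hull \<phi> z = ereal (Phi \<phi> e + gap_slope \<phi> e h * (z - e))"
  using hull_chord[OF assms(2,3)] hull_ge[OF gap_bounded(2)[OF assms(1)], of z]
  by (simp add: gap_slope_def mult.commute antisym)

lemma chord_slope_tendsto:
  fixes \<Phi> :: "real \<Rightarrow> real"
  assumes "((\<lambda>x. \<Phi> x / x) \<longlongrightarrow> k) F" "filterlim (\<lambda>x. x) at_infinity F"
  shows "((\<lambda>x. (\<Phi> x - d) / (x - e)) \<longlongrightarrow> k) F"
proof -
  have inv: "((\<lambda>x. b / x) \<longlongrightarrow> 0) F" for b :: real
    by (rule tendsto_divide_0[OF tendsto_const assms(2)])
  have "((\<lambda>x. (\<Phi> x / x - d / x) / (1 - e / x)) \<longlongrightarrow> (k - 0) / (1 - 0)) F"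
    by (intro tendsto_intros assms inv) simp
  moreover have "\<forall>\<^sub>F x in F. (\<Phi> x / x - d / x) / (1 - e / x) = (\<Phi> x - d) / (x - e)"
  proof -
    have "\<forall>\<^sub>F x in F. x \<noteq> 0" using filterlim_at_infinity_imp_eventually_ne[OF assms(2)] .
    then show ?thesis
    proof eventually_elim
      case (elim x)
      then have "(\<Phi> x / x - d / x) / (1 - e / x) = ((\<Phi> x - d) / x) / ((x - e) / x)"
        by (simp add: diff_divide_distrib)
      then show ?case using elim by simp
    qed
  qed
  ultimately show ?thesis using tendsto_cong by force
qed

text \<open>The upper bound comes from the chords between \<open>e\<close> and \<open>q\<close>,
  whose slopes tend to \<open>r\<close> as \<open>q\<close> tends to infinity; the lower bound is
  the support line at \<open>e\<close>.\<close>

lemma hull_right_gap: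
  assumes "(ereal e, \<infinity>) \<in> gaps \<phi>" "e < z"
  shows "Phi_hull \<phi> z = ereal (Phi \<phi> e + r * (z - e))"
proof (rule antisym)
  show "ereal (Phi \<phi> e + r * (z - e)) \<le> Phi_hull \<phi> z" by (rule hull_ge[OF gap_right[OF assms(1)]])
  have "filterlim (\<lambda>x::real. x) at_infinity at_top"
    by (simp add: filterlim_at_top_imp_at_infinity filterlim_ident)
  then have "((\<lambda>q. (Phi \<phi> q - Phi \<phi> e) / (q - e)) \<longlongrightarrow> r) at_top" by (rule chord_slope_tendsto[OF slope_r])
  then have "((\<lambda>q. ereal (Phi \<phi> e + (z - e) * ((Phi \<phi> q - Phi \<phi> e) / (q - e)))) \<longlongrightarrow>
      ereal (Phi \<phi> e + (z - e) * r)) at_top" by (intro tendsto_intros)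
  then have "Phi_hull \<phi> z \<le> ereal (Phi \<phi> e + (z - e) * r)"
  proof (rule tendsto_lowerbound)
    show "\<forall>\<^sub>F q in at_top. Phi_hull \<phi> z \<le> ereal (Phi \<phi> e + (z - e) * ((Phi \<phi> q - Phi \<phi> e) / (q - e)))"
      using eventually_gt_at_top[of z] by eventually_elim (rule hull_chord[OF assms(2)])
  qed simp
  then show "Phi_hull \<phi> z \<le> ereal (Phi \<phi> e + r * (z - e))" by (simp add: mult.commute)
qed

lemma hull_left_gap:
  assumes "(-\<infinity>, ereal h) \<in> gaps \<phi>" "z < h"
  shows "Phi_hull \<phi> z = ereal (Phi \<phi> h + l * (z - h))"
proof (rule antisym)
  show "ereal (Phi \<phi> h + l * (z - h)) \<le> Phi_hull \<phi> z" by (rule hull_ge[OF gap_left[OF assms(1)]])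
  have "filterlim (\<lambda>x::real. x) at_infinity at_bot"
    by (simp add: filterlim_at_bot_imp_at_infinity filterlim_ident)
  then have "((\<lambda>q. (Phi \<phi> q - Phi \<phi> h) / (q - h)) \<longlongrightarrow> l) at_bot" by (rule chord_slope_tendsto[OF slope_l])
  then have "((\<lambda>q. ereal (Phi \<phi> h + (z - h) * ((Phi \<phi> q - Phi \<phi> h) / (q - h)))) \<longlongrightarrow>
      ereal (Phi \<phi> h + (z - h) * l)) at_bot" by (intro tendsto_intros)
  then have "Phi_hull \<phi> z \<le> ereal (Phi \<phi> h + (z - h) * l)"
  proof (rule tendsto_lowerbound)
    show "\<forall>\<^sub>F q in at_bot. Phi_hull \<phi> z \<le> ereal (Phi \<phi> h + (z - h) * ((Phi \<phi> q - Phi \<phi> h) / (q - h)))"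
      using eventually_gt_at_bot[of z]
    proof eventually_elim
      case (elim q)
      have "Phi \<phi> q + (z - q) * ((Phi \<phi> h - Phi \<phi> q) / (h - q)) = Phi \<phi> h + (z - h) * ((Phi \<phi> q - Phi \<phi> h) / (q - h))"
        using elim assms(2) by (simp add: divide_simps) (simp add: algebra_simps)
      then show ?case using hull_chord[OF elim assms(2)] by simp
    qed
  qed simp
  then show "Phi_hull \<phi> z \<le> ereal (Phi \<phi> h + l * (z - h))" by (simp add: mult.commute)
qed

text \<open>Every point of the graph of the hull is on a support line of \<open>Phi\<close>. So the
  hull is finite and inherits a support line of bounded slope at each of its points.\<close>

lemma hull_supported:
  assumes "K0 \<phi> \<noteq> {}"
  shows "\<exists>c y. supports (Phi \<phi>) c y \<and> Phi_hull \<phi> z = ereal (Phi \<phi> y + c * (z - y))"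
proof (cases "z \<in> K0 \<phi>")
  case True
  then obtain c where "supports (Phi \<phi>) c z" using K0_iff by blast
  moreover have "Phi_hull \<phi> z = ereal (Phi \<phi> z + c * (z - z))" using True by (simp add: K0_def)
  ultimately show ?thesis by blast
next
  case False
  obtain e h where eh: "(e, h) \<in> gaps \<phi>" "e = -\<infinity> \<or> (\<exists>r\<in>K0 \<phi> \<inter> {..z}. e = ereal r)"
    "h = \<infinity> \<or> (\<exists>r\<in>K0 \<phi> \<inter> {z..}. h = ereal r)" "e = -\<infinity> \<Longrightarrow> h \<noteq> \<infinity>"
  proof (rule split_gap[of "K0 \<phi> \<inter> {..z}" "K0 \<phi> \<inter> {z..}"])
    fix x y assume "x \<in> K0 \<phi> \<inter> {..z}" "y \<in> K0 \<phi> \<inter> {z..}"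
    then show "x < y" using False by (cases "x = y") auto
  qed (use closed_K0 assms False in auto)
  consider (b) u v where "e = ereal u" "h = ereal v" "u < z" "z < v"
    | (r) u where "e = ereal u" "h = \<infinity>" "u < z" | (l) v where "e = -\<infinity>" "h = ereal v" "z < v"
    using eh(2-4) False by (fastforce simp: less_le)
  then show ?thesis
  proof cases
    case b
    then show ?thesis using hull_bounded_gap gap_bounded eh(1) by metis
  next
    case r
    then show ?thesis using hull_right_gap gap_right eh(1) by metis
  next
    case l
    then show ?thesis using hull_left_gap gap_left eh(1) by metis
  qed
qed

abbreviation Psi :: "real \<Rightarrow> real" where "Psi x \<equiv> real_of_ereal (Phi_hull \<phi> x)"

lemma hull_real: "K0 \<phi> \<noteq> {} \<Longrightarrow> Phi_hull \<phi> z = ereal (Psi z)"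
  using hull_supported[of z] by auto

lemma hull_supports:
  assumes "K0 \<phi> \<noteq> {}" "supports (Phi \<phi>) c y" "Phi_hull \<phi> z = ereal (Phi \<phi> y + c * (z - y))"
  shows "supports Psi c z"
  unfolding supports_def
proof
  fix w
  have "Phi \<phi> y + c * (w - y) \<le> Psi w" using hull_ge[OF assms(2), of w] hull_real[OF assms(1), of w]
    by (metis ereal_less_eq(3))
  then show "Psi z + c * (w - z) \<le> Psi w" using assms(3) by (simp add: algebra_simps)
qed

lemma hull_is_supported:
  assumes "K0 \<phi> \<noteq> {}"
  obtains s where "supported Psi s C"
proof -
  have "\<forall>z. \<exists>c. supports Psi c z \<and> \<bar>c\<bar> \<le> C"
    using hull_supported[OF assms] hull_supports[OF assms] slope_bounded by metis
  then obtain s where "\<forall>z. supports Psi (s z) z \<and> \<bar>s z\<bar> \<le> C" by metis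
  then show thesis using that[of s] by (simp add: supported_def)
qed

end

section \<open>Asymptotic profiles\<close>

text \<open>Instead of restricting to long intervals, the mean conditions carry an additive
  constant. In this form they hold for all intervals and can be added over adjacent ones.\<close>

locale conservation_law = flux f + asymptotic_data \<phi> C "ul_sup \<phi>" "ur_inf \<phi>"
  for f \<phi> :: "real \<Rightarrow> real" and C :: real +
  assumes mean_right: "\<And>\<epsilon>. \<epsilon> > 0 \<Longrightarrow> \<exists>K. \<forall>p q. 0 \<le> p \<and> p \<le> q \<longrightarrow>
      \<bar>Phi \<phi> q - Phi \<phi> p - ur_inf \<phi> * (q - p)\<bar> \<le> \<epsilon> * (q - p) + K"
    and mean_left: "\<And>\<epsilon>. \<epsilon> > 0 \<Longrightarrow> \<exists>K. \<forall>p q. p \<le> q \<and> q \<le> 0 \<longrightarrow>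
      \<bar>Phi \<phi> q - Phi \<phi> p - ul_sup \<phi> * (q - p)\<bar> \<le> \<epsilon> * (q - p) + K"
begin

abbreviation l :: real where "l \<equiv> ul_sup \<phi>"
abbreviation r :: real where "r \<equiv> ur_inf \<phi>"

sublocale hl: hopf_lax f "deriv f" "Phi \<phi>" C
  by (rule hopf_laxI) (rule Phi_lipschitz)

lemma maximizers_phi: "t > 0 \<Longrightarrow> maximizers f \<phi> x t = hl.minimizers x t"
  by (rule maximizers_eq[OF phi_loc _ hl.hopf_lax_axioms, of _ 0]) auto

text \<open>Here \<open>z\<close> is arbitrary: with the hull in place of the primitive, a divide
  emits from every point of the axis.\<close>

lemma maximizers_hull:
  assumes "K0 \<phi> \<noteq> {}" "supports Psi c z" "t > 0"
  shows "maximizers f (hull_data \<phi>) (z + t * a c) t = {c}"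
proof -
  obtain s where "supported Psi s C" using hull_is_supported[OF assms(1)] .
  then interpret supported Psi s C .
  have hl': "hopf_lax f a Psi C" by (rule hopf_laxI) (rule lipschitz)
  have "maximizers f (hull_data \<phi>) (z + t * a c) t = hopf_lax.minimizers f a Psi (z + t * a c) t"
    unfolding hull_data_def
    by (rule maximizers_eq[OF deriv_loc assms(3) hl', of "- Psi 0"]) (simp add: Phi_deriv)
  also have "\<dots> = {c}" by (rule hopf_lax.supp_minimizers[OF hl' assms(2,3)])
  finally show ?thesis .
qed

lemma is_divide_iff: "is_divide f \<phi> c y \<longleftrightarrow> supports (Phi \<phi>) c y"
proof
  assume "is_divide f \<phi> c y"
  then have "hl.minimizers (y + t * a c) t = {c}" if "t > 0" for t
    using that maximizers_phi by (auto simp: is_divide_def ray_def)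
  then show "supports (Phi \<phi>) c y" using hl.minimizers_ray_imp_supp by simp
next
  assume "supports (Phi \<phi>) c y"
  then show "is_divide f \<phi> c y"
    using hl.supp_minimizers maximizers_phi by (auto simp: is_divide_def ray_def)
qed

section \<open>Generalized characteristics and shocks as chains\<close>

lemma u_left_eq: "t > 0 \<Longrightarrow> u_left f \<phi> x t = hl.uL x t"
  by (simp add: u_left_def hl.uL_def maximizers_phi)

lemma u_right_eq: "t > 0 \<Longrightarrow> u_right f \<phi> x t = hl.uR x t"
  by (simp add: u_right_def hl.uR_def maximizers_phi)

lemma Delta_eq:
  assumes "t > 0" shows "Delta_I f \<phi> x t = {(\<xi>, \<tau>). 0 < \<tau> \<and> hl.below \<xi> \<tau> x t}"
proof (intro equalityI subsetI)
  fix p assume "p \<in> Delta_I f \<phi> x t"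
  then obtain \<tau> v where p: "p = (x - (t - \<tau>) * a v, \<tau>)" "0 < \<tau>" "\<tau> < t" "hl.uR x t \<le> v" "v \<le> hl.uL x t"
    using assms by (auto simp: Delta_I_def u_left_eq u_right_eq algebra_simps)
  then show "p \<in> {(\<xi>, \<tau>). 0 < \<tau> \<and> hl.below \<xi> \<tau> x t}" using hl.belowI[of \<tau> t x v] by simp
next
  fix p assume "p \<in> {(\<xi>, \<tau>). 0 < \<tau> \<and> hl.below \<xi> \<tau> x t}"
  then obtain \<xi> \<tau> where p: "p = (\<xi>, \<tau>)" "0 < \<tau>" "hl.below \<xi> \<tau> x t" by auto
  obtain v where "hl.uR x t \<le> v" "v \<le> hl.uL x t" "\<xi> = x - (t - \<tau>) * a v"
    using hl.below_ivt[OF p(3)] .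
  then show "p \<in> Delta_I f \<phi> x t"
    using p hl.belowD(2)[OF p(3)] assms by (auto simp: Delta_I_def u_left_eq u_right_eq algebra_simps)
qed

text \<open>\<open>Delta_I\<close> omits its apex, so the inclusion says nothing about
  \<open>(x1, t1)\<close> directly. The apex is reached as a limit along one of its own
  characteristics; the converse is transitivity.\<close>

lemma Delta_subset_iff:
  assumes "0 < t1" "t1 < t2"
  shows "Delta_I f \<phi> x1 t1 \<subseteq> Delta_I f \<phi> x2 t2 \<longleftrightarrow> hl.below x1 t1 x2 t2"
proof
  assume b: "hl.below x1 t1 x2 t2"
  show "Delta_I f \<phi> x1 t1 \<subseteq> Delta_I f \<phi> x2 t2"
    using assms hl.below_trans[OF _ b] by (auto simp: Delta_eq)
next
  assume sub: "Delta_I f \<phi> x1 t1 \<subseteq> Delta_I f \<phi> x2 t2"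
  define u where "u = hl.uR x1 t1"
  have b: "hl.below (x1 - (t1 - \<tau>) * a u) \<tau> x2 t2" if "0 < \<tau>" "\<tau> < t1" for \<tau>
  proof -
    have "hl.below (x1 - (t1 - \<tau>) * a u) \<tau> x1 t1"
      by (rule hl.belowI) (use that assms hl.uR_le_uL in \<open>auto simp: u_def\<close>)
    then show ?thesis using sub that assms by (auto simp: Delta_eq)
  qed
  have ev: "\<forall>\<^sub>F \<tau> in at_left t1. hl.below (x1 - (t1 - \<tau>) * a u) \<tau> x2 t2"
    unfolding eventually_at_left_field using b assms by (intro exI[of _ 0]) auto
  have lim: "((\<lambda>\<tau>. x1 - (t1 - \<tau>) * a u) \<longlongrightarrow> x1 - (t1 - t1) * a u) (at_left t1)"
    by (intro tendsto_intros)
  have limv: "((\<lambda>\<tau>. x2 - (t2 - \<tau>) * a v) \<longlongrightarrow> x2 - (t2 - t1) * a v) (at_left t1)" for v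
    by (intro tendsto_intros)
  have "x2 - (t2 - t1) * a (hl.uL x2 t2) \<le> x1 - (t1 - t1) * a u"
    by (rule tendsto_le[OF _ lim limv]) (use ev in \<open>auto elim!: eventually_mono dest: hl.belowD\<close>)
  moreover have "x1 - (t1 - t1) * a u \<le> x2 - (t2 - t1) * a (hl.uR x2 t2)"
    by (rule tendsto_le[OF _ limv lim]) (use ev in \<open>auto elim!: eventually_mono dest: hl.belowD\<close>)
  ultimately show "hl.below x1 t1 x2 t2" using assms by (simp add: hl.below_def)
qed

lemma fwd_char_iff: "fwd_char f \<phi> (\<gamma> t0) t0 \<gamma> \<longleftrightarrow> t0 > 0 \<and> hl.chain t0 \<gamma>"
proof
  assume f: "fwd_char f \<phi> (\<gamma> t0) t0 \<gamma>"
  then have t0: "t0 > 0" by (simp add: fwd_char_def)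
  have "hl.below (\<gamma> s) s (\<gamma> t) t" if st: "t0 \<le> s" "s < t" for s t
  proof -
    have "Delta_I f \<phi> (\<gamma> s) s \<subseteq> Delta_I f \<phi> (\<gamma> t) t"
    proof (cases "s = t0")
      case True
      \<comment> \<open>The definition speaks of \<open>t0 < t1 < t2\<close>. The inclusion from
        time \<open>t0\<close> to \<open>t\<close> is its first half for \<open>t1 = t\<close>, with
        any later time as \<open>t2\<close>.\<close>
      then have "t0 < t \<and> t < t + 1" using st by simp
      then show ?thesis using f True unfolding fwd_char_def by blast
    next
      case False
      then show ?thesis using f st by (simp add: fwd_char_def)
    qed
    then show ?thesis using Delta_subset_iff st t0 by simp
  qed
  then show "t0 > 0 \<and> hl.chain t0 \<gamma>" using t0 by (simp add: hl.chain_def)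
next
  assume c: "t0 > 0 \<and> hl.chain t0 \<gamma>"
  then show "fwd_char f \<phi> (\<gamma> t0) t0 \<gamma>"
    using hl.chain_continuous hl.chainD by (auto simp: fwd_char_def Delta_subset_iff)
qed

text \<open>The definition relates positive times only. The relation of the starting point on the
  axis to later points is obtained as \<open>s\<close> tends to 0, by continuity of the
  curve.\<close>

lemma fwd_char_axis_iff: "fwd_char_axis f \<phi> x0 \<gamma> \<longleftrightarrow> \<gamma> 0 = x0 \<and> hl.chain 0 \<gamma>"
proof
  assume "\<gamma> 0 = x0 \<and> hl.chain 0 \<gamma>"
  then show "fwd_char_axis f \<phi> x0 \<gamma>"
    using hl.chain_continuous hl.chain_shift by (auto simp: fwd_char_axis_def fwd_char_iff)
next
  assume f: "fwd_char_axis f \<phi> x0 \<gamma>"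
  then have chain: "hl.chain s \<gamma>" if "s > 0" for s
    using that by (auto simp: fwd_char_axis_def fwd_char_iff)
  have "continuous_on {0..} \<gamma>" using f by (simp add: fwd_char_axis_def)
  then have "(\<gamma> \<longlongrightarrow> \<gamma> 0) (at 0 within {0..})" unfolding continuous_on_def by simp
  then have lim: "(\<gamma> \<longlongrightarrow> \<gamma> 0) (at_right 0)" by (rule tendsto_within_subset) auto
  have b0: "hl.below (\<gamma> 0) 0 (\<gamma> t) t" if t: "t > 0" for t
  proof -
    have b: "hl.below (\<gamma> s) s (\<gamma> t) t" if "0 < s" "s < t" for s
      using hl.chainD[OF chain[OF that(1)]] that by simp
    have ev: "\<forall>\<^sub>F s in at_right 0. hl.below (\<gamma> s) s (\<gamma> t) t"
      unfolding eventually_at_right_field using b t by (intro exI[of _ t]) auto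
    have limv: "((\<lambda>s. \<gamma> t - (t - s) * a v) \<longlongrightarrow> \<gamma> t - (t - 0) * a v) (at_right 0)" for v
      by (intro tendsto_intros)
    have "\<gamma> t - (t - 0) * a (hl.uL (\<gamma> t) t) \<le> \<gamma> 0"
      by (rule tendsto_le[OF _ lim limv]) (use ev in \<open>auto elim!: eventually_mono dest: hl.belowD\<close>)
    moreover have "\<gamma> 0 \<le> \<gamma> t - (t - 0) * a (hl.uR (\<gamma> t) t)"
      by (rule tendsto_le[OF _ limv lim]) (use ev in \<open>auto elim!: eventually_mono dest: hl.belowD\<close>)
    ultimately show ?thesis using t by (simp add: hl.below_def)
  qed
  have "hl.below (\<gamma> s) s (\<gamma> t) t" if "0 \<le> s" "s < t" for s t
    using b0[of t] hl.chainD[OF chain[of s], of s t] that by (cases "s = 0") auto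
  then show "\<gamma> 0 = x0 \<and> hl.chain 0 \<gamma>" using f by (simp add: hl.chain_def fwd_char_axis_def)
qed

section \<open>Uniform limits in the gaps and beside a characteristic\<close>

lemma tends_uniformlyI:
  assumes "\<And>\<epsilon>. \<epsilon> > 0 \<Longrightarrow> \<exists>T. \<forall>t\<ge>T. \<forall>x u. t > 0 \<longrightarrow> (x, t) \<in> S \<longrightarrow> u \<in> hl.minimizers x t \<longrightarrow> \<bar>u - c\<bar> \<le> 3 * \<epsilon>"
  shows "tends_uniformly f \<phi> S c"
  unfolding tends_uniformly_def
proof (intro allI impI)
  fix \<epsilon> :: real assume \<epsilon>: "\<epsilon> > 0"
  \<comment> \<open>A quarter, so that \<open>3 * (\<epsilon> / 4)\<close> stays strictly below
    \<open>\<epsilon>\<close>.\<close>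
  then obtain T where T: "\<And>t x u. t \<ge> T \<Longrightarrow> t > 0 \<Longrightarrow> (x, t) \<in> S \<Longrightarrow> u \<in> hl.minimizers x t \<Longrightarrow> \<bar>u - c\<bar> \<le> 3 * (\<epsilon> / 4)"
    using assms[of "\<epsilon> / 4"] by auto
  show "\<forall>\<^sub>F t in at_top. \<forall>x. (x, t) \<in> S \<longrightarrow> \<bar>u_left f \<phi> x t - c\<bar> < \<epsilon> \<and> \<bar>u_right f \<phi> x t - c\<bar> < \<epsilon>"
    using eventually_ge_at_top[of T] eventually_gt_at_top[of 0]
  proof eventually_elim
    case (elim t)
    show ?case
    proof (intro allI impI)
      fix x assume x: "(x, t) \<in> S"
      have "\<bar>hl.uL x t - c\<bar> \<le> 3 * (\<epsilon> / 4)" "\<bar>hl.uR x t - c\<bar> \<le> 3 * (\<epsilon> / 4)"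
        using T[OF elim x] hl.uL_minimizers hl.uR_minimizers elim by auto
      then show "\<bar>u_left f \<phi> x t - c\<bar> < \<epsilon> \<and> \<bar>u_right f \<phi> x t - c\<bar> < \<epsilon>"
        using \<epsilon> elim by (simp add: u_left_eq u_right_eq)
    qed
  qed
qed

lemma tends_uniformly_two_sided:
  assumes up: "\<And>\<epsilon>. \<epsilon> > 0 \<Longrightarrow> \<exists>T. \<forall>t\<ge>T. \<forall>x u. t > 0 \<longrightarrow> (x, t) \<in> S \<longrightarrow> u \<in> hl.minimizers x t \<longrightarrow> u \<le> c + 3 * \<epsilon>"
    and lo: "\<And>\<epsilon>. \<epsilon> > 0 \<Longrightarrow> \<exists>T. \<forall>t\<ge>T. \<forall>x u. t > 0 \<longrightarrow> (x, t) \<in> S \<longrightarrow> u \<in> hl.minimizers x t \<longrightarrow> c - 3 * \<epsilon> \<le> u"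
  shows "tends_uniformly f \<phi> S c"
proof (rule tends_uniformlyI)
  fix \<epsilon> :: real assume \<epsilon>: "\<epsilon> > 0"
  obtain T1 where T1: "\<And>t x u. t \<ge> T1 \<Longrightarrow> t > 0 \<Longrightarrow> (x, t) \<in> S \<Longrightarrow> u \<in> hl.minimizers x t \<Longrightarrow> u \<le> c + 3 * \<epsilon>"
    using up[OF \<epsilon>] by blast
  obtain T2 where T2: "\<And>t x u. t \<ge> T2 \<Longrightarrow> t > 0 \<Longrightarrow> (x, t) \<in> S \<Longrightarrow> u \<in> hl.minimizers x t \<Longrightarrow> c - 3 * \<epsilon> \<le> u"
    using lo[OF \<epsilon>] by blast
  show "\<exists>T. \<forall>t\<ge>T. \<forall>x u. t > 0 \<longrightarrow> (x, t) \<in> S \<longrightarrow> u \<in> hl.minimizers x t \<longrightarrow> \<bar>u - c\<bar> \<le> 3 * \<epsilon>"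
  proof (intro exI[of _ "max T1 T2"] allI impI)
    fix t x u assume "max T1 T2 \<le> t" "t > 0" "(x, t) \<in> S" "u \<in> hl.minimizers x t"
    then show "\<bar>u - c\<bar> \<le> 3 * \<epsilon>" using T1[of t x u] T2[of t x u] by (simp add: abs_le_iff)
  qed
qed

text \<open>\<open>P\<close> consists of the pairs of base points between which the mean of the data
  is controlled: all pairs, or those on one side of a point.\<close>

lemma upper_bound:
  assumes S: "\<And>\<epsilon>. \<epsilon> > 0 \<Longrightarrow> \<exists>K. \<forall>p q. (p, q) \<in> P \<and> p \<le> q \<longrightarrow> Phi \<phi> q - Phi \<phi> p \<le> (c + \<epsilon>) * (q - p) + K"
    and mem: "\<And>\<epsilon> t x u. \<epsilon> > 0 \<Longrightarrow> t > 0 \<Longrightarrow> (x, t) \<in> S \<Longrightarrow> u \<in> hl.minimizers x t \<Longrightarrow> c + 3 * \<epsilon> < u \<Longrightarrow>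
      (x - t * a u, x - t * a (u - \<epsilon>)) \<in> P"
    and \<epsilon>: "\<epsilon> > 0"
  shows "\<exists>T. \<forall>t\<ge>T. \<forall>x u. t > 0 \<longrightarrow> (x, t) \<in> S \<longrightarrow> u \<in> hl.minimizers x t \<longrightarrow> u \<le> c + 3 * \<epsilon>"
proof -
  obtain K where K: "\<And>p q. (p, q) \<in> P \<Longrightarrow> p \<le> q \<Longrightarrow> Phi \<phi> q - Phi \<phi> p \<le> (c + \<epsilon>) * (q - p) + K"
    using S[OF \<epsilon>] by blast
  show ?thesis
  proof (rule hl.minimizers_upper[OF \<epsilon>, of P c K])
    show "Phi \<phi> q - Phi \<phi> p \<le> (c + \<epsilon>) * (q - p) + K" if "(p, q) \<in> P" "p \<le> q" for p q
      by (rule K[OF that])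
    fix T assume T: "\<And>t x u. t \<ge> T \<Longrightarrow> u \<in> hl.minimizers x t \<Longrightarrow>
      (c + 3 * \<epsilon> < u \<Longrightarrow> (x - t * a u, x - t * a (u - \<epsilon>)) \<in> P) \<Longrightarrow> u \<le> c + 3 * \<epsilon>"
    show ?thesis
    proof (intro exI[of _ T] allI impI)
      fix t x u assume t: "t \<ge> T" "t > 0" and x: "(x, t) \<in> S" and u: "u \<in> hl.minimizers x t"
      show "u \<le> c + 3 * \<epsilon>" by (rule T[OF t(1) u mem[OF \<epsilon> t(2) x u]])
    qed
  qed
qed

lemma lower_bound:
  assumes S: "\<And>\<epsilon>. \<epsilon> > 0 \<Longrightarrow> \<exists>K. \<forall>p q. (p, q) \<in> P \<and> p \<le> q \<longrightarrow> (c - \<epsilon>) * (q - p) - K \<le> Phi \<phi> q - Phi \<phi> p"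
    and mem: "\<And>\<epsilon> t x u. \<epsilon> > 0 \<Longrightarrow> t > 0 \<Longrightarrow> (x, t) \<in> S \<Longrightarrow> u \<in> hl.minimizers x t \<Longrightarrow> u < c - 3 * \<epsilon> \<Longrightarrow>
      (x - t * a (u + \<epsilon>), x - t * a u) \<in> P"
    and \<epsilon>: "\<epsilon> > 0"
  shows "\<exists>T. \<forall>t\<ge>T. \<forall>x u. t > 0 \<longrightarrow> (x, t) \<in> S \<longrightarrow> u \<in> hl.minimizers x t \<longrightarrow> c - 3 * \<epsilon> \<le> u"
proof -
  obtain K where K: "\<And>p q. (p, q) \<in> P \<Longrightarrow> p \<le> q \<Longrightarrow> (c - \<epsilon>) * (q - p) - K \<le> Phi \<phi> q - Phi \<phi> p"
    using S[OF \<epsilon>] by blast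
  show ?thesis
  proof (rule hl.minimizers_lower[OF \<epsilon>, of P c K])
    show "(c - \<epsilon>) * (q - p) - K \<le> Phi \<phi> q - Phi \<phi> p" if "(p, q) \<in> P" "p \<le> q" for p q
      by (rule K[OF that])
    fix T assume T: "\<And>t x u. t \<ge> T \<Longrightarrow> u \<in> hl.minimizers x t \<Longrightarrow>
      (u < c - 3 * \<epsilon> \<Longrightarrow> (x - t * a (u + \<epsilon>), x - t * a u) \<in> P) \<Longrightarrow> c - 3 * \<epsilon> \<le> u"
    show ?thesis
    proof (intro exI[of _ T] allI impI)
      fix t x u assume t: "t \<ge> T" "t > 0" and x: "(x, t) \<in> S" and u: "u \<in> hl.minimizers x t"
      show "c - 3 * \<epsilon> \<le> u" by (rule T[OF t(1) u mem[OF \<epsilon> t(2) x u]])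
    qed
  qed
qed

lemma increment_bounds:
  fixes D c z \<epsilon> K :: real
  assumes "\<bar>D - c * z\<bar> \<le> \<epsilon> * z + K"
  shows "(c - \<epsilon>) * z - K \<le> D" "D \<le> (c + \<epsilon>) * z + K"
  using assms unfolding abs_le_iff by (simp_all add: left_diff_distrib distrib_right)

text \<open>Moving both end points by at most \<open>d\<close> changes the increment of
  \<open>Phi\<close> by at most \<open>2 * C * d\<close> and the linear term by at most
  \<open>2 * \<bar>c\<bar> * d\<close>. This transfers the mean conditions from half-lines ending at
  0 to arbitrary ones.\<close>

lemma clamp_increment:
  assumes "p \<le> q" "\<bar>p - p'\<bar> \<le> d" "\<bar>q - q'\<bar> \<le> d"
    and "\<bar>Phi \<phi> q' - Phi \<phi> p' - c * (q' - p')\<bar> \<le> \<epsilon> * (q' - p') + K" "\<epsilon> \<ge> 0" "q' - p' \<le> q - p"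
  shows "\<bar>Phi \<phi> q - Phi \<phi> p - c * (q - p)\<bar> \<le> \<epsilon> * (q - p) + (K + 2 * (C + \<bar>c\<bar>) * d)"
proof -
  have C: "\<bar>Phi \<phi> z - Phi \<phi> z'\<bar> \<le> C * d" "\<bar>c * (z - z')\<bar> \<le> \<bar>c\<bar> * d" if "\<bar>z - z'\<bar> \<le> d" for z z'
    using Phi_lipschitz[of z z'] mult_left_mono[OF that C_nonneg] mult_left_mono[OF that, of "\<bar>c\<bar>"]
    by (auto simp: abs_mult)
  have "\<epsilon> * (q' - p') \<le> \<epsilon> * (q - p)" using assms by (intro mult_left_mono)
  moreover have "Phi \<phi> q - Phi \<phi> p - c * (q - p) = (Phi \<phi> q' - Phi \<phi> p' - c * (q' - p'))
      + (Phi \<phi> q - Phi \<phi> q') - (Phi \<phi> p - Phi \<phi> p') - c * (q - q') + c * (p - p')"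
    by (simp add: algebra_simps)
  moreover have "2 * (C + \<bar>c\<bar>) * d = C * d + C * d + \<bar>c\<bar> * d + \<bar>c\<bar> * d" by (simp add: algebra_simps)
  ultimately show ?thesis using C[OF assms(2)] C[OF assms(3)] assms(4) by linarith
qed

lemma mean_right_from:
  assumes "\<epsilon> > 0"
  obtains K where "\<And>p q. P \<le> p \<Longrightarrow> p \<le> q \<Longrightarrow> (r - \<epsilon>) * (q - p) - K \<le> Phi \<phi> q - Phi \<phi> p"
    "\<And>p q. P \<le> p \<Longrightarrow> p \<le> q \<Longrightarrow> Phi \<phi> q - Phi \<phi> p \<le> (r + \<epsilon>) * (q - p) + K"
proof -
  obtain K where K: "\<And>p q. 0 \<le> p \<Longrightarrow> p \<le> q \<Longrightarrow> \<bar>Phi \<phi> q - Phi \<phi> p - r * (q - p)\<bar> \<le> \<epsilon> * (q - p) + K"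
    using mean_right[OF assms] by blast
  have "\<bar>Phi \<phi> q - Phi \<phi> p - r * (q - p)\<bar> \<le> \<epsilon> * (q - p) + (K + 2 * (C + \<bar>r\<bar>) * \<bar>P\<bar>)"
    if "P \<le> p" "p \<le> q" for p q
    \<comment> \<open>For \<open>P \<le> p\<close>, replacing \<open>p\<close> by
      \<open>max p 0\<close> moves it by at most \<open>\<bar>P\<bar>\<close>.\<close>
    by (rule clamp_increment[OF that(2) _ _ K[of "max p 0" "max q 0"]]) (use assms that in auto)
  from increment_bounds[OF this] show thesis by (rule that)
qed

lemma mean_left_to:
  assumes "\<epsilon> > 0"
  obtains K where "\<And>p q. p \<le> q \<Longrightarrow> q \<le> P \<Longrightarrow> (l - \<epsilon>) * (q - p) - K \<le> Phi \<phi> q - Phi \<phi> p"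
    "\<And>p q. p \<le> q \<Longrightarrow> q \<le> P \<Longrightarrow> Phi \<phi> q - Phi \<phi> p \<le> (l + \<epsilon>) * (q - p) + K"
proof -
  obtain K where K: "\<And>p q. p \<le> q \<Longrightarrow> q \<le> 0 \<Longrightarrow> \<bar>Phi \<phi> q - Phi \<phi> p - l * (q - p)\<bar> \<le> \<epsilon> * (q - p) + K"
    using mean_left[OF assms] by blast
  have "\<bar>Phi \<phi> q - Phi \<phi> p - l * (q - p)\<bar> \<le> \<epsilon> * (q - p) + (K + 2 * (C + \<bar>l\<bar>) * \<bar>P\<bar>)"
    if "p \<le> q" "q \<le> P" for p q
    by (rule clamp_increment[OF that(1) _ _ K[of "min p 0" "min q 0"]]) (use assms that in auto)
  from increment_bounds[OF this] show thesis by (rule that)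
qed

text \<open>Intervals are cut at 0. Because \<open>r \<le> l\<close>, the lower bound with
  \<open>r\<close> and the upper bound with \<open>l\<close> hold on either side.\<close>

lemma mean_global:
  assumes "r \<le> l" "\<epsilon> > 0"
  obtains K where "\<And>p q. p \<le> q \<Longrightarrow> (r - \<epsilon>) * (q - p) - K \<le> Phi \<phi> q - Phi \<phi> p"
    "\<And>p q. p \<le> q \<Longrightarrow> Phi \<phi> q - Phi \<phi> p \<le> (l + \<epsilon>) * (q - p) + K"
proof -
  obtain K1 where K1: "\<And>p q. 0 \<le> p \<Longrightarrow> p \<le> q \<Longrightarrow> (r - \<epsilon>) * (q - p) - K1 \<le> Phi \<phi> q - Phi \<phi> p"
    "\<And>p q. 0 \<le> p \<Longrightarrow> p \<le> q \<Longrightarrow> Phi \<phi> q - Phi \<phi> p \<le> (r + \<epsilon>) * (q - p) + K1"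
    using mean_right_from[OF assms(2)] by blast
  obtain K2 where K2: "\<And>p q. p \<le> q \<Longrightarrow> q \<le> 0 \<Longrightarrow> (l - \<epsilon>) * (q - p) - K2 \<le> Phi \<phi> q - Phi \<phi> p"
    "\<And>p q. p \<le> q \<Longrightarrow> q \<le> 0 \<Longrightarrow> Phi \<phi> q - Phi \<phi> p \<le> (l + \<epsilon>) * (q - p) + K2"
    using mean_left_to[OF assms(2)] by blast
  have nonneg: "K1 \<ge> 0" "K2 \<ge> 0" using K1(1)[of 0 0] K2(1)[of 0 0] by auto
  have m: "(r - \<epsilon>) * (q - p) \<le> (l - \<epsilon>) * (q - p)" "(r + \<epsilon>) * (q - p) \<le> (l + \<epsilon>) * (q - p)" if "p \<le> q" for p q
    using assms(1) that by (auto intro!: mult_right_mono)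
  have "(r - \<epsilon>) * (q - p) - (K1 + K2) \<le> Phi \<phi> q - Phi \<phi> p \<and>
      Phi \<phi> q - Phi \<phi> p \<le> (l + \<epsilon>) * (q - p) + (K1 + K2)" if pq: "p \<le> q" for p q
  proof -
    consider "0 \<le> p" | "q \<le> 0" | "p < 0" "0 < q" by linarith
    then show ?thesis
    proof cases
      case 1
      then show ?thesis using K1[OF 1 pq] m[OF pq] nonneg by linarith
    next
      case 2
      then show ?thesis using K2[OF pq 2] m[OF pq] nonneg by linarith
    next
      case 3
      have "(r - \<epsilon>) * (q - p) = (r - \<epsilon>) * (q - 0) + (r - \<epsilon>) * (0 - p)"
        "(l + \<epsilon>) * (q - p) = (l + \<epsilon>) * (q - 0) + (l + \<epsilon>) * (0 - p)"
        by (simp_all add: right_diff_distrib)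
      then show ?thesis using K1[of 0 q] K2[of p 0] m[of 0 q] m[of p 0] 3 by linarith
    qed
  qed
  then show thesis using that[of "K1 + K2"] by blast
qed

lemma base_right:
  assumes "supports (Phi \<phi>) c e" "t > 0" "e + t * a c < x" "u \<in> hl.minimizers x t"
  shows "e \<le> x - t * a u"
  using hl.minimizers_base_mono[of c "e + t * a c" t u x] hl.supp_minimizers assms by simp

lemma base_left:
  assumes "supports (Phi \<phi>) c h" "t > 0" "x < h + t * a c" "u \<in> hl.minimizers x t"
  shows "x - t * a u \<le> h"
  using hl.minimizers_base_mono[of u x t c "h + t * a c"] hl.supp_minimizers assms by simp

text \<open>Both \<open>x - t * a u\<close> and \<open>x - t * a c\<close> lie in
  \<open>{e..h}\<close>, the former because characteristics do not cross the divides from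
  \<open>e\<close> and \<open>h\<close>. Hence the speeds differ by at most
  \<open>(h - e) / t\<close>.\<close>

lemma bounded_gap_uniform:
  assumes "(ereal e, ereal h) \<in> gaps \<phi>"
  shows "tends_uniformly f \<phi> (H_region f \<phi> e h) (gap_slope \<phi> e h)"
proof (rule tends_uniformlyI)
  fix \<epsilon> :: real assume \<epsilon>: "\<epsilon> > 0"
  define c where "c = gap_slope \<phi> e h"
  have g: "e < h" "supports (Phi \<phi>) c e" "supports (Phi \<phi>) c h"
    using gap_bounded[OF assms] by (auto simp: c_def)
  \<comment> \<open>A speed within \<open>d\<close> of \<open>a c\<close> belongs to a state within
    \<open>3 * \<epsilon>\<close> of \<open>c\<close>.\<close>
  define d where "d = min (a (c + 3 * \<epsilon>) - a c) (a c - a (c - 3 * \<epsilon>))"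
  have d: "d > 0" using \<epsilon> by (simp add: d_def)
  show "\<exists>T. \<forall>t\<ge>T. \<forall>x u. t > 0 \<longrightarrow> (x, t) \<in> H_region f \<phi> e h \<longrightarrow> u \<in> hl.minimizers x t \<longrightarrow>
      \<bar>u - gap_slope \<phi> e h\<bar> \<le> 3 * \<epsilon>"
  proof (intro exI[of _ "(h - e) / d"] allI impI)
    fix t x u assume t: "(h - e) / d \<le> t" "t > 0" and x: "(x, t) \<in> H_region f \<phi> e h" and u: "u \<in> hl.minimizers x t"
    have x: "e + t * a c < x" "x < h + t * a c" using x by (auto simp: H_region_def Let_def c_def)
    have "e \<le> x - t * a u" "x - t * a u \<le> h" using base_right base_left g x t u by auto
    then have "\<bar>t * (a u - a c)\<bar> \<le> h - e" using x by (simp add: abs_le_iff algebra_simps)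
    also have "\<dots> \<le> t * d" using t d by (simp add: pos_divide_le_eq)
    finally have "\<bar>a u - a c\<bar> \<le> d" using t by (simp add: abs_mult)
    moreover have "d \<le> a (c + 3 * \<epsilon>) - a c" "d \<le> a c - a (c - 3 * \<epsilon>)" unfolding d_def by linarith+
    ultimately have "a u \<le> a (c + 3 * \<epsilon>)" "a (c - 3 * \<epsilon>) \<le> a u" by linarith+
    then show "\<bar>u - gap_slope \<phi> e h\<bar> \<le> 3 * \<epsilon>" by (auto simp: c_def abs_le_iff)
  qed
qed

text \<open>The interval between the base points has to lie right of \<open>e\<close>. For the upper
  bound its left end is the base point of \<open>u\<close>, confined by the divide from
  \<open>e\<close>. For the lower bound it is the base point of the competitor, which lies right of
  \<open>e\<close> because \<open>u + \<epsilon> \<le> r\<close>.\<close>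

lemma right_gap_uniform:
  assumes "(ereal e, \<infinity>) \<in> gaps \<phi>"
  shows "tends_uniformly f \<phi> (H_region f \<phi> e \<infinity>) r"
proof (rule tends_uniformly_two_sided)
  note sup = gap_right[OF assms]
  have H: "e + t * a r < x" if "(x, t) \<in> H_region f \<phi> e \<infinity>" for x t using that by (simp add: H_region_def)
  show "\<exists>T. \<forall>t\<ge>T. \<forall>x u. t > 0 \<longrightarrow> (x, t) \<in> H_region f \<phi> e \<infinity> \<longrightarrow> u \<in> hl.minimizers x t \<longrightarrow> u \<le> r + 3 * \<epsilon>"
    if "\<epsilon> > 0" for \<epsilon>
  proof (rule upper_bound[where P="{(p, q). e \<le> p}", OF _ _ that])
    show "\<exists>K. \<forall>p q. (p, q) \<in> {(p, q). e \<le> p} \<and> p \<le> q \<longrightarrow> Phi \<phi> q - Phi \<phi> p \<le> (r + \<epsilon>) * (q - p) + K"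
      if \<epsilon>: "\<epsilon> > 0" for \<epsilon>
      using mean_right_from[OF \<epsilon>] by simp metis
  qed (use base_right[OF sup] H in auto)
  show "\<exists>T. \<forall>t\<ge>T. \<forall>x u. t > 0 \<longrightarrow> (x, t) \<in> H_region f \<phi> e \<infinity> \<longrightarrow> u \<in> hl.minimizers x t \<longrightarrow> r - 3 * \<epsilon> \<le> u"
    if "\<epsilon> > 0" for \<epsilon>
  proof (rule lower_bound[where P="{(p, q). e \<le> p}", OF _ _ that])
    show "\<exists>K. \<forall>p q. (p, q) \<in> {(p, q). e \<le> p} \<and> p \<le> q \<longrightarrow> (r - \<epsilon>) * (q - p) - K \<le> Phi \<phi> q - Phi \<phi> p"
      if \<epsilon>: "\<epsilon> > 0" for \<epsilon>
      using mean_right_from[OF \<epsilon>] by simp metis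
    show "(x - t * a (u + \<epsilon>), x - t * a u) \<in> {(p, q). e \<le> p}"
      if "\<epsilon> > 0" "t > 0" "(x, t) \<in> H_region f \<phi> e \<infinity>" "u < r - 3 * \<epsilon>" for \<epsilon> t x u
    proof -
      have "t * a (u + \<epsilon>) \<le> t * a r" using that by simp
      then show ?thesis using H[OF that(3)] by simp
    qed
  qed
qed

lemma left_gap_uniform:
  assumes "(-\<infinity>, ereal h) \<in> gaps \<phi>"
  shows "tends_uniformly f \<phi> (H_region f \<phi> (-\<infinity>) h) l"
proof (rule tends_uniformly_two_sided)
  note sup = gap_left[OF assms]
  have H: "x < h + t * a l" if "(x, t) \<in> H_region f \<phi> (-\<infinity>) h" for x t using that by (simp add: H_region_def)
  show "\<exists>T. \<forall>t\<ge>T. \<forall>x u. t > 0 \<longrightarrow> (x, t) \<in> H_region f \<phi> (-\<infinity>) h \<longrightarrow> u \<in> hl.minimizers x t \<longrightarrow> u \<le> l + 3 * \<epsilon>"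
    if "\<epsilon> > 0" for \<epsilon>
  proof (rule upper_bound[where P="{(p, q). q \<le> h}", OF _ _ that])
    show "\<exists>K. \<forall>p q. (p, q) \<in> {(p, q). q \<le> h} \<and> p \<le> q \<longrightarrow> Phi \<phi> q - Phi \<phi> p \<le> (l + \<epsilon>) * (q - p) + K"
      if \<epsilon>: "\<epsilon> > 0" for \<epsilon>
      using mean_left_to[OF \<epsilon>] by simp metis
    show "(x - t * a u, x - t * a (u - \<epsilon>)) \<in> {(p, q). q \<le> h}"
      if "\<epsilon> > 0" "t > 0" "(x, t) \<in> H_region f \<phi> (-\<infinity>) h" "l + 3 * \<epsilon> < u" for \<epsilon> t x u
    proof -
      have "t * a l \<le> t * a (u - \<epsilon>)" using that by simp
      then show ?thesis using H[OF that(3)] by simp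
    qed
  qed
  show "\<exists>T. \<forall>t\<ge>T. \<forall>x u. t > 0 \<longrightarrow> (x, t) \<in> H_region f \<phi> (-\<infinity>) h \<longrightarrow> u \<in> hl.minimizers x t \<longrightarrow> l - 3 * \<epsilon> \<le> u"
    if "\<epsilon> > 0" for \<epsilon>
  proof (rule lower_bound[where P="{(p, q). q \<le> h}", OF _ _ that])
    show "\<exists>K. \<forall>p q. (p, q) \<in> {(p, q). q \<le> h} \<and> p \<le> q \<longrightarrow> (l - \<epsilon>) * (q - p) - K \<le> Phi \<phi> q - Phi \<phi> p"
      if \<epsilon>: "\<epsilon> > 0" for \<epsilon>
      using mean_left_to[OF \<epsilon>] by simp metis
  qed (use base_left[OF sup] H in auto)
qed

lemma upper_global:
  assumes "r \<le> l" "\<epsilon> > 0"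
  shows "\<exists>T. \<forall>t\<ge>T. \<forall>x u. t > 0 \<longrightarrow> (x, t) \<in> S \<longrightarrow> u \<in> hl.minimizers x t \<longrightarrow> u \<le> l + 3 * \<epsilon>"
  proof (rule upper_bound[where P=UNIV, OF _ _ assms(2)])
  show "\<exists>K. \<forall>p q. (p, q) \<in> UNIV \<and> p \<le> q \<longrightarrow> Phi \<phi> q - Phi \<phi> p \<le> (l + \<epsilon>) * (q - p) + K"
    if "\<epsilon> > 0" for \<epsilon>
    using mean_global[OF assms(1) that] by simp metis
qed simp

lemma lower_global:
  assumes "r \<le> l" "\<epsilon> > 0"
  shows "\<exists>T. \<forall>t\<ge>T. \<forall>x u. t > 0 \<longrightarrow> (x, t) \<in> S \<longrightarrow> u \<in> hl.minimizers x t \<longrightarrow> r - 3 * \<epsilon> \<le> u"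
  proof (rule lower_bound[where P=UNIV, OF _ _ assms(2)])
  show "\<exists>K. \<forall>p q. (p, q) \<in> UNIV \<and> p \<le> q \<longrightarrow> (r - \<epsilon>) * (q - p) - K \<le> Phi \<phi> q - Phi \<phi> p"
    if "\<epsilon> > 0" for \<epsilon>
    using mean_global[OF assms(1) that] by simp metis
qed simp

lemma uniform_everywhere:
  assumes "l = r" shows "tends_uniformly f \<phi> S r"
proof (rule tends_uniformly_two_sided)
  have rl: "r \<le> l" using assms by simp
  fix \<epsilon> :: real assume \<epsilon>: "\<epsilon> > 0"
  show "\<exists>T. \<forall>t\<ge>T. \<forall>x u. t > 0 \<longrightarrow> (x, t) \<in> S \<longrightarrow> u \<in> hl.minimizers x t \<longrightarrow> u \<le> r + 3 * \<epsilon>"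
    using upper_global[OF rl \<epsilon>] unfolding assms .
  show "\<exists>T. \<forall>t\<ge>T. \<forall>x u. t > 0 \<longrightarrow> (x, t) \<in> S \<longrightarrow> u \<in> hl.minimizers x t \<longrightarrow> r - 3 * \<epsilon> \<le> u"
    using lower_global[OF rl \<epsilon>] unfolding assms .
qed

text \<open>Points right of the chain have their base points right of \<open>\<gamma> 0\<close>,
  which gives the upper bound. In the lower bound the competitor's base point need not lie there,
  but \<open>r\<close> is the smaller slope, so the global mean bound applies.\<close>

lemma char_uniform_right:
  assumes "r \<le> l" "hl.chain 0 \<gamma>"
  shows "tends_uniformly f \<phi> {(x, t). t > 0 \<and> x > \<gamma> t} r"
proof (rule tends_uniformly_two_sided)
  show "\<exists>T. \<forall>t\<ge>T. \<forall>x u. t > 0 \<longrightarrow> (x, t) \<in> {(x, t). t > 0 \<and> x > \<gamma> t} \<longrightarrow> u \<in> hl.minimizers x t \<longrightarrow> u \<le> r + 3 * \<epsilon>"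
    if "\<epsilon> > 0" for \<epsilon>
  proof (rule upper_bound[where P="{(p, q). \<gamma> 0 \<le> p}", OF _ _ that])
    show "\<exists>K. \<forall>p q. (p, q) \<in> {(p, q). \<gamma> 0 \<le> p} \<and> p \<le> q \<longrightarrow> Phi \<phi> q - Phi \<phi> p \<le> (r + \<epsilon>) * (q - p) + K"
      if \<epsilon>: "\<epsilon> > 0" for \<epsilon>
      using mean_right_from[OF \<epsilon>] by simp metis
    show "(x - t * a u, x - t * a (u - \<epsilon>)) \<in> {(p, q). \<gamma> 0 \<le> p}"
      if "t > 0" "(x, t) \<in> {(x, t). t > 0 \<and> x > \<gamma> t}" "u \<in> hl.minimizers x t" for \<epsilon> t x u
      using hl.minimizers_base_mono[OF hl.uR_minimizers that(3), of "\<gamma> t"] hl.belowD(5)[OF hl.chainD[OF assms(2), of 0 t]] that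
      by simp
  qed
qed (rule lower_global[OF assms(1)])

lemma char_uniform_left:
  assumes "r \<le> l" "hl.chain 0 \<gamma>"
  shows "tends_uniformly f \<phi> {(x, t). t > 0 \<and> x < \<gamma> t} l"
proof (rule tends_uniformly_two_sided)
  show "\<exists>T. \<forall>t\<ge>T. \<forall>x u. t > 0 \<longrightarrow> (x, t) \<in> {(x, t). t > 0 \<and> x < \<gamma> t} \<longrightarrow> u \<in> hl.minimizers x t \<longrightarrow> l - 3 * \<epsilon> \<le> u"
    if "\<epsilon> > 0" for \<epsilon>
  proof (rule lower_bound[where P="{(p, q). q \<le> \<gamma> 0}", OF _ _ that])
    show "\<exists>K. \<forall>p q. (p, q) \<in> {(p, q). q \<le> \<gamma> 0} \<and> p \<le> q \<longrightarrow> (l - \<epsilon>) * (q - p) - K \<le> Phi \<phi> q - Phi \<phi> p"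
      if \<epsilon>: "\<epsilon> > 0" for \<epsilon>
      using mean_left_to[OF \<epsilon>] by simp metis
    show "(x - t * a (u + \<epsilon>), x - t * a u) \<in> {(p, q). q \<le> \<gamma> 0}"
      if "t > 0" "(x, t) \<in> {(x, t). t > 0 \<and> x < \<gamma> t}" "u \<in> hl.minimizers x t" for \<epsilon> t x u
      using hl.minimizers_base_mono[OF that(3) hl.uL_minimizers, of "\<gamma> t"] hl.belowD(4)[OF hl.chainD[OF assms(2), of 0 t]] that
      by simp
  qed
qed (rule upper_global[OF assms(1)])

section \<open>The solution for the hull data and the cover of the half plane\<close>

lemma hull_sol:
  assumes "K0 \<phi> \<noteq> {}" "supports (Phi \<phi>) c y" "Phi_hull \<phi> z = ereal (Phi \<phi> y + c * (z - y))" "t > 0"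
  shows "entropy_sol f (hull_data \<phi>) (z + t * a c) t = c"
  using maximizers_hull[OF assms(1) hull_supports[OF assms(1-3)] assms(4)] by (simp add: entropy_sol_def)

lemma divide_sol:
  assumes "is_divide f \<phi> c y" "(x, t) \<in> ray f c y"
  shows "entropy_sol f \<phi> x t = entropy_sol f (hull_data \<phi>) x t"
    "entropy_sol f \<phi> x t = inv (deriv f) ((x - y) / t)"
proof -
  have sup: "supports (Phi \<phi>) c y" using assms(1) by (simp add: is_divide_iff)
  then have y: "y \<in> K0 \<phi>" by (rule K0_supports)
  have x: "x = y + t * a c" and t: "t > 0" using assms(2) by (auto simp: ray_def)
  have u: "entropy_sol f \<phi> x t = c"
    using hl.supp_minimizers[OF sup t] by (simp add: entropy_sol_def maximizers_phi t x)
  have ne: "K0 \<phi> \<noteq> {}" using y by blast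
  have "Phi_hull \<phi> y = ereal (Phi \<phi> y + c * (y - y))" using y by (simp add: K0_def)
  from hull_sol[OF ne sup this t] show "entropy_sol f \<phi> x t = entropy_sol f (hull_data \<phi>) x t"
    using u x by simp
  have "inj (deriv f)" by (rule injI) simp
  then show "entropy_sol f \<phi> x t = inv (deriv f) ((x - y) / t)"
    using u x t by (simp add: inv_f_f)
qed

lemma bounded_gap_hull_sol:
  assumes "(ereal e, ereal h) \<in> gaps \<phi>" "(x, t) \<in> H_region f \<phi> e h"
  shows "entropy_sol f (hull_data \<phi>) x t = gap_slope \<phi> e h"
proof -
  define c where "c = gap_slope \<phi> e h"
  have x: "t > 0" "e < x - t * a c" "x - t * a c < h"
    using assms(2) by (auto simp: H_region_def Let_def c_def)
  have ne: "K0 \<phi> \<noteq> {}" using gapD(3)[OF assms(1)] by blast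
  show ?thesis
    using hull_sol[OF ne gap_bounded(2)[OF assms(1)] hull_bounded_gap[OF assms(1)], of "x - t * a c" t] x
    by (simp add: c_def)
qed

lemma right_gap_hull_sol:
  assumes "(ereal e, \<infinity>) \<in> gaps \<phi>" "(x, t) \<in> H_region f \<phi> e \<infinity>"
  shows "entropy_sol f (hull_data \<phi>) x t = r"
proof -
  have x: "t > 0" "e < x - t * a r" using assms(2) by (auto simp: H_region_def)
  have ne: "K0 \<phi> \<noteq> {}" using gapD(3)[OF assms(1)] by blast
  show ?thesis
    using hull_sol[OF ne gap_right[OF assms(1)] hull_right_gap[OF assms(1)], of "x - t * a r" t] x by simp
qed

lemma left_gap_hull_sol:
  assumes "(-\<infinity>, ereal h) \<in> gaps \<phi>" "(x, t) \<in> H_region f \<phi> (-\<infinity>) h"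
  shows "entropy_sol f (hull_data \<phi>) x t = l"
proof -
  have x: "t > 0" "x - t * a l < h" using assms(2) by (auto simp: H_region_def)
  have ne: "K0 \<phi> \<noteq> {}" using gapD(4)[OF assms(1)] by blast
  show ?thesis
    using hull_sol[OF ne gap_left[OF assms(1)] hull_left_gap[OF assms(1)], of "x - t * a l" t] x by simp
qed

lemma supports_between:
  assumes "supports (Phi \<phi>) c y" "supports (Phi \<phi>) c' y" "c \<le> w" "w \<le> c'"
  shows "supports (Phi \<phi>) w y"
  unfolding supports_def
proof
  fix z
  have "w * (z - y) \<le> max (c * (z - y)) (c' * (z - y))"
    using assms(3,4) by (cases "y \<le> z") (auto simp: le_max_iff_disj intro: mult_right_mono mult_right_mono_neg)
  then show "Phi \<phi> y + w * (z - y) \<le> Phi \<phi> z" using supportsD[OF assms(1), of z] supportsD[OF assms(2), of z] by linarith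
qed

text \<open>The points of \<open>K0\<close> are divided according to whether a divide from them
  passes left or right of \<open>(x, t)\<close>. As no divide hits \<open>(x, t)\<close>, the parts
  are separated and \<open>A\<close> is left of \<open>B\<close>; the gap between them is the one
  whose region contains the point.\<close>

lemma half_plane_cover:
  assumes ne: "K0 \<phi> \<noteq> {}" and t: "t > 0" and notK: "(x, t) \<notin> K_set f \<phi>"
  shows "\<exists>(e, h)\<in>gaps \<phi>. (x, t) \<in> H_region f \<phi> e h"
proof -
  define A where "A = {y. \<exists>c. supports (Phi \<phi>) c y \<and> y + t * a c \<in> {..x}}"
  define B where "B = {y. \<exists>c. supports (Phi \<phi>) c y \<and> y + t * a c \<in> {x..}}"
  have cont: "continuous_on UNIV (\<lambda>c. t * a c)" by (intro continuous_intros a_cont)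
  have cl: "closed A" "closed B" unfolding A_def B_def by (intro closed_slopes cont closed_atMost closed_atLeast)+
  have "(\<exists>c. supports (Phi \<phi>) c y) \<longleftrightarrow> (\<exists>c. supports (Phi \<phi>) c y \<and> y + t * a c \<le> x) \<or>
      (\<exists>c. supports (Phi \<phi>) c y \<and> x \<le> y + t * a c)" for y by (meson linear)
  then have K: "K0 \<phi> = A \<union> B" by (simp add: A_def B_def set_eq_iff K0_iff)
  have neq: "y + t * a c \<noteq> x" if "supports (Phi \<phi>) c y" for y c
    using notK that t by (auto simp: K_set_def is_divide_iff ray_def)
  have less: "y < y'" if yA: "y \<in> A" and yB: "y' \<in> B" for y y'
  proof (rule ccontr)
    assume "\<not> y < y'"
    obtain c where c: "supports (Phi \<phi>) c y" "y + t * a c \<le> x" using yA by (auto simp: A_def)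
    obtain c' where c': "supports (Phi \<phi>) c' y'" "x \<le> y' + t * a c'" using yB by (auto simp: B_def)
    show False
    \<comment> \<open>At a kink, divides on both sides of \<open>(x, t)\<close> could emit from one
      point. All intermediate slopes are then support slopes, and one of these divides would hit
      \<open>(x, t)\<close>.\<close>
    proof (cases "y = y'")
      case True
      have "a c \<le> (x - y) / t" "(x - y) / t \<le> a c'" using c c' True t by (auto simp: field_simps)
      then obtain w where w: "c \<le> w" "w \<le> c'" "a w = (x - y) / t" by (rule hl.a_ivt)
      have "supports (Phi \<phi>) w y" using supports_between c(1) c'(1) w(1,2) True by blast
      then show False using neq w(3) t by fastforce
    next
      case False
      then have yy: "y' < y" using \<open>\<not> y < y'\<close> by simp
      have "t * a c' \<le> t * a c" using supports_mono[OF c'(1) c(1) yy] t by simp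
      then show False using c c' yy by linarith
    qed
  qed
  obtain M where M: "\<And>u. -C \<le> u \<Longrightarrow> u \<le> C \<Longrightarrow> \<bar>a u\<bar> \<le> M" using hl.a_bounded by blast
  have b: "\<bar>t * a c\<bar> \<le> t * M" if "supports (Phi \<phi>) c y" for c y
    using M slope_bounded[OF that] t by (simp add: abs_mult abs_le_iff minus_le_iff)
  have "bdd_above A" by (rule bdd_aboveI[of _ "x + t * M"]) (use b in \<open>fastforce simp: A_def abs_le_iff\<close>)
  moreover have "bdd_below B" by (rule bdd_belowI[of _ "x - t * M"]) (use b in \<open>fastforce simp: B_def abs_le_iff\<close>)
  ultimately obtain e h where eh: "(e, h) \<in> gaps \<phi>" "e = -\<infinity> \<or> (\<exists>r\<in>A. e = ereal r)" "h = \<infinity> \<or> (\<exists>r\<in>B. h = ereal r)"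
    "e = -\<infinity> \<Longrightarrow> h \<noteq> \<infinity>"
    using split_gap[OF K ne cl less] by blast
  have A': "y + t * a c < x" if "y \<in> A" "supports (Phi \<phi>) c y" for y c
    using less[OF that(1), of y] that(2) by (force simp: B_def)
  have B': "x < y + t * a c" if "y \<in> B" "supports (Phi \<phi>) c y" for y c
    using less[OF _ that(1), of y] that(2) by (force simp: A_def)
  consider (b) u v where "e = ereal u" "h = ereal v" "u \<in> A" "v \<in> B"
    | (r) u where "e = ereal u" "h = \<infinity>" "u \<in> A" | (l) v where "e = -\<infinity>" "h = ereal v" "v \<in> B"
    using eh(2-4) by blast
  then have "(x, t) \<in> H_region f \<phi> e h"
  proof cases
    case b
    then show ?thesis using gap_bounded[of u v] eh(1) A' B' t by (simp add: H_region_def Let_def)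
  next
    case r
    then show ?thesis using gap_right[of u] eh(1) A' t by (simp add: H_region_def)
  next
    case l
    then show ?thesis using gap_left[of v] eh(1) B' t by (simp add: H_region_def)
  qed
  then show ?thesis using eh(1) by blast
qed

lemma half_plane_eq:
  assumes "K0 \<phi> \<noteq> {}"
  shows "UNIV \<times> {0<..} = K_set f \<phi> \<union> (\<Union>(e, h) \<in> gaps \<phi>. H_region f \<phi> e h)"
proof (intro equalityI subsetI)
  fix p :: "real \<times> real" assume "p \<in> UNIV \<times> {0<..}"
  then obtain x t where "p = (x, t)" "t > 0" by (cases p) auto
  then show "p \<in> K_set f \<phi> \<union> (\<Union>(e, h) \<in> gaps \<phi>. H_region f \<phi> e h)"
    using half_plane_cover[OF assms] by blast
next
  fix p assume "p \<in> K_set f \<phi> \<union> (\<Union>(e, h) \<in> gaps \<phi>. H_region f \<phi> e h)"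
  then show "p \<in> UNIV \<times> {0<..}"
    by (auto simp: K_set_def ray_def H_region_def Let_def split: if_splits)
qed

lemma shock_chain: "is_shock f \<phi> t0 \<gamma> \<Longrightarrow> hl.chain t0 \<gamma>"
  by (auto simp: is_shock_def fwd_char_iff fwd_char_axis_iff)

lemma is_shockI: "t0 > 0 \<Longrightarrow> hl.chain t0 \<gamma> \<Longrightarrow> (\<And>t. t > t0 \<Longrightarrow> hl.uR (\<gamma> t) t < hl.uL (\<gamma> t) t) \<Longrightarrow> is_shock f \<phi> t0 \<gamma>"
  by (simp add: is_shock_def fwd_char_iff u_left_eq u_right_eq)

end

text \<open>Intervals shorter than \<open>X\<close> are left to the Lipschitz bound, which is where
  the additive constant comes from.\<close>

lemma uniform_mean_bound:
  fixes \<Phi> :: "real \<Rightarrow> real" and \<epsilon> :: real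
  assumes mean: "\<And>p q. p \<in> S \<Longrightarrow> q \<in> S \<Longrightarrow> p \<le> q \<Longrightarrow> X \<le> q - p \<Longrightarrow> \<bar>\<Phi> q - \<Phi> p - c * (q - p)\<bar> \<le> \<epsilon> * (q - p)"
    and lip: "\<And>x y. \<bar>\<Phi> x - \<Phi> y\<bar> \<le> C * \<bar>x - y\<bar>" and "\<epsilon> > 0"
  shows "\<exists>K. \<forall>p q. p \<in> S \<and> q \<in> S \<and> p \<le> q \<longrightarrow> \<bar>\<Phi> q - \<Phi> p - c * (q - p)\<bar> \<le> \<epsilon> * (q - p) + K"
proof (intro exI[of _ "(C + \<bar>c\<bar>) * \<bar>X\<bar>"] allI impI, elim conjE)
  fix p q assume pq: "p \<in> S" "q \<in> S" "p \<le> q"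
  have C: "0 \<le> C" using lip[of 1 0] by simp
  show "\<bar>\<Phi> q - \<Phi> p - c * (q - p)\<bar> \<le> \<epsilon> * (q - p) + (C + \<bar>c\<bar>) * \<bar>X\<bar>"
  proof (cases "X \<le> q - p")
    case True
    have "0 \<le> (C + \<bar>c\<bar>) * \<bar>X\<bar>" using C by simp
    then show ?thesis using mean[OF pq True] by linarith
  next
    case False
    have "\<bar>\<Phi> q - \<Phi> p - c * (q - p)\<bar> \<le> C * (q - p) + \<bar>c\<bar> * (q - p)"
      using lip[of q p] abs_triangle_ineq4[of "\<Phi> q - \<Phi> p" "c * (q - p)"] pq by (simp add: abs_mult)
    also have "\<dots> = (C + \<bar>c\<bar>) * (q - p)" by (simp add: algebra_simps)
    also have "\<dots> \<le> (C + \<bar>c\<bar>) * \<bar>X\<bar>" using C False by (intro mult_left_mono) auto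
    also have "\<dots> \<le> \<epsilon> * (q - p) + (C + \<bar>c\<bar>) * \<bar>X\<bar>" using \<open>\<epsilon> > 0\<close> pq by simp
    finally show ?thesis .
  qed
qed

theorem theorem7p3:
  fixes f \<phi> :: "real \<Rightarrow> real"
  assumes f_C2: "C2 f"
    and f_convex: "\<forall>s. deriv (deriv f) s \<ge> 0"
    and f_nondeg: "{s. deriv (deriv f) s = 0} \<in> null_sets lebesgue"
    and \<phi>_Linfty: "Linfty \<phi>"
    and ur_eq: "ur_sup \<phi> = ur_inf \<phi>"
    and ul_eq: "ul_sup \<phi> = ul_inf \<phi>"
    and mean_right: "uniform_limit {0::real..} (\<lambda>x y. (1 / x) * (LINT \<xi>=ereal y..ereal (y + x)|lebesgue. \<phi> \<xi>))
                       (\<lambda>y. ur_inf \<phi>) at_top"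
    and mean_left: "uniform_limit {..0::real} (\<lambda>x y. (1 / x) * (LINT \<xi>=ereal y..ereal (y + x)|lebesgue. \<phi> \<xi>))
                       (\<lambda>y. ul_sup \<phi>) at_bot"
  shows
   "((ul_sup \<phi> < ur_inf \<phi> \<or> (ul_sup \<phi> = ur_inf \<phi> \<and> K0 \<phi> \<noteq> {})) \<longrightarrow>
      (\<forall>x. Phi_hull \<phi> x \<noteq> -\<infinity>) \<and>
      UNIV \<times> {0<..} = K_set f \<phi> \<union> (\<Union>(e, h) \<in> gaps \<phi>. H_region f \<phi> e h) \<and>
      (\<forall>c x0. is_divide f \<phi> c x0 \<longrightarrow> x0 \<in> K0 \<phi> \<and>
         (\<forall>(x, t) \<in> ray f c x0.
            entropy_sol f \<phi> x t = entropy_sol f (hull_data \<phi>) x t \<and>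
            entropy_sol f \<phi> x t = inv (deriv f) ((x - x0) / t))) \<and>
      (\<forall>e h :: real. (ereal e, ereal h) \<in> gaps \<phi> \<longrightarrow>
         (\<forall>(x, t) \<in> H_region f \<phi> e h. entropy_sol f (hull_data \<phi>) x t = gap_slope \<phi> e h) \<and>
         tends_uniformly f \<phi> (H_region f \<phi> e h) (gap_slope \<phi> e h)) \<and>
      (\<forall>e :: real. (ereal e, \<infinity>) \<in> gaps \<phi> \<longrightarrow>
         (\<forall>(x, t) \<in> H_region f \<phi> e \<infinity>. entropy_sol f (hull_data \<phi>) x t = ur_inf \<phi>) \<and>
         tends_uniformly f \<phi> (H_region f \<phi> e \<infinity>) (ur_inf \<phi>)) \<and>
      (\<forall>h :: real. (-\<infinity>, ereal h) \<in> gaps \<phi> \<longrightarrow>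
         (\<forall>(x, t) \<in> H_region f \<phi> (-\<infinity>) h. entropy_sol f (hull_data \<phi>) x t = ul_sup \<phi>) \<and>
         tends_uniformly f \<phi> (H_region f \<phi> (-\<infinity>) h) (ul_sup \<phi>)))
    \<and>
    ((ul_sup \<phi> > ur_inf \<phi> \<or> (ul_sup \<phi> = ur_inf \<phi> \<and> K0 \<phi> = {})) \<longrightarrow>
      (\<exists>t0 \<gamma>. is_shock f \<phi> t0 \<gamma>) \<and>
      (\<forall>t1 \<gamma>1 t2 \<gamma>2. is_shock f \<phi> t1 \<gamma>1 \<and> is_shock f \<phi> t2 \<gamma>2 \<longrightarrow>
         (\<exists>T. \<forall>t\<ge>T. \<gamma>1 t = \<gamma>2 t)) \<and>
      (ul_sup \<phi> = ur_inf \<phi> \<longrightarrow> tends_uniformly f \<phi> (UNIV \<times> {0<..}) (ur_inf \<phi>)) \<and>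
      (ul_sup \<phi> > ur_inf \<phi> \<longrightarrow>
         (\<forall>x0. (\<exists>\<gamma>. fwd_char_axis f \<phi> x0 \<gamma>) \<and>
            (\<forall>\<gamma>. fwd_char_axis f \<phi> x0 \<gamma> \<longrightarrow>
               tends_uniformly f \<phi> {(x, t). t > 0 \<and> x < \<gamma> t} (ul_sup \<phi>) \<and>
               tends_uniformly f \<phi> {(x, t). t > 0 \<and> x > \<gamma> t} (ur_inf \<phi>)))))"
proof -
  obtain C where C: "\<phi> \<in> borel_measurable lebesgue" "AE x in lebesgue. \<bar>\<phi> x\<bar> \<le> C"
    using \<phi>_Linfty by (auto simp: Linfty_def)
  interpret bounded_data \<phi> C by unfold_locales (use C in auto)
  have mean: "(1 / x) * (LINT \<xi>=ereal y..ereal (y + x)|lebesgue. \<phi> \<xi>) = (Phi \<phi> (y + x) - Phi \<phi> y) / x" for x y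
    by (simp add: LINT_eq_Phi[OF phi_loc])
  note mr = mean_right[unfolded mean] and ml = mean_left[unfolded mean]
  have sr: "((\<lambda>x. Phi \<phi> x / x) \<longlongrightarrow> ur_inf \<phi>) at_top"
    using tendsto_uniform_limitI[OF mr, of 0] by (simp add: Phi_0)
  have sl: "((\<lambda>x. Phi \<phi> x / x) \<longlongrightarrow> ul_sup \<phi>) at_bot"
    using tendsto_uniform_limitI[OF ml, of 0] by (simp add: Phi_0)
  have "\<exists>K. \<forall>p q. 0 \<le> p \<and> p \<le> q \<longrightarrow> \<bar>Phi \<phi> q - Phi \<phi> p - ur_inf \<phi> * (q - p)\<bar> \<le> \<epsilon> * (q - p) + K"
    if \<epsilon>: "\<epsilon> > 0" for \<epsilon>
  proof -
    have "\<forall>\<^sub>F x in at_top. 0 < x \<and> (\<forall>y\<in>{0..}. dist ((Phi \<phi> (y + x) - Phi \<phi> y) / x) (ur_inf \<phi>) < \<epsilon>)"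
      by (rule eventually_conj[OF eventually_gt_at_top uniform_limitD[OF mr \<epsilon>]])
    then obtain X where X: "\<And>x y. x \<ge> X \<Longrightarrow> 0 < x \<and> (0 \<le> y \<longrightarrow> \<bar>(Phi \<phi> (y + x) - Phi \<phi> y) / x - ur_inf \<phi>\<bar> < \<epsilon>)"
      unfolding eventually_at_top_linorder by (auto simp: dist_real_def)
    have "\<bar>Phi \<phi> q - Phi \<phi> p - ur_inf \<phi> * (q - p)\<bar> \<le> \<epsilon> * (q - p)" if "p \<in> {0..}" "X \<le> q - p" for p q
    proof -
      have "0 < q - p" "\<bar>(Phi \<phi> q - Phi \<phi> p) / (q - p) - ur_inf \<phi>\<bar> < \<epsilon>" using X[OF that(2), of p] that(1) by auto
      then show ?thesis by (auto simp: abs_less_iff abs_le_iff field_simps)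
    qed
    then have "\<exists>K. \<forall>p q. p \<in> {0..} \<and> q \<in> {0..} \<and> p \<le> q \<longrightarrow>
        \<bar>Phi \<phi> q - Phi \<phi> p - ur_inf \<phi> * (q - p)\<bar> \<le> \<epsilon> * (q - p) + K"
      by (intro uniform_mean_bound[where X=X, OF _ Phi_lipschitz \<epsilon>]) blast
    then obtain K where "\<And>p q. p \<in> {0..} \<Longrightarrow> q \<in> {0..} \<Longrightarrow> p \<le> q \<Longrightarrow>
        \<bar>Phi \<phi> q - Phi \<phi> p - ur_inf \<phi> * (q - p)\<bar> \<le> \<epsilon> * (q - p) + K" by blast
    then show ?thesis by (intro exI[of _ K]) simp
  qed
  moreover have "\<exists>K. \<forall>p q. p \<le> q \<and> q \<le> 0 \<longrightarrow> \<bar>Phi \<phi> q - Phi \<phi> p - ul_sup \<phi> * (q - p)\<bar> \<le> \<epsilon> * (q - p) + K"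
    if \<epsilon>: "\<epsilon> > 0" for \<epsilon>
  proof -
    have "\<forall>\<^sub>F x in at_bot. x < 0 \<and> (\<forall>y\<in>{..0}. dist ((Phi \<phi> (y + x) - Phi \<phi> y) / x) (ul_sup \<phi>) < \<epsilon>)"
      by (rule eventually_conj[OF eventually_gt_at_bot uniform_limitD[OF ml \<epsilon>]])
    then obtain X where X: "\<And>x y. x \<le> X \<Longrightarrow> x < 0 \<and> (y \<le> 0 \<longrightarrow> \<bar>(Phi \<phi> (y + x) - Phi \<phi> y) / x - ul_sup \<phi>\<bar> < \<epsilon>)"
      unfolding eventually_at_bot_linorder by (auto simp: dist_real_def)
    have "\<bar>Phi \<phi> q - Phi \<phi> p - ul_sup \<phi> * (q - p)\<bar> \<le> \<epsilon> * (q - p)" if "q \<in> {..0}" "- X \<le> q - p" for p q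
    proof -
      \<comment> \<open>The interval is traversed leftwards from \<open>q\<close>, with the negative
        number \<open>p - q\<close> as increment, since the hypothesis is uniform over the point
        where the traversal starts.\<close>
      have "p - q \<le> X" using that by simp
      then have "0 < q - p" "\<bar>(Phi \<phi> p - Phi \<phi> q) / (p - q) - ul_sup \<phi>\<bar> < \<epsilon>" using X[of "p - q" q] that(1) by auto
      moreover have "(Phi \<phi> p - Phi \<phi> q) / (p - q) = (Phi \<phi> q - Phi \<phi> p) / (q - p)"
        by (metis minus_diff_eq minus_divide_divide)
      ultimately show ?thesis by (auto simp: abs_less_iff abs_le_iff field_simps)
    qed
    then have "\<exists>K. \<forall>p q. p \<in> {..0} \<and> q \<in> {..0} \<and> p \<le> q \<longrightarrow>
        \<bar>Phi \<phi> q - Phi \<phi> p - ul_sup \<phi> * (q - p)\<bar> \<le> \<epsilon> * (q - p) + K"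
      by (intro uniform_mean_bound[where X="- X", OF _ Phi_lipschitz \<epsilon>]) blast
    then obtain K where "\<And>p q. p \<in> {..0} \<Longrightarrow> q \<in> {..0} \<Longrightarrow> p \<le> q \<Longrightarrow>
        \<bar>Phi \<phi> q - Phi \<phi> p - ul_sup \<phi> * (q - p)\<bar> \<le> \<epsilon> * (q - p) + K" by blast
    then show ?thesis by (intro exI[of _ K]) simp
  qed
  ultimately interpret conservation_law f \<phi> C
    by unfold_locales (use f_C2 f_convex f_nondeg sr sl in auto)
  \<comment> \<open>A support slope \<open>c\<close> satisfies \<open>l \<le> c \<le> r\<close>, so
    there is none if \<open>l > r\<close>; if \<open>l = r\<close>, an empty \<open>K0\<close>
    excludes it.\<close>
  have no_supports: "\<not> supports (Phi \<phi>) c y" if "l > r \<or> l = r \<and> K0 \<phi> = {}" for c y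
    using that supports_le_slope[OF _ sr] supports_ge_slope[OF _ sl] K0_supports by fastforce
  have ne: "K0 \<phi> \<noteq> {}" if "l < r \<or> l = r \<and> K0 \<phi> \<noteq> {}"
    using that supports_exists[OF cont_Phi sr sl] K0_supports by blast
  show ?thesis
  proof (rule conjI[OF impI impI], goal_cases)
    case 1
    note ne = ne[OF 1]
    show ?case
    proof (intro conjI allI impI, goal_cases)
      case (1 x)
      show ?case by (subst hull_real[OF ne]) simp
    next
      case 2
      then show ?case by (rule half_plane_eq[OF ne])
    next
      case (3 c y)
      then show ?case by (simp add: is_divide_iff K0_supports)
    next
      case (4 c y)
      then show ?case using divide_sol by blast
    next
      case (5 e h)
      then show ?case using bounded_gap_hull_sol by blast
    next
      case (6 e h)
      then show ?case by (rule bounded_gap_uniform)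
    next
      case (7 e)
      then show ?case using right_gap_hull_sol by blast
    next
      case (8 e)
      then show ?case by (rule right_gap_uniform)
    next
      case (9 h)
      then show ?case using left_gap_hull_sol by blast
    next
      case (10 h)
      then show ?case by (rule left_gap_uniform)
    qed
  next
    case 2
    note none = no_supports[OF 2]
    show ?case
    proof (intro conjI allI impI, goal_cases)
      case 1
      then show ?case using hl.shock_exists[OF none] is_shockI by metis
    next
      case (2 t1 \<gamma>1 t2 \<gamma>2)
      then show ?case using hl.chains_merge[OF _ _ none] shock_chain by metis
    next
      case 3
      then show ?case by (rule uniform_everywhere)
    next
      case (4 x0)
      then show ?case using hl.chain_exists[of 0 x0] fwd_char_axis_iff by (metis order_refl)
    next
      case (5 x0 \<gamma>)
      then show ?case by (intro char_uniform_left) (auto simp: fwd_char_axis_iff)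
    next
      case (6 x0 \<gamma>)
      then show ?case by (intro char_uniform_right) (auto simp: fwd_char_axis_iff)
    qed
  qed
qed

end
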